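(* Assume there exists a deformation of an irreducible plane curve singularity with semigroup $\Gamma_K$ to an irreducible plane curve singularity with semigroup $\Gamma_L$. Then for each non-negative integer $n$, \[ \#(\Gamma_K\cap[0,n)) \le \#(\Gamma_L\cap[0,n)). \]
   Context: An isolated irreducible plane curve singularity (cusp) is given by a polynomial $F\in\mathbb{C}[x,y]$ with an isolated singular point (say at the origin) at which the germ of $\{F=0\}$ is irreducible. Its link is the knot obtained by intersecting $\{F=0\}$ with a sufficiently small 3-sphere centred at the singular point. The zero set of $F$ near the singular point has a parametrization $t\mapsto(x(t),y(t))$, $x(t),y(t)\in\mathbb{C}[[t]]$, with $F(x(t),y(t))\equiv0$, which is a bijection from $\{|t|<\eta\}$, $\eta\ll 1$, onto a neighbourhood of the singular point in $\{F=0\}$. If $K$ is the link of the singularity, its semigroup is $\Gamma_K=\{\mathrm{ord}_t\,G(x(t),y(t))\mid G\in\mathbb{C}[[x,y]],\ F\nmid G\}\subset\mathbb{N}=\{0,1,2,\dots\}$ (divisibility in the power series ring at the singular point). Deformations: a deformation of a singularity with link $K$ is an analytic family $\{F_s\}$ of polynomials in $\mathbb{C}[x,y]$, parametrised by $s\in\mathbb{C}$, $|s|<1$, where $F_0$ defines the given singularity at the origin, such that there is a ball $B\subset\mathbb{C}^2$ with the following properties: (1) the only singular point of $\{F_0=0\}$ inside $B$ is at the origin; (2) $\{F_s=0\}$ intersects $\partial B$ transversely and $\{F_s=0\}\cap\partial B$ is isotopic to $K$ for every $|s|<1$; (3) the zero set of $F_s$ has only isolated singular points in $B$ for every $|s|<1$;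 (4) all the singular points of $\{F_s=0\}$ inside $B$ are irreducible for every $|s|<1$; (5) all fibres $\{F_s=0\}$ with $s\ne0$ have the same collection of local analytic types of singularities. It is moreover assumed that for each $s$ there is only one singular point of $\{F_s=0\}$ inside $B$. If such a family exists, the singularity of $F_0$ at the origin is said to have a deformation to the singularity of $F_{1/2}$ (in $B$). *)

theory Defs
  imports
    "HOL-Analysis.Analysis"
    "HOL-Computational_Algebra.Computational_Algebra"
begin

section \<open>Plane curves\<close>

text \<open>
  A polynomial in \<open>\<complex>[x,y]\<close> is an element of \<^typ>\<open>complex poly poly\<close>: the outer
  variable is \<open>y\<close>, the coefficients are polynomials in \<open>x\<close>. Likewise \<open>\<complex>[[x,y]]\<close> is
  \<^typ>\<open>complex fps fps\<close>, read as \<open>\<complex>[[x]][[y]]\<close>. The type \<^typ>\<open>complex \<times> complex\<close>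
  carries the Euclidean norm and the real inner product of \<open>\<real>\<^sup>4\<close>.
\<close>

definition eval2 :: "complex poly poly \<Rightarrow> complex \<times> complex \<Rightarrow> complex" where
  "eval2 F z = poly (poly F [:snd z:]) (fst z)"

definition pderiv_x :: "complex poly poly \<Rightarrow> complex poly poly" where
  "pderiv_x F = map_poly pderiv F"

definition pderiv_y :: "complex poly poly \<Rightarrow> complex poly poly" where
  "pderiv_y F = pderiv F"

definition zero_set :: "complex poly poly \<Rightarrow> (complex \<times> complex) set" where
  "zero_set F = {z. eval2 F z = 0}"

definition sing_points :: "complex poly poly \<Rightarrow> (complex \<times> complex) set" where
  "sing_points F = {z \<in> zero_set F. eval2 (pderiv_x F) z = 0 \<and> eval2 (pderiv_y F) z = 0}"

text \<open>The expansion \<open>F(a + x, b + y)\<close> of \<open>F\<close> at \<open>p = (a, b)\<close>, as a power series.\<close>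

definition translate2 :: "complex \<times> complex \<Rightarrow> complex poly poly \<Rightarrow> complex poly poly" where
  "translate2 p F = pcompose (map_poly (\<lambda>c. pcompose c [:fst p, 1:]) F) [:[:snd p:], 1:]"

definition fps2_at :: "complex poly poly \<Rightarrow> complex \<times> complex \<Rightarrow> complex fps fps" where
  "fps2_at F p = fps_of_poly (map_poly fps_of_poly (translate2 p F))"

text \<open>
  An isolated singular point at which the germ of \<open>{F = 0}\<close> is irreducible. Irreducibility of
  the germ means irreducibility of its equation in the power series ring at the point (\<open>F\<close> is
  automatically reduced there, the singular point being isolated).
\<close>

definition cusp :: "complex poly poly \<Rightarrow> complex \<times> complex \<Rightarrow> bool" where
  "cusp F p \<longleftrightarrow> p isolated_in sing_points F \<and> irreducible (fps2_at F p)"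

section \<open>Parametrizations and the semigroup\<close>

text \<open>
  \<open>G(X(t), Y(t))\<close> for \<open>G \<in> \<complex>[[x,y]]\<close> and series \<open>X\<close>, \<open>Y\<close> without constant term. The coefficient
  of \<open>t\<^sup>n\<close> in \<open>\<Sum>j. G\<^sub>j(X(t)) Y(t)\<^sup>j\<close> only involves the terms with \<open>j \<le> n\<close>, because \<open>Y\<close> has positive
  order; compare \<open>fps_compose_def\<close>.
\<close>

definition fps2_compose :: "complex fps fps \<Rightarrow> complex fps \<Rightarrow> complex fps \<Rightarrow> complex fps" where
  "fps2_compose G X Y = Abs_fps (\<lambda>n. \<Sum>j\<le>n. fps_nth (fps_compose (fps_nth G j) X * Y ^ j) n)"

text \<open>
  The parametrization of \<open>{F = 0}\<close> near \<open>p\<close> is \<open>t \<mapsto> p + (X(t), Y(t))\<close>, with \<open>X\<close> and \<open>Y\<close> in the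
  coordinates centred at \<open>p\<close>. For all small radii it is a bijection from the disc onto a
  neighbourhood of \<open>p\<close> in \<open>{F = 0}\<close>.
\<close>

definition parametrization ::
    "complex poly poly \<Rightarrow> complex \<times> complex \<Rightarrow> complex fps \<Rightarrow> complex fps \<Rightarrow> bool" where
  "parametrization F p X Y \<longleftrightarrow>
     fps_nth X 0 = 0 \<and> fps_nth Y 0 = 0 \<and>
     fps2_compose (fps2_at F p) X Y = 0 \<and>
     (\<forall>\<^sub>F \<eta> in at_right 0.
        ereal \<eta> \<le> fps_conv_radius X \<and> ereal \<eta> \<le> fps_conv_radius Y \<and>
        (\<exists>N U. bij_betw (\<lambda>t. p + (eval_fps X t, eval_fps Y t)) (ball 0 \<eta>) N \<and>
               N \<subseteq> zero_set F \<and> open U \<and> p \<in> U \<and> U \<inter> zero_set F \<subseteq> N))"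

text \<open>
  \<open>\<Gamma>\<close> is the semigroup of the singularity of \<open>F\<close> at \<open>p\<close>. The order in \<open>t\<close> is \<^const>\<open>subdegree\<close>.
\<close>

definition has_semigroup :: "complex poly poly \<Rightarrow> complex \<times> complex \<Rightarrow> nat set \<Rightarrow> bool" where
  "has_semigroup F p \<Gamma> \<longleftrightarrow>
     (\<exists>X Y. parametrization F p X Y \<and>
            \<Gamma> = {subdegree (fps2_compose G X Y) | G. \<not> fps2_at F p dvd G})"

section \<open>Local analytic types\<close>

definition analytic2_at ::
    "(complex \<times> complex \<Rightarrow> complex) \<Rightarrow> complex \<times> complex \<Rightarrow> bool" where
  "analytic2_at f p \<longleftrightarrow>
     (\<exists>A :: complex fps fps. \<forall>\<^sub>F h in nhds (0, 0).
        ((\<lambda>(i, j). fps_nth (fps_nth A j) i * fst h ^ i * snd h ^ j) has_sum f (p + h)) UNIV)"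

definition analytic_map_at ::
    "(complex \<times> complex \<Rightarrow> complex \<times> complex) \<Rightarrow> complex \<times> complex \<Rightarrow> bool" where
  "analytic_map_at \<phi> p \<longleftrightarrow> analytic2_at (\<lambda>z. fst (\<phi> z)) p \<and> analytic2_at (\<lambda>z. snd (\<phi> z)) p"

text \<open>
  Two curve germs have the same local analytic type if a germ of a biholomorphic map of the
  ambient plane carries one onto the other.
\<close>

definition same_analytic_type ::
    "complex poly poly \<Rightarrow> complex \<times> complex \<Rightarrow> complex poly poly \<Rightarrow> complex \<times> complex \<Rightarrow> bool" where
  "same_analytic_type F p G q \<longleftrightarrow>
     (\<exists>\<phi> \<psi>. \<phi> p = q \<and> \<psi> q = p \<and> analytic_map_at \<phi> p \<and> analytic_map_at \<psi> q \<and>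
        (\<forall>\<^sub>F z in nhds p. \<psi> (\<phi> z) = z \<and> (z \<in> zero_set F \<longleftrightarrow> \<phi> z \<in> zero_set G)) \<and>
        (\<forall>\<^sub>F w in nhds q. \<phi> (\<psi> w) = w))"

section \<open>Links\<close>

text \<open>
  The intersection of \<open>{F = 0}\<close> with the sphere of centre \<open>c\<close> and radius \<open>r\<close>, moved to the unit
  sphere by a translation and a dilation so that links in different spheres can be compared.
\<close>

definition sphere_section ::
    "complex poly poly \<Rightarrow> complex \<times> complex \<Rightarrow> real \<Rightarrow> (complex \<times> complex) set" where
  "sphere_section F c r = (\<lambda>z. (z - c) /\<^sub>R r) ` (zero_set F \<inter> sphere c r)"

definition isotopic_links :: "(complex \<times> complex) set \<Rightarrow> (complex \<times> complex) set \<Rightarrow> bool" where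
  "isotopic_links K L \<longleftrightarrow>
     (\<exists>h :: real \<times> (complex \<times> complex) \<Rightarrow> complex \<times> complex.
        continuous_on ({0..1} \<times> sphere 0 1) h \<and>
        (\<forall>t\<in>{0..1}. \<exists>g. homeomorphism (sphere 0 1) (sphere 0 1) (\<lambda>z. h (t, z)) g) \<and>
        (\<forall>z\<in>sphere 0 1. h (0, z) = z) \<and>
        (\<lambda>z. h (1, z)) ` K = L)"

text \<open>
  Transversality at \<open>z\<close>: the curve is smooth there and its tangent line, the kernel of the
  differential, spans the whole of \<open>\<real>\<^sup>4\<close> together with the tangent space of the sphere.
\<close>

definition transverse_to_sphere ::
    "complex poly poly \<Rightarrow> complex \<times> complex \<Rightarrow> real \<Rightarrow> bool" where
  "transverse_to_sphere F c r \<longleftrightarrow>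
     (\<forall>z \<in> zero_set F \<inter> sphere c r.
        z \<notin> sing_points F \<and>
        {v + w | v w. eval2 (pderiv_x F) z * fst v + eval2 (pderiv_y F) z * snd v = 0 \<and>
                      (z - c) \<bullet> w = 0} = UNIV)"

section \<open>Deformations\<close>

text \<open>
  Analyticity of the family is expressed through its coefficients. No uniform bound on the
  degrees is imposed.
\<close>

definition analytic_family :: "(complex \<Rightarrow> complex poly poly) \<Rightarrow> bool" where
  "analytic_family F \<longleftrightarrow> (\<forall>i j. (\<lambda>s. coeff (coeff (F s) j) i) holomorphic_on ball 0 1)"

text \<open>
  \<open>F\<close> is a deformation of the singularity of \<open>F 0\<close> at the origin, in the ball \<open>B = ball c r\<close>.
  The ball need not be centred at the origin. The link of that singularity is
  \<open>sphere_section (F 0) 0 \<epsilon>\<close> for all sufficiently small \<open>\<epsilon>\<close>. The last clause is the standing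
  assumption that every fibre has exactly one singular point in \<open>B\<close>.
\<close>

definition deformation ::
    "(complex \<Rightarrow> complex poly poly) \<Rightarrow> complex \<times> complex \<Rightarrow> real \<Rightarrow> bool" where
  "deformation F c r \<longleftrightarrow>
     analytic_family F \<and> cusp (F 0) 0 \<and> r > 0 \<and>
     sing_points (F 0) \<inter> ball c r = {0} \<and>
     (\<forall>s\<in>ball 0 1. transverse_to_sphere (F s) c r \<and>
        (\<forall>\<^sub>F \<epsilon> in at_right 0.
           isotopic_links (sphere_section (F s) c r) (sphere_section (F 0) 0 \<epsilon>))) \<and>
     (\<forall>s\<in>ball 0 1. \<forall>p \<in> sing_points (F s) \<inter> ball c r. p isolated_in sing_points (F s)) \<and>
     (\<forall>s\<in>ball 0 1. \<forall>p \<in> sing_points (F s) \<inter> ball c r. irreducible (fps2_at (F s) p)) \<and>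
     (\<forall>s\<in>ball 0 1 - {0}. \<forall>s'\<in>ball 0 1 - {0}.
        \<exists>f. bij_betw f (sing_points (F s) \<inter> ball c r) (sing_points (F s') \<inter> ball c r) \<and>
            (\<forall>p \<in> sing_points (F s) \<inter> ball c r. same_analytic_type (F s) p (F s') (f p))) \<and>
     (\<forall>s\<in>ball 0 1. \<exists>!p. p \<in> sing_points (F s) \<inter> ball c r)"

text \<open>
  The singularity of \<open>f\<close> at the origin has a deformation to the singularity of \<open>g\<close> at \<open>q\<close>.
\<close>

definition deforms_to ::
    "complex poly poly \<Rightarrow> complex poly poly \<Rightarrow> complex \<times> complex \<Rightarrow> bool" where
  "deforms_to f g q \<longleftrightarrow>
     (\<exists>F c r. deformation F c r \<and> F 0 = f \<and> F (1/2) = g \<and> q \<in> sing_points g \<inter> ball c r)"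

end

theory Submission
  imports Defs "HOL-Complex_Analysis.Complex_Analysis"
begin

text \<open>
  Orders along a branch are intersection multiplicities, and these are upper semicontinuous.
  Suppose \<open>\<Gamma>\<^sub>K\<close> had more elements below \<open>n\<close> than \<open>\<Gamma>\<^sub>L\<close>. Choose polynomials \<open>G\<^sub>e\<close> whose order on the
  central branch is \<open>e\<close>, for \<open>e \<in> \<Gamma>\<^sub>K\<close>, \<open>e < n\<close>. Along the singular branch of a nearby fibre,
  which is analytically equivalent to \<open>L\<close>, all orders lie in \<open>\<Gamma>\<^sub>L\<close>, so by counting dimensions some
  normalized combination of the \<open>G\<^sub>e\<close> has order at least \<open>n\<close> there. A limit of these combinations
  as \<open>s \<rightarrow> 0\<close> has order less than \<open>n\<close> on the central branch.

  This contradicts semicontinuity, which is seen on the norm \<open>R(x) = \<Prod> G(x, y)\<close>, the product being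
  over the small roots \<open>y\<close> of \<open>F(x, \<cdot>)\<close>. By the argument principle and Newton's identities, \<open>R\<close> is
  holomorphic and depends continuously on \<open>F\<close> and \<open>G\<close>. On the nearby fibres it vanishes to order
  at least \<open>n\<close>, so by the Schwarz lemma it is \<open>O(|x - x\<^sub>s|\<^sup>n)\<close> with a uniform constant, and this bound
  survives in the limit.
\<close>

section \<open>Polynomial functions of two variables\<close>

text \<open>Only one parametrization serves all the nearby fibres: that of the fibre at 1/2, pushed
  through the biholomorphisms given by equality of analytic types. Hence all their orders lie in one
  and the same semigroup. The test functions are polynomials because they must be evaluated on
  branches based at moving points, where a formal power series at the origin has no meaning.

  The obstacle is uniformity. The disc on which a transported branch is defined, and the constant in
  its bound of order \<open>n\<close>, depend on the fibre without control. The norm lives on a disc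
  in \<open>x\<close> common to the nearby fibres and is bounded there by a common constant, so that
  the mere order of vanishing yields a uniform estimate. A transported branch need not carry all the
  small roots; those off it cost only a bounded factor. On the central fibre, by contrast, for small
  \<open>x \<noteq> 0\<close> every small root lies on the branch and is simple, so the norm is
  bounded below with the exact exponent. No change of coordinates is made: the branch is not
  vertical, because \<open>x\<close> cannot divide an irreducible equation of a singular
  germ.\<close>

definition pfun :: "nat \<Rightarrow> (nat \<Rightarrow> nat \<Rightarrow> complex) \<Rightarrow> complex \<Rightarrow> complex \<Rightarrow> complex" where
  "pfun D a x y = (\<Sum>i\<le>D. \<Sum>j\<le>D. a i j * x ^ i * y ^ j)"

text \<open>Entries outside the box of side \<open>D\<close> are invisible to
  \<open>pfun D a\<close>; the cutoff keeps the shifted array from reading the entry at index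
  \<open>D + 1\<close>.\<close>

definition coeff_dx :: "nat \<Rightarrow> (nat \<Rightarrow> nat \<Rightarrow> complex) \<Rightarrow> nat \<Rightarrow> nat \<Rightarrow> complex" where
  "coeff_dx D a i j = (if i < D then of_nat (Suc i) * a (Suc i) j else 0)"

definition coeff_dy :: "nat \<Rightarrow> (nat \<Rightarrow> nat \<Rightarrow> complex) \<Rightarrow> nat \<Rightarrow> nat \<Rightarrow> complex" where
  "coeff_dy D a i j = (if j < D then of_nat (Suc j) * a i (Suc j) else 0)"

lemma sum_pow_derivative_shift:
  fixes c :: "nat \<Rightarrow> complex"
  shows "(\<Sum>i\<le>D. c i * (of_nat i * x ^ (i - 1))) =
         (\<Sum>i\<le>D. (if i < D then of_nat (Suc i) * c (Suc i) else 0) * x ^ i)"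
proof (cases D)
  case (Suc d)
  have "(\<Sum>i\<le>Suc d. c i * (of_nat i * x ^ (i - 1))) = (\<Sum>i\<le>d. c (Suc i) * (of_nat (Suc i) * x ^ i))"
    by (subst sum.atMost_Suc_shift) simp
  also have "\<dots> = (\<Sum>i\<le>Suc d. (if i < Suc d then of_nat (Suc i) * c (Suc i) else 0) * x ^ i)"
    by (simp, intro sum.cong) (auto simp: algebra_simps)
  finally show ?thesis using Suc by simp
qed simp

lemma pfun_swap: "pfun D a x y = (\<Sum>j\<le>D. (\<Sum>i\<le>D. a i j * x ^ i) * y ^ j)"
  unfolding pfun_def by (subst sum.swap) (simp add: sum_distrib_right)

lemma pfun_alt: "pfun D a x y = (\<Sum>i\<le>D. (\<Sum>j\<le>D. a i j * y ^ j) * x ^ i)"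
  unfolding pfun_def by (simp add: sum_distrib_left mult_ac)

lemma DERIV_pfun_y:
  "((\<lambda>y. pfun D a x y) has_field_derivative pfun D (coeff_dy D a) x y) (at y within S)"
proof -
  have "((\<lambda>y. \<Sum>j\<le>D. (\<Sum>i\<le>D. a i j * x ^ i) * y ^ j) has_field_derivative
     (\<Sum>j\<le>D. (\<Sum>i\<le>D. a i j * x ^ i) * (of_nat j * y ^ (j - 1)))) (at y within S)"
    by (auto intro!: derivative_eq_intros sum.cong simp: mult_ac)
  also have "(\<Sum>j\<le>D. (\<Sum>i\<le>D. a i j * x ^ i) * (of_nat j * y ^ (j - 1))) = pfun D (coeff_dy D a) x y"
    by (subst sum_pow_derivative_shift)
       (auto simp: pfun_swap coeff_dy_def sum_distrib_left mult_ac intro!: sum.cong)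
  finally show ?thesis by (simp add: pfun_swap)
qed

lemma DERIV_pfun_x:
  "((\<lambda>x. pfun D a x y) has_field_derivative pfun D (coeff_dx D a) x y) (at x within S)"
proof -
  have "((\<lambda>x. \<Sum>i\<le>D. (\<Sum>j\<le>D. a i j * y ^ j) * x ^ i) has_field_derivative
     (\<Sum>i\<le>D. (\<Sum>j\<le>D. a i j * y ^ j) * (of_nat i * x ^ (i - 1)))) (at x within S)"
    by (auto intro!: derivative_eq_intros sum.cong simp: mult_ac)
  also have "(\<Sum>i\<le>D. (\<Sum>j\<le>D. a i j * y ^ j) * (of_nat i * x ^ (i - 1))) = pfun D (coeff_dx D a) x y"
    by (subst sum_pow_derivative_shift)
       (auto simp: pfun_alt coeff_dx_def sum_distrib_left mult_ac intro!: sum.cong)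
  finally show ?thesis by (simp add: pfun_alt)
qed

lemma continuous_on_pfun [continuous_intros]:
  assumes "continuous_on S f" "continuous_on S g"
  shows "continuous_on S (\<lambda>z. pfun D a (f z) (g z))"
  unfolding pfun_def by (intro continuous_intros assms)

lemma holomorphic_on_pfun [holomorphic_intros]:
  assumes "f holomorphic_on S" "g holomorphic_on S"
  shows "(\<lambda>z. pfun D a (f z) (g z)) holomorphic_on S"
  unfolding pfun_def by (intro holomorphic_intros assms)

lemma tendsto_pfun [tendsto_intros]:
  assumes "\<And>i j. ((\<lambda>k. a k i j) \<longlongrightarrow> a0 i j) F" "(f \<longlongrightarrow> x) F" "(g \<longlongrightarrow> y) F"
  shows "((\<lambda>k. pfun D (a k) (f k) (g k)) \<longlongrightarrow> pfun D a0 x y) F"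
  unfolding pfun_def by (intro tendsto_intros assms)

lemma tendsto_coeff_dx [tendsto_intros]:
  assumes "\<And>i j. ((\<lambda>k. a k i j) \<longlongrightarrow> a0 i j) F"
  shows "((\<lambda>k. coeff_dx D (a k) i j) \<longlongrightarrow> coeff_dx D a0 i j) F"
  unfolding coeff_dx_def by (auto intro!: tendsto_intros assms)

lemma tendsto_coeff_dy [tendsto_intros]:
  assumes "\<And>i j. ((\<lambda>k. a k i j) \<longlongrightarrow> a0 i j) F"
  shows "((\<lambda>k. coeff_dy D (a k) i j) \<longlongrightarrow> coeff_dy D a0 i j) F"
  unfolding coeff_dy_def by (auto intro!: tendsto_intros assms)

lemma norm_pfun_le:
  assumes "norm x \<le> 1" "norm y \<le> 1"
  shows "norm (pfun D a x y) \<le> (\<Sum>i\<le>D. \<Sum>j\<le>D. norm (a i j))"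
  unfolding pfun_def
proof (intro order.trans[OF norm_sum] sum_mono)
  fix i j
  have "norm (x ^ i) * norm (y ^ j) \<le> 1"
    using assms by (intro mult_le_one) (auto simp: norm_power power_le_one)
  then have "norm (a i j) * (norm (x ^ i) * norm (y ^ j)) \<le> norm (a i j) * 1"
    by (intro mult_left_mono) auto
  then show "norm (a i j * x ^ i * y ^ j) \<le> norm (a i j)"
    by (simp add: norm_mult mult_ac)
qed

lemma pfun_diff: "pfun D a x y - pfun D b x y = pfun D (\<lambda>i j. a i j - b i j) x y"
  unfolding pfun_def by (simp add: sum_subtractf algebra_simps)

lemma finite_roots_pfun:
  assumes "pfun D a x y0 \<noteq> 0"
  shows "finite {y. pfun D a x y = 0}"
proof -
  define p where "p = (\<Sum>j\<le>D. monom (\<Sum>i\<le>D. a i j * x ^ i) j)"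
  have p: "poly p y = pfun D a x y" for y
    by (simp add: p_def poly_sum poly_monom pfun_swap)
  then have "p \<noteq> 0" using assms by auto
  then have "finite {y. poly p y = 0}" by (rule poly_roots_finite)
  then show ?thesis by (simp add: p)
qed

section \<open>Newton's identities\<close>

text \<open>Newton's identities \<open>(k+1) e(k+1) = \<Sum>i\<le>k. (-1)^i e(k-i) p(i+1)\<close>,
  solved for the elementary symmetric functions. The result is a polynomial in the power sums, so it
  inherits holomorphy and convergence from them.\<close>

fun newton_esym :: "(nat \<Rightarrow> complex) \<Rightarrow> nat \<Rightarrow> complex" where
  "newton_esym p 0 = 1"
| "newton_esym p (Suc k) = (\<Sum>i\<le>k. (-1) ^ i * newton_esym p (k - i) * p (Suc i)) / of_nat (Suc k)"

text \<open>\<open>E Z\<close> generates the elementary symmetric functions of the values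
  \<open>g z\<close>, counted with multiplicity. Its logarithmic derivative \<open>Q Z\<close> has
  the signed power sums as coefficients, and comparing coefficients in \<open>E' = E Q\<close> is
  the recursion.\<close>

lemma newton_esym_eq_fps_nth:
  fixes g :: "'a \<Rightarrow> complex" and m :: "'a \<Rightarrow> nat"
  assumes "finite Z"
  defines "p \<equiv> \<lambda>j. \<Sum>z\<in>Z. of_nat (m z) * g z ^ j"
  shows "fps_nth (\<Prod>z\<in>Z. (1 + fps_const (g z) * fps_X) ^ m z) k = newton_esym p k"
proof -
  define E where "E Z = (\<Prod>z\<in>Z. (1 + fps_const (g z) * fps_X :: complex fps) ^ m z)" for Z
  \<comment> \<open>The inverse of \<open>1 + g z X\<close>, written out so that no division of
    series is required.\<close>
  define geo where "geo z = Abs_fps (\<lambda>i. (- g z) ^ i)" for z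
  define Q where "Q Z = (\<Sum>z\<in>Z. of_nat (m z) * fps_const (g z) * geo z)" for Z
  have geo: "(1 + fps_const (g z) * fps_X) * geo z = 1" for z
  proof (rule fps_ext)
    fix n show "fps_nth ((1 + fps_const (g z) * fps_X) * geo z) n = fps_nth 1 n"
      by (cases n) (auto simp: geo_def ring_distribs mult.assoc)
  qed
  have single: "fps_deriv ((1 + fps_const (g z) * fps_X) ^ n) =
      (1 + fps_const (g z) * fps_X) ^ n * (of_nat n * fps_const (g z) * geo z)" for z n
  proof (cases n)
    case (Suc k)
    define A where "A = 1 + fps_const (g z) * fps_X"
    have "fps_deriv A = fps_const (g z)" by (simp add: A_def)
    then have "fps_deriv (A ^ n) = of_nat n * fps_const (g z) * A ^ k"
      using Suc by (simp only: fps_deriv_power fps_of_nat diff_Suc_1)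
    then have "fps_deriv ((1 + fps_const (g z) * fps_X) ^ n) =
        of_nat n * fps_const (g z) * (1 + fps_const (g z) * fps_X) ^ k" by (simp only: A_def)
    also have "\<dots> = of_nat n * fps_const (g z) * (1 + fps_const (g z) * fps_X) ^ k *
        ((1 + fps_const (g z) * fps_X) * geo z)" by (simp add: geo)
    also have "\<dots> = (1 + fps_const (g z) * fps_X) ^ n * (of_nat n * fps_const (g z) * geo z)"
      using Suc by (simp add: mult_ac)
    finally show ?thesis .
  qed simp
  have dE: "fps_deriv (E Z) = E Z * Q Z"
    using assms(1)
  proof (induction Z rule: finite_induct)
    case empty then show ?case by (simp add: E_def Q_def)
  next
    case (insert z Z)
    have "E (insert z Z) = (1 + fps_const (g z) * fps_X) ^ m z * E Z"
      using insert by (simp add: E_def)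
    moreover have "Q (insert z Z) = of_nat (m z) * fps_const (g z) * geo z + Q Z"
      using insert by (simp add: Q_def)
    ultimately show ?case
      using insert.IH by (simp only: fps_deriv_mult single) (simp only: ring_distribs mult_ac add_ac)
  qed
  have Qn: "fps_nth (Q Z) i = (-1) ^ i * p (Suc i)" for i
  proof -
    have "fps_nth (Q Z) i = (\<Sum>z\<in>Z. of_nat (m z) * (g z * (- g z) ^ i))"
      by (simp add: Q_def fps_sum_nth geo_def fps_of_nat[symmetric] mult.assoc del: fps_const_mult)
    also have "\<dots> = (-1) ^ i * p (Suc i)"
      unfolding p_def sum_distrib_left
    proof (rule sum.cong, goal_cases)
      case (2 z)
      have "(- g z) ^ i = (-1) ^ i * g z ^ i" by (rule power_minus)
      then show ?case by simp
    qed simp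
    finally show ?thesis .
  qed
  have "fps_nth (E Z) k = newton_esym p k"
  proof (induction k rule: less_induct)
    case (less k)
    show ?case
    proof (cases k)
      case 0
      have "fps_nth (E Z) 0 = 1"
        using assms(1) unfolding E_def by (induction Z rule: finite_induct) (auto simp: fps_power_zeroth)
      then show ?thesis using 0 by simp
    next
      case (Suc l)
      have "of_nat (Suc l) * fps_nth (E Z) (Suc l) = fps_nth (fps_deriv (E Z)) l"
        by simp
      also have "\<dots> = fps_nth (Q Z * E Z) l"
        by (simp only: dE mult.commute)
      also have "\<dots> = (\<Sum>i\<le>l. (-1) ^ i * newton_esym p (l - i) * p (Suc i))"
        unfolding fps_mult_nth atLeast0AtMost
        using less Suc by (intro sum.cong) (auto simp: Qn mult_ac)
      finally show ?thesis using Suc by (simp add: field_simps del: of_nat_Suc)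
    qed
  qed
  then show ?thesis by (simp add: E_def)
qed

text \<open>Stated with degree bounds instead of degrees, because a factor \<open>1 + c X\<close>
  drops to degree 0 when \<open>c = 0\<close>.\<close>

lemma coeff_mult_top:
  fixes p q :: "'a::comm_semiring_0 poly"
  assumes "degree p \<le> a" "degree q \<le> b"
  shows "coeff (p * q) (a + b) = coeff p a * coeff q b"
proof -
  have "coeff (p * q) (a + b) = (\<Sum>i\<le>a + b. coeff p i * coeff q (a + b - i))"
    by (simp add: coeff_mult)
  also have "\<dots> = (\<Sum>i\<in>{a}. coeff p i * coeff q (a + b - i))"
  proof (rule sum.mono_neutral_right)
    show "\<forall>i\<in>{..a + b} - {a}. coeff p i * coeff q (a + b - i) = 0"
    proof
      fix i assume i: "i \<in> {..a + b} - {a}"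
      show "coeff p i * coeff q (a + b - i) = 0"
      proof (cases "i < a")
        case True
        then have "coeff q (a + b - i) = 0" using assms by (intro coeff_eq_0) auto
        then show ?thesis by simp
      next
        case False
        then have "coeff p i = 0" using i assms by (intro coeff_eq_0) auto
        then show ?thesis by simp
      qed
    qed
  qed auto
  finally show ?thesis by simp
qed

text \<open>The product is the elementary symmetric function of top index: the coefficient of
  \<open>\<Prod>(1 + g z X)^m z\<close> at the total multiplicity.\<close>

lemma prod_power_eq_newton_esym:
  fixes g :: "'a \<Rightarrow> complex" and m :: "'a \<Rightarrow> nat"
  assumes "finite Z"
  shows "(\<Prod>z\<in>Z. g z ^ m z) = newton_esym (\<lambda>j. \<Sum>z\<in>Z. of_nat (m z) * g z ^ j) (\<Sum>z\<in>Z. m z)"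
proof -
  have pow: "degree ([:1, c:] ^ n) \<le> n \<and> coeff ([:1, c:] ^ n) n = c ^ n" for c :: complex and n
  proof (induction n)
    case (Suc n)
    have "degree ([:1, c:] * [:1, c:] ^ n) \<le> 1 + n"
      using Suc by (intro order.trans[OF degree_mult_le] add_mono) auto
    moreover have "coeff ([:1, c:] * [:1, c:] ^ n) (1 + n) = coeff [:1, c:] 1 * coeff ([:1, c:] ^ n) n"
      using Suc by (intro coeff_mult_top) auto
    ultimately show ?case using Suc by simp
  qed simp
  have "degree (\<Prod>z\<in>Z. [:1, g z:] ^ m z) \<le> (\<Sum>z\<in>Z. m z) \<and>
        coeff (\<Prod>z\<in>Z. [:1, g z:] ^ m z) (\<Sum>z\<in>Z. m z) = (\<Prod>z\<in>Z. g z ^ m z)"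
    using assms
  proof (induction Z rule: finite_induct)
    case (insert z Z)
    have "degree ([:1, g z:] ^ m z * (\<Prod>z\<in>Z. [:1, g z:] ^ m z)) \<le> m z + (\<Sum>z\<in>Z. m z)"
      using insert pow by (intro order.trans[OF degree_mult_le] add_mono) auto
    moreover have "coeff ([:1, g z:] ^ m z * (\<Prod>z\<in>Z. [:1, g z:] ^ m z)) (m z + (\<Sum>z\<in>Z. m z)) =
        coeff ([:1, g z:] ^ m z) (m z) * coeff (\<Prod>z\<in>Z. [:1, g z:] ^ m z) (\<Sum>z\<in>Z. m z)"
      using insert pow by (intro coeff_mult_top) auto
    ultimately show ?case using insert pow by simp
  qed simp
  then have "(\<Prod>z\<in>Z. g z ^ m z) = fps_nth (fps_of_poly (\<Prod>z\<in>Z. [:1, g z:] ^ m z)) (\<Sum>z\<in>Z. m z)"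
    by simp
  also have "fps_of_poly (\<Prod>z\<in>Z. [:1, g z:] ^ m z) = (\<Prod>z\<in>Z. (1 + fps_const (g z) * fps_X) ^ m z)"
    by (simp add: fps_of_poly_prod fps_of_poly_power fps_of_poly_pCons)
  finally show ?thesis using newton_esym_eq_fps_nth[OF assms] by simp
qed

lemma holomorphic_on_newton_esym:
  assumes "\<And>j. (\<lambda>x. p x j) holomorphic_on S"
  shows "(\<lambda>x. newton_esym (p x) k) holomorphic_on S"
proof (induction k rule: less_induct)
  case (less k)
  then show ?case
    by (cases k) (auto intro!: holomorphic_intros assms simp del: of_nat_Suc)
qed

lemma tendsto_newton_esym:
  assumes "\<And>j. ((\<lambda>x. p x j) \<longlongrightarrow> q j) F"
  shows "((\<lambda>x. newton_esym (p x) k) \<longlongrightarrow> newton_esym q k) F"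
proof (induction k rule: less_induct)
  case (less k)
  then show ?case
    by (cases k) (auto intro!: tendsto_intros assms simp del: of_nat_Suc)
qed

section \<open>The norm over the small roots\<close>

definition root_set :: "nat \<Rightarrow> (nat \<Rightarrow> nat \<Rightarrow> complex) \<Rightarrow> real \<Rightarrow> complex \<Rightarrow> complex set" where
  "root_set D a \<delta> x = {y. norm y < \<delta> \<and> pfun D a x y = 0}"

definition root_mult :: "nat \<Rightarrow> (nat \<Rightarrow> nat \<Rightarrow> complex) \<Rightarrow> complex \<Rightarrow> complex \<Rightarrow> nat" where
  "root_mult D a x y = nat (zorder (pfun D a x) y)"

definition root_power_sum where
  "root_power_sum D a E b \<delta> x j =
     (\<Sum>y\<in>root_set D a \<delta> x. of_nat (root_mult D a x y) * pfun E b x y ^ j)"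

text \<open>A local resultant of the two curves, restricted to the roots in the disc of radius
  \<open>\<delta>\<close>.\<close>

definition root_norm where
  "root_norm D a E b \<delta> x = (\<Prod>y\<in>root_set D a \<delta> x. pfun E b x y ^ root_mult D a x y)"

definition root_count where
  "root_count D a \<delta> x = (\<Sum>y\<in>root_set D a \<delta> x. root_mult D a x y)"

text \<open>Keeps the roots off the circle, so that those inside can be captured by an integral over
  it.\<close>

definition circle_nonzero where
  "circle_nonzero D a \<delta> x \<longleftrightarrow> (\<forall>y. norm y = \<delta> \<longrightarrow> pfun D a x y \<noteq> 0)"

lemma root_mult_pos:
  assumes "pfun D a x y0 \<noteq> 0" "pfun D a x y = 0"
  shows "zorder (pfun D a x) y > 0"
proof -
  have "pfun D a x holomorphic_on UNIV" by (intro holomorphic_intros)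
  then show ?thesis using zorder_exist_zero[of "pfun D a x" UNIV y] assms by auto
qed

lemma circle_nonzero_ex: "circle_nonzero D a \<delta> x \<Longrightarrow> \<delta> > 0 \<Longrightarrow> \<exists>y. pfun D a x y \<noteq> 0"
  unfolding circle_nonzero_def by (intro exI[of _ "of_real \<delta>"]) auto

lemma finite_root_set: "circle_nonzero D a \<delta> x \<Longrightarrow> \<delta> > 0 \<Longrightarrow> finite (root_set D a \<delta> x)"
  using circle_nonzero_ex[of D a \<delta> x] finite_roots_pfun[of D a x]
  by (auto simp: root_set_def intro: finite_subset[rotated])

text \<open>The integrand \<open>F_y G^j / F dy\<close> of the argument principle, pulled back to
  the fixed compact interval [0,1], where theorems on parameter integrals apply.\<close>

definition power_sum_kernel where
  "power_sum_kernel D a E b \<delta> j x t =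
     pfun D (coeff_dy D a) x (circlepath 0 \<delta> t) * pfun E b x (circlepath 0 \<delta> t) ^ j
     / pfun D a x (circlepath 0 \<delta> t) * (2 * pi * \<i> * \<delta> * exp (2 * of_real pi * \<i> * of_real t))"

text \<open>The argument principle with weight \<open>G^j\<close>: the circle winds once around the
  roots inside and not at all around those outside.\<close>

lemma root_power_sum_eq_integral:
  assumes nz: "circle_nonzero D a \<delta> x" and \<delta>: "\<delta> > 0"
  shows "root_power_sum D a E b \<delta> x j =
         integral (cbox 0 1) (power_sum_kernel D a E b \<delta> j x) / (2 * pi * \<i>)"
proof -
  let ?f = "pfun D a x" and ?h = "\<lambda>y. pfun E b x y ^ j"
  obtain y0 where y0: "?f y0 \<noteq> 0" using circle_nonzero_ex[OF assms] by blast
  have df: "deriv ?f y = pfun D (coeff_dy D a) x y" for y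
    by (intro DERIV_imp_deriv DERIV_pfun_y)
  have fin: "finite {w. ?f w = 0}" using finite_roots_pfun[OF y0] .
  have "contour_integral (circlepath 0 \<delta>) (\<lambda>y. deriv ?f y * ?h y / ?f y) = 2 * pi * \<i> *
     (\<Sum>p\<in>{w\<in>UNIV. ?f w = 0 \<or> w \<in> {}}. winding_number (circlepath 0 \<delta>) p * ?h p * zorder ?f p)"
    using nz \<delta> fin
    by (intro argument_principle) (auto intro!: holomorphic_intros simp: circle_nonzero_def)
  also have "(\<Sum>p\<in>{w\<in>UNIV. ?f w = 0 \<or> w \<in> {}}. winding_number (circlepath 0 \<delta>) p * ?h p * zorder ?f p)
    = (\<Sum>p\<in>root_set D a \<delta> x. winding_number (circlepath 0 \<delta>) p * ?h p * zorder ?f p)"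
  proof (rule sum.mono_neutral_right)
    show "\<forall>i\<in>{w \<in> UNIV. ?f w = 0 \<or> w \<in> {}} - root_set D a \<delta> x.
       winding_number (circlepath 0 \<delta>) i * ?h i * zorder ?f i = 0"
    proof
      fix i assume i: "i \<in> {w \<in> UNIV. ?f w = 0 \<or> w \<in> {}} - root_set D a \<delta> x"
      then have "norm i > \<delta>" using nz by (auto simp: root_set_def circle_nonzero_def not_less le_less)
      then have "winding_number (circlepath 0 \<delta>) i = 0"
        using \<delta> by (intro winding_number_zero_outside[where s = "cball 0 \<delta>"]) auto
      then show "winding_number (circlepath 0 \<delta>) i * ?h i * zorder ?f i = 0" by simp
    qed
  qed (use fin in \<open>auto simp: root_set_def\<close>)
  also have "\<dots> = root_power_sum D a E b \<delta> x j"
    unfolding root_power_sum_def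
  proof (rule sum.cong, goal_cases)
    case (2 p)
    then have "winding_number (circlepath 0 \<delta>) p = 1"
      by (intro winding_number_circlepath) (auto simp: root_set_def)
    moreover have "zorder ?f p > 0" using root_mult_pos[OF y0] 2 by (auto simp: root_set_def)
    ultimately show ?case by (simp add: root_mult_def)
  qed simp
  also have "contour_integral (circlepath 0 \<delta>) (\<lambda>y. deriv ?f y * ?h y / ?f y) =
      integral (cbox 0 1) (power_sum_kernel D a E b \<delta> j x)"
    unfolding contour_integral_integral vector_derivative_circlepath df power_sum_kernel_def
    by (simp add: mult_ac)
  finally show ?thesis by simp
qed

lemma continuous_on_circlepath [continuous_intros]:
  "continuous_on S f \<Longrightarrow> continuous_on S (\<lambda>z. circlepath c r (f z))"
  unfolding circlepath by (intro continuous_intros)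

lemma norm_circlepath_0 [simp]: "norm (circlepath 0 \<delta> t) = \<bar>\<delta>\<bar>"
  by (simp add: circlepath norm_mult)

text \<open>A single root need not be holomorphic in \<open>x\<close>, since roots branch; the
  integral over a fixed circle is, by differentiation under the integral sign.\<close>

lemma holomorphic_on_root_power_sum:
  assumes nz: "\<And>x. x \<in> ball 0 \<epsilon> \<Longrightarrow> circle_nonzero D a \<delta> x" and \<delta>: "\<delta> > 0"
  shows "(\<lambda>x. root_power_sum D a E b \<delta> x j) holomorphic_on ball 0 \<epsilon>"
proof -
  let ?\<gamma> = "circlepath 0 \<delta>"
  let ?w = "\<lambda>t::real. 2 * pi * \<i> * \<delta> * exp (2 * of_real pi * \<i> * of_real t)"
  let ?N = "\<lambda>x t. pfun D (coeff_dy D a) x (?\<gamma> t) * pfun E b x (?\<gamma> t) ^ j"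
  \<comment> \<open>The product rule for \<open>?N\<close>; the quotient rule then gives
    \<open>?k'\<close>, the derivative of the whole kernel.\<close>
  let ?N' = "\<lambda>x t. pfun D (coeff_dy D a) x (?\<gamma> t) *
        (of_nat j * (pfun E (coeff_dx E b) x (?\<gamma> t) * pfun E b x (?\<gamma> t) ^ (j - 1)))
      + pfun D (coeff_dx D (coeff_dy D a)) x (?\<gamma> t) * pfun E b x (?\<gamma> t) ^ j"
  let ?F = "\<lambda>x t. pfun D a x (?\<gamma> t)" and ?F' = "\<lambda>x t. pfun D (coeff_dx D a) x (?\<gamma> t)"
  let ?k' = "\<lambda>x t. (?N' x t * ?F x t - ?N x t * ?F' x t) / (?F x t * ?F x t) * ?w t"
  have nzt: "?F x t \<noteq> 0" if "x \<in> ball 0 \<epsilon>" for x t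
    using nz[OF that] \<delta> by (auto simp: circle_nonzero_def)
  have "(\<lambda>x. integral (cbox 0 1) (power_sum_kernel D a E b \<delta> j x)) holomorphic_on ball 0 \<epsilon>"
  proof (rule leibniz_rule_holomorphic)
    fix x :: complex and t :: real assume x: "x \<in> ball 0 \<epsilon>"
    show "((\<lambda>x. power_sum_kernel D a E b \<delta> j x t) has_field_derivative ?k' x t) (at x within ball 0 \<epsilon>)"
      unfolding power_sum_kernel_def
      by (intro DERIV_cmult_right DERIV_divide DERIV_mult' DERIV_power[unfolded One_nat_def[symmetric]]
          DERIV_pfun_x nzt[OF x])
  next
    fix x :: complex assume x: "x \<in> ball 0 \<epsilon>"
    show "power_sum_kernel D a E b \<delta> j x integrable_on cbox 0 1"
      unfolding power_sum_kernel_def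
      by (intro integrable_continuous continuous_intros) (use nzt[OF x] in auto)
  next
    show "continuous_on (ball 0 \<epsilon> \<times> cbox 0 1) (\<lambda>(x, t). ?k' x t)"
      unfolding case_prod_beta
      by (intro continuous_intros) (use nzt in auto)
  qed (rule convex_ball)
  then have "(\<lambda>x. integral (cbox 0 1) (power_sum_kernel D a E b \<delta> j x) / (2 * pi * \<i>))
      holomorphic_on ball 0 \<epsilon>"
    by (rule holomorphic_on_divide[OF _ holomorphic_on_const]) auto
  then show ?thesis
    by (rule holomorphic_transform) (use root_power_sum_eq_integral nz \<delta> in auto)
qed

lemma tendsto_coordinatewise:
  fixes f :: "'i \<Rightarrow> 'a \<Rightarrow> 'b::topological_space"
  assumes "\<And>i. ((\<lambda>k. f k i) \<longlongrightarrow> l i) F"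
  shows "(f \<longlongrightarrow> l) F"
proof -
  have "limitin (product_topology (\<lambda>_. euclidean) UNIV) f l F"
    using assms by (simp add: limitin_componentwise)
  then show ?thesis by (simp add: euclidean_product_topology)
qed

text \<open>Coefficient arrays are points of a function space with the product topology. There
  coefficientwise convergence is convergence, and the parameter integral is continuous as long as
  the denominator has no zero on the circle.\<close>

lemma tendsto_root_power_sum:
  assumes nz: "circle_nonzero D a \<delta> x" and nzk: "\<And>k. circle_nonzero D (ak k) \<delta> x" and \<delta>: "\<delta> > 0"
    and ak: "\<And>i j. (\<lambda>k. ak k i j) \<longlonglongrightarrow> a i j" and bk: "\<And>i j. (\<lambda>k. bk k i j) \<longlonglongrightarrow> b i j"
  shows "(\<lambda>k. root_power_sum D (ak k) E (bk k) \<delta> x j) \<longlonglongrightarrow> root_power_sum D a E b \<delta> x j"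
proof -
  define U where "U = {(a, b :: nat \<Rightarrow> nat \<Rightarrow> complex). circle_nonzero D a \<delta> x}"
  have coord: "continuous_on S (\<lambda>z. f z i j)" if "continuous_on S f"
    for S and f :: "'c::topological_space \<Rightarrow> nat \<Rightarrow> nat \<Rightarrow> complex" and i j
    by (rule continuous_on_product_then_coordinatewise
        [OF continuous_on_product_then_coordinatewise[OF that]])
  have pf: "continuous_on S (\<lambda>z. pfun D (f z) x (g z))"
    if "continuous_on S f" "continuous_on S g"
    for S and f :: "'c::topological_space \<Rightarrow> nat \<Rightarrow> nat \<Rightarrow> complex" and g D
    unfolding pfun_def
    by (intro continuous_on_sum continuous_on_mult continuous_on_power continuous_on_const coord that)
  have dy: "continuous_on S (\<lambda>z. coeff_dy D (f z))" if "continuous_on S f"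
    for S and f :: "'c::topological_space \<Rightarrow> nat \<Rightarrow> nat \<Rightarrow> complex" and D
  proof -
    have "continuous_on S (\<lambda>z. coeff_dy D (f z) i j)" for i j
    proof (cases "j < D")
      case True
      then show ?thesis unfolding coeff_dy_def if_P[OF True]
        by (intro continuous_on_mult continuous_on_const coord that)
    qed (simp add: coeff_dy_def)
    then have "continuous_on S (\<lambda>z. coeff_dy D (f z) i)" for i
      by (rule continuous_on_coordinatewise_then_product)
    then show ?thesis by (rule continuous_on_coordinatewise_then_product)
  qed
  have "continuous_on (U \<times> cbox 0 1)
     (\<lambda>z. power_sum_kernel D (fst (fst z)) E (snd (fst z)) \<delta> j x (snd z))"
    unfolding power_sum_kernel_def
    by (intro continuous_on_mult continuous_on_divide continuous_on_power continuous_on_exp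
        continuous_on_of_real continuous_on_const continuous_on_circlepath
        continuous_on_fst continuous_on_snd continuous_on_id pf dy) (use \<delta> in \<open>auto simp: U_def circle_nonzero_def\<close>)
  then have "continuous_on U (\<lambda>u. integral (cbox 0 1) (power_sum_kernel D (fst u) E (snd u) \<delta> j x))"
    by (intro integral_continuous_on_param) (simp add: case_prod_beta)
  then have "continuous_on U (\<lambda>u. root_power_sum D (fst u) E (snd u) \<delta> x j)"
    by (subst continuous_on_cong[OF refl root_power_sum_eq_integral])
       (auto simp: U_def \<delta> intro!: continuous_on_divide continuous_on_const)
  moreover have "(\<lambda>k. (ak k, bk k)) \<longlonglongrightarrow> (a, b)"
    by (intro tendsto_Pair tendsto_coordinatewise ak bk)
  ultimately have "(\<lambda>k. (\<lambda>u. root_power_sum D (fst u) E (snd u) \<delta> x j) (ak k, bk k))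
      \<longlonglongrightarrow> (\<lambda>u. root_power_sum D (fst u) E (snd u) \<delta> x j) (a, b)"
    by (rule continuous_on_tendsto_compose) (use nz nzk in \<open>auto simp: U_def\<close>)
  then show ?thesis by simp
qed

lemma root_power_sum_0: "root_power_sum D a E b \<delta> x 0 = of_nat (root_count D a \<delta> x)"
  by (simp add: root_power_sum_def root_count_def)

lemma root_norm_eq_newton_esym:
  assumes "circle_nonzero D a \<delta> x" "\<delta> > 0"
  shows "root_norm D a E b \<delta> x = newton_esym (root_power_sum D a E b \<delta> x) (root_count D a \<delta> x)"
  unfolding root_norm_def root_count_def root_power_sum_def
  by (rule prod_power_eq_newton_esym) (rule finite_root_set[OF assms])

text \<open>The count is the zeroth power sum, hence continuous, and distinct integers differ by at
  least 1, so it cannot change on a connected disc.\<close>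

lemma root_count_constant:
  assumes nz: "\<And>x. x \<in> ball 0 \<epsilon> \<Longrightarrow> circle_nonzero D a \<delta> x" and \<delta>: "\<delta> > 0"
    and x: "x \<in> ball 0 \<epsilon>"
  shows "root_count D a \<delta> x = root_count D a \<delta> 0"
proof -
  \<comment> \<open>With exponent 0 the weight is 1 whatever the second function is, so the zero
    polynomial does.\<close>
  let ?f = "\<lambda>x. root_power_sum D a 0 (\<lambda>_ _. 0) \<delta> x 0"
  have "?f constant_on ball 0 \<epsilon>"
  proof (rule continuous_discrete_range_constant)
    show "continuous_on (ball 0 \<epsilon>) ?f"
      using holomorphic_on_root_power_sum[OF nz \<delta>] by (rule holomorphic_on_imp_continuous_on)
    fix x assume "x \<in> ball (0::complex) \<epsilon>"
    show "\<exists>e>0. \<forall>y. y \<in> ball 0 \<epsilon> \<and> ?f y \<noteq> ?f x \<longrightarrow> e \<le> norm (?f y - ?f x)"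
    proof (intro exI[of _ 1] conjI allI impI)
      fix y assume y: "y \<in> ball 0 \<epsilon> \<and> ?f y \<noteq> ?f x"
      have "norm (?f y - ?f x) = norm (complex_of_int (int (root_count D a \<delta> y) - int (root_count D a \<delta> x)))"
        by (simp add: root_power_sum_0)
      also have "\<dots> = \<bar>int (root_count D a \<delta> y) - int (root_count D a \<delta> x)\<bar>"
        by (simp only: norm_of_int)
      also have "\<dots> \<ge> 1"
      proof -
        have "int (root_count D a \<delta> y) \<noteq> int (root_count D a \<delta> x)"
          using y by (auto simp: root_power_sum_0)
        then show ?thesis by linarith
      qed
      finally show "1 \<le> norm (?f y - ?f x)" .
    qed simp
  qed simp
  then obtain c where "\<And>x. x \<in> ball 0 \<epsilon> \<Longrightarrow> ?f x = c" by (auto simp: constant_on_def)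
  moreover have "(0::complex) \<in> ball 0 \<epsilon>" using x by (auto simp: le_less_trans[OF norm_ge_zero])
  ultimately have "?f x = ?f 0" using x by metis
  then show ?thesis by (simp add: root_power_sum_0)
qed

lemma holomorphic_on_root_norm:
  assumes nz: "\<And>x. x \<in> ball 0 \<epsilon> \<Longrightarrow> circle_nonzero D a \<delta> x" and \<delta>: "\<delta> > 0"
  shows "root_norm D a E b \<delta> holomorphic_on ball 0 \<epsilon>"
proof -
  \<comment> \<open>One index for the whole disc, so that the norm is a single polynomial in the
    power sums; constancy of the root count allows it.\<close>
  have "(\<lambda>x. newton_esym (root_power_sum D a E b \<delta> x) (root_count D a \<delta> 0)) holomorphic_on ball 0 \<epsilon>"
    by (intro holomorphic_on_newton_esym holomorphic_on_root_power_sum nz \<delta>)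
  then show ?thesis
  proof (rule holomorphic_transform)
    fix x :: complex assume "x \<in> ball 0 \<epsilon>"
    then show "newton_esym (root_power_sum D a E b \<delta> x) (root_count D a \<delta> 0) = root_norm D a E b \<delta> x"
      using root_norm_eq_newton_esym[OF nz \<delta>] root_count_constant[OF nz \<delta>] by metis
  qed
qed

text \<open>The norm is the elementary symmetric function whose index is the root count. Convergent
  integers are eventually constant, which fixes the index before passing to the limit.\<close>

lemma tendsto_root_norm:
  assumes nz: "circle_nonzero D a \<delta> x" and nzk: "\<And>k. circle_nonzero D (ak k) \<delta> x" and \<delta>: "\<delta> > 0"
    and ak: "\<And>i j. (\<lambda>k. ak k i j) \<longlonglongrightarrow> a i j" and bk: "\<And>i j. (\<lambda>k. bk k i j) \<longlonglongrightarrow> b i j"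
  shows "eventually (\<lambda>k. root_count D (ak k) \<delta> x = root_count D a \<delta> x) sequentially"
    and "(\<lambda>k. root_norm D (ak k) E (bk k) \<delta> x) \<longlonglongrightarrow> root_norm D a E b \<delta> x"
proof -
  note lim = tendsto_root_power_sum[OF nz nzk \<delta> ak bk]
  have "(\<lambda>k. (of_nat (root_count D (ak k) \<delta> x) :: complex)) \<longlonglongrightarrow> of_nat (root_count D a \<delta> x)"
    using lim[where j = 0 and E = E] by (simp only: root_power_sum_0)
  then have "eventually (\<lambda>k. dist (of_nat (root_count D (ak k) \<delta> x)) (of_nat (root_count D a \<delta> x) :: complex) < 1) sequentially"
    by (rule tendstoD) simp
  then show ev: "eventually (\<lambda>k. root_count D (ak k) \<delta> x = root_count D a \<delta> x) sequentially"
  proof eventually_elim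
    case (elim k)
    have "dist (of_nat (root_count D (ak k) \<delta> x)) (of_nat (root_count D a \<delta> x) :: complex) =
        norm (complex_of_int (int (root_count D (ak k) \<delta> x) - int (root_count D a \<delta> x)))"
      by (simp add: dist_norm)
    also have "\<dots> = \<bar>int (root_count D (ak k) \<delta> x) - int (root_count D a \<delta> x)\<bar>"
      by (simp only: norm_of_int)
    finally show ?case using elim by simp
  qed
  have "(\<lambda>k. newton_esym (root_power_sum D (ak k) E (bk k) \<delta> x) (root_count D a \<delta> x))
      \<longlonglongrightarrow> newton_esym (root_power_sum D a E b \<delta> x) (root_count D a \<delta> x)"
    by (intro tendsto_newton_esym lim)
  then show "(\<lambda>k. root_norm D (ak k) E (bk k) \<delta> x) \<longlonglongrightarrow> root_norm D a E b \<delta> x"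
    unfolding root_norm_eq_newton_esym[OF nz \<delta>]
  proof (rule Lim_transform_eventually)
    show "eventually (\<lambda>k. newton_esym (root_power_sum D (ak k) E (bk k) \<delta> x) (root_count D a \<delta> x) =
        root_norm D (ak k) E (bk k) \<delta> x) sequentially"
      using ev by eventually_elim (simp add: root_norm_eq_newton_esym[OF nzk \<delta>])
  qed
qed

text \<open>One factor is kept for each root in \<open>T\<close> and everything else is bounded by
  \<open>M\<close>. Knowing part of the roots is thus enough, and \<open>T = {}\<close> gives a
  plain bound.\<close>

lemma norm_root_norm_le:
  assumes nz: "circle_nonzero D a \<delta> x" and \<delta>: "\<delta> > 0" and M: "M \<ge> 1"
    and le: "\<And>y. norm y < \<delta> \<Longrightarrow> norm (pfun E b x y) \<le> M" and T: "T \<subseteq> root_set D a \<delta> x"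
  shows "norm (root_norm D a E b \<delta> x) \<le> M ^ root_count D a \<delta> x * (\<Prod>y\<in>T. norm (pfun E b x y))"
proof -
  let ?Z = "root_set D a \<delta> x" and ?m = "root_mult D a x" and ?G = "pfun E b x"
  have fin: "finite ?Z" by (rule finite_root_set[OF nz \<delta>])
  obtain y0 where y0: "pfun D a x y0 \<noteq> 0" using circle_nonzero_ex[OF nz \<delta>] by blast
  have m: "?m y \<ge> 1" if "y \<in> ?Z" for y
    using root_mult_pos[OF y0] that by (fastforce simp: root_set_def root_mult_def)
  have "norm (root_norm D a E b \<delta> x) = (\<Prod>y\<in>?Z. norm (?G y) ^ ?m y)"
    by (simp add: root_norm_def prod_norm[symmetric] norm_power)
  also have "\<dots> \<le> (\<Prod>y\<in>?Z. M ^ ?m y * (if y \<in> T then norm (?G y) else 1))"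
  proof (rule prod_mono, rule conjI)
    fix y assume y: "y \<in> ?Z"
    then have G: "norm (?G y) \<le> M" using le by (auto simp: root_set_def)
    show "norm (?G y) ^ ?m y \<le> M ^ ?m y * (if y \<in> T then norm (?G y) else 1)"
    proof (cases "y \<in> T")
      case True
      obtain l where l: "?m y = Suc l" using m[OF y] by (cases "?m y") auto
      have "norm (?G y) ^ l \<le> M ^ l" using G by (intro power_mono) auto
      \<comment> \<open>One surplus factor \<open>M \<ge> 1\<close> is spent to have the exponent
        \<open>?m y\<close> for roots inside and outside \<open>T\<close> alike.\<close>
      also have "\<dots> \<le> M ^ Suc l" using M by (intro power_increasing) auto
      finally have "norm (?G y) * norm (?G y) ^ l \<le> norm (?G y) * M ^ Suc l"
        by (intro mult_left_mono) auto
      then show ?thesis using l True by (simp add: mult_ac)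
    next
      case False
      then show ?thesis using G by (auto intro!: power_mono)
    qed
  qed auto
  also have "\<dots> = M ^ root_count D a \<delta> x * (\<Prod>y\<in>?Z. if y \<in> T then norm (?G y) else 1)"
    by (simp add: prod.distrib root_count_def power_sum)
  also have "(\<Prod>y\<in>?Z. if y \<in> T then norm (?G y) else 1) = (\<Prod>y\<in>T. norm (?G y))"
    using fin T by (subst prod.inter_restrict[symmetric]) (auto intro!: prod.cong)
  finally show ?thesis .
qed

section \<open>Semicontinuity of intersection multiplicities\<close>

lemma holomorphic_mult_eq_0:
  assumes f: "f holomorphic_on S" and g: "g holomorphic_on S" and S: "open S" "connected S"
    and fg: "\<And>z. z \<in> S \<Longrightarrow> f z * g z = 0" and z0: "z0 \<in> S" "f z0 \<noteq> 0" and z: "z \<in> S"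
  shows "g z = 0"
proof -
  define U where "U = {z \<in> S. f z \<noteq> 0}"
  have "U = S \<inter> f -` (- {0})" by (auto simp: U_def)
  then have "open U"
    using continuous_open_preimage[OF holomorphic_on_imp_continuous_on[OF f] S(1), of "- {0}"]
    by (simp add: open_Compl)
  then have "z0 islimpt U" using z0 by (intro interior_limit_point) (auto simp: U_def interior_open)
  then show ?thesis
    using analytic_continuation[OF g S, of U z0 z] fg z0(1) z by (auto simp: U_def)
qed

text \<open>\<open>X - X 0\<close> is the \<open>e\<close>-th power of \<open>s t = t * g t\<close>,
  and \<open>s\<close> is a local coordinate because its derivative at 0 is
  \<open>g 0 \<noteq> 0\<close>. Growth and fibres are therefore those of the \<open>e\<close>-th
  power map. The fibre count holds in every small disc, with \<open>\<kappa>\<close> depending on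
  it; this later confines all preimages of a small \<open>x\<close> to a smaller disc.\<close>

lemma holomorphic_local_power_map:
  fixes X :: "complex \<Rightarrow> complex"
  assumes X: "X holomorphic_on ball 0 \<rho>" and \<rho>: "\<rho> > 0" and nc: "\<not> X constant_on ball 0 \<rho>"
  obtains e r c C where "e > 0" "0 < r" "r \<le> \<rho>" "c > 0" "C > 0"
    "\<And>t. t \<in> ball 0 r \<Longrightarrow> c * norm t ^ e \<le> norm (X t - X 0) \<and> norm (X t - X 0) \<le> C * norm t ^ e"
    "\<And>\<eta>. 0 < \<eta> \<Longrightarrow> \<eta> \<le> r \<Longrightarrow> \<exists>\<kappa>>0. \<forall>x. 0 < norm (x - X 0) \<and> norm (x - X 0) < \<kappa> \<longrightarrow>
        card {t \<in> ball 0 \<eta>. X t = x} = e"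
proof -
  have "\<exists>n>0. (deriv ^^ n) X 0 \<noteq> 0"
  proof (rule ccontr)
    assume "\<not> ?thesis"
    then have "(deriv ^^ n) X 0 = 0" if "0 < n" for n using that by blast
    then have "X w = X 0" if "w \<in> ball 0 \<rho>" for w
      using that \<rho> by (intro holomorphic_fun_eq_const_on_connected[OF X]) auto
    then show False using nc by (auto simp: constant_on_def)
  qed
  define e where "e = (LEAST n. n > 0 \<and> (deriv ^^ n) X 0 \<noteq> 0)"
  have e: "e > 0" "(deriv ^^ e) X 0 \<noteq> 0"
    using LeastI_ex[OF \<open>\<exists>n>0. (deriv ^^ n) X 0 \<noteq> 0\<close>] unfolding e_def by auto
  have e_min: "(deriv ^^ i) X 0 = 0" if "0 < i" "i < e" for i
    using not_less_Least[of i "\<lambda>n. n > 0 \<and> (deriv ^^ n) X 0 \<noteq> 0"] that by (auto simp: e_def)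
  obtain g r0 where r0: "0 < r0" and g: "g holomorphic_on ball 0 r0"
    and Xg: "\<And>w. w \<in> ball 0 r0 \<Longrightarrow> X w - X 0 = ((w - 0) * g w) ^ e"
    and gnz: "\<And>w. w \<in> ball 0 r0 \<Longrightarrow> g w \<noteq> 0"
    using holomorphic_factor_order_of_zero_strong[OF X open_ball _ e(1) e(2) e_min] \<rho>
    by (metis centre_in_ball)
  define s where "s w = w * g w" for w
  have s_hol: "s holomorphic_on ball 0 r0" unfolding s_def by (intro holomorphic_intros g)
  have "(g has_field_derivative deriv g 0) (at 0)"
    using g r0 by (intro holomorphic_derivI[OF g]) auto
  then have "(s has_field_derivative g 0) (at 0)"
    unfolding s_def by (auto intro!: derivative_eq_intros)
  then have s'0: "deriv s 0 \<noteq> 0" using gnz[of 0] r0 by (simp add: DERIV_imp_deriv)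
  have "0 \<in> ball 0 r0" using r0 by simp
  then obtain r1 where r1: "r1 > 0" "ball (0::complex) r1 \<subseteq> ball 0 r0" "inj_on s (ball 0 r1)"
    by (rule has_complex_derivative_locally_injective[OF s_hol _ open_ball s'0])
  define b where "b = norm (g 0)"
  have b: "b > 0" using gnz[of 0] r0 by (simp add: b_def)
  have "isCont g 0"
    using holomorphic_on_imp_continuous_on[OF g] r0 by (simp add: continuous_on_eq_continuous_at)
  then obtain r2 where r2: "r2 > 0" "\<And>t. dist t 0 < r2 \<Longrightarrow> dist (g t) (g 0) < b / 2"
    using b unfolding continuous_at_eps_delta by (meson half_gt_zero)
  define r where "r = min \<rho> (min r1 r2)"
  have r: "0 < r" "r \<le> \<rho>" "r \<le> r1" "r \<le> r2" using \<rho> r1 r2 by (auto simp: r_def)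
  have in0: "t \<in> ball 0 r0" if "t \<in> ball 0 r" for t :: complex
    using that r(3) r1(2) by (meson subset_ball subsetD)
  have Xs: "X t - X 0 = s t ^ e" if "t \<in> ball 0 r" for t
    using Xg[OF in0[OF that]] by (simp add: s_def)
  have gb: "b / 2 \<le> norm (g t) \<and> norm (g t) \<le> 2 * b" if "t \<in> ball 0 r" for t
  proof -
    have "norm (g t - g 0) < b / 2" using r2(2)[of t] that r by (simp add: dist_norm)
    then show ?thesis
      using norm_triangle_ineq2[of "g 0" "g t"] norm_triangle_ineq2[of "g t" "g 0"]
      by (simp add: b_def norm_minus_commute)
  qed
  show thesis
  proof (rule that[OF e(1) r(1,2), of "(b / 2) ^ e" "(2 * b) ^ e"])
    fix t :: complex assume t: "t \<in> ball 0 r"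
    have n: "norm (X t - X 0) = (norm t * norm (g t)) ^ e"
      by (simp add: Xs[OF t] s_def norm_power norm_mult)
    have "(norm t * (b / 2)) ^ e \<le> (norm t * norm (g t)) ^ e"
      using gb[OF t] b by (intro power_mono mult_left_mono) auto
    moreover have "(norm t * norm (g t)) ^ e \<le> (norm t * (2 * b)) ^ e"
      using gb[OF t] b by (intro power_mono mult_left_mono) auto
    ultimately show "(b / 2) ^ e * norm t ^ e \<le> norm (X t - X 0) \<and>
        norm (X t - X 0) \<le> (2 * b) ^ e * norm t ^ e"
      unfolding n by (simp only: power_mult_distrib mult.commute)
  next
    fix \<eta> :: real assume \<eta>: "0 < \<eta>" "\<eta> \<le> r"
    have inj: "inj_on s (ball 0 \<eta>)" using r1(3) \<eta> r by (elim inj_on_subset) auto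
    have "open (s ` ball 0 \<eta>)"
      using \<eta> in0 by (intro open_mapping_thm3 holomorphic_on_subset[OF s_hol] inj) auto
    moreover have "0 \<in> s ` ball 0 \<eta>" using \<eta> by (auto simp: s_def intro!: image_eqI[of _ _ 0])
    ultimately obtain \<kappa>' where \<kappa>': "\<kappa>' > 0" "ball 0 \<kappa>' \<subseteq> s ` ball 0 \<eta>"
      by (meson open_contains_ball)
    show "\<exists>\<kappa>>0. \<forall>x. 0 < norm (x - X 0) \<and> norm (x - X 0) < \<kappa> \<longrightarrow> card {t \<in> ball 0 \<eta>. X t = x} = e"
    proof (intro exI[of _ "\<kappa>' ^ e"] conjI allI impI)
      fix x assume x: "0 < norm (x - X 0) \<and> norm (x - X 0) < \<kappa>' ^ e"
      have eq: "X t = x \<longleftrightarrow> s t ^ e = x - X 0" if "t \<in> ball 0 \<eta>" for t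
        using Xs[of t] that \<eta> by auto
      \<comment> \<open>All \<open>e\<close>-th roots of \<open>x - X 0\<close> have modulus below
        \<open>\<kappa>'\<close>, so each of them is a value of \<open>s\<close> on the
        disc.\<close>
      have "s ` {t \<in> ball 0 \<eta>. X t = x} = {z. z ^ e = x - X 0}"
      proof (intro equalityI subsetI)
        fix z assume z: "z \<in> {z. z ^ e = x - X 0}"
        then have "norm z ^ e < \<kappa>' ^ e" using x by (simp flip: norm_power)
        then have "norm z < \<kappa>'" using \<kappa>' by (metis power_less_imp_less_base less_imp_le)
        then have "z \<in> s ` ball 0 \<eta>" using \<kappa>' by auto
        then show "z \<in> s ` {t \<in> ball 0 \<eta>. X t = x}" using z eq by auto
      qed (use eq in auto)
      moreover have "inj_on s {t \<in> ball 0 \<eta>. X t = x}" using inj by (rule inj_on_subset) auto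
      ultimately have "card {t \<in> ball 0 \<eta>. X t = x} = card {z. z ^ e = x - X 0}"
        by (metis card_image)
      also have "\<dots> = e" using x e by (intro card_nth_roots) auto
      finally show "card {t \<in> ball 0 \<eta>. X t = x} = e" .
    qed (use \<kappa>' in auto)
  qed (use b in auto)
qed

text \<open>Division by \<open>z\<close> once per unit of \<open>n\<close>, as in the Schwarz lemma.
  The local constants \<open>\<kappa>\<close> and \<open>C\<close> only witness that
  \<open>f\<close> vanishes to order \<open>n\<close>; the bound obtained depends on
  \<open>B\<close> and \<open>\<rho>\<close> alone and is therefore uniform over a sequence of
  functions.\<close>

lemma Schwarz_higher_order:
  assumes "f holomorphic_on ball 0 \<rho>" "\<rho> > 0"
    and "\<And>x. x \<in> ball 0 \<rho> \<Longrightarrow> norm (f x) \<le> B"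
    and "\<kappa> > 0" "\<And>x. 0 < norm x \<Longrightarrow> norm x < \<kappa> \<Longrightarrow> norm (f x) \<le> C * norm x ^ n"
    and "x \<in> ball 0 \<rho>"
  shows "norm (f x) \<le> B * (norm x / \<rho>) ^ n"
  using assms
proof (induction n arbitrary: f B C x \<kappa>)
  case 0
  then show ?case by simp
next
  case (Suc n)
  note \<rho> = Suc.prems(2)
  have cont: "continuous (at 0) f"
    using holomorphic_on_imp_continuous_on[OF Suc.prems(1)] \<rho>
    by (simp add: continuous_on_eq_continuous_at)
  have "f 0 = 0"
  \<comment> \<open>The growth hypothesis speaks of nonzero arguments only; the value at 0 follows
    by continuity, the exponent being positive.\<close>
  proof -
    have "isCont (\<lambda>x::complex. C * norm x ^ Suc n) 0" by (intro continuous_intros)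
    then have "((\<lambda>x::complex. C * norm x ^ Suc n) \<longlongrightarrow> 0) (at 0)" by (simp add: isCont_def)
    moreover have "eventually (\<lambda>x. norm (f x) \<le> C * norm x ^ Suc n) (at 0)"
      unfolding eventually_at using Suc.prems(4,5) by (intro exI[of _ \<kappa>]) auto
    ultimately have "(f \<longlongrightarrow> 0) (at 0)" by (rule Lim_null_comparison[rotated])
    then show ?thesis using cont by (metis LIM_unique continuous_at)
  qed
  then obtain h where h: "h holomorphic_on ball 0 \<rho>" and fh: "\<And>z. norm z < \<rho> \<Longrightarrow> f z = z * h z"
    using Schwarz3[OF Suc.prems(1)] by blast
  \<comment> \<open>Maximum modulus on circles of radius \<open>r < \<rho>\<close>, where
    \<open>f\<close> is under control, followed by \<open>r \<rightarrow> \<rho>\<close>.\<close>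
  have hb: "norm (h z) \<le> B / \<rho>" if z: "z \<in> ball 0 \<rho>" for z
  proof -
    have le: "norm (h z) \<le> B / r" if r: "norm z < r" "r < \<rho>" for r
    proof (rule maximum_modulus_frontier[where S = "cball 0 r" and f = h and \<xi> = z])
      show "h holomorphic_on interior (cball 0 r)"
        using r by (intro holomorphic_on_subset[OF h]) auto
      show "continuous_on (closure (cball 0 r)) h"
        using r by (intro holomorphic_on_imp_continuous_on holomorphic_on_subset[OF h]) auto
      fix w :: complex assume "w \<in> frontier (cball 0 r)"
      then have w: "norm w = r" by simp
      have r0: "r > 0" using r norm_ge_zero[of z] by linarith
      have "norm (f w) = r * norm (h w)" using fh[of w] w r by (simp add: norm_mult)
      moreover have "norm (f w) \<le> B" using Suc.prems(3)[of w] w r by auto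
      ultimately show "norm (h w) \<le> B / r" using r0 by (simp add: field_simps)
    qed (use r in auto)
    have "((\<lambda>r. B / r) \<longlongrightarrow> B / \<rho>) (at_left \<rho>)" using \<rho> by (intro tendsto_intros) auto
    moreover have "eventually (\<lambda>r. norm (h z) \<le> B / r) (at_left \<rho>)"
      using eventually_at_left_real[of "norm z" \<rho>] z by (auto elim!: eventually_mono intro: le)
    ultimately show ?thesis by (rule tendsto_lowerbound) simp
  qed
  have hn: "norm (h w) \<le> C * norm w ^ n" if "0 < norm w" "norm w < min \<kappa> \<rho>" for w
  proof -
    have "norm w * norm (h w) \<le> norm w * (C * norm w ^ n)"
      using Suc.prems(5)[of w] fh[of w] that by (simp add: norm_mult mult_ac)
    then show ?thesis using that(1) by (rule mult_left_le_imp_le)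
  qed
  have "norm (h x) \<le> B / \<rho> * (norm x / \<rho>) ^ n"
    by (rule Suc.IH[where \<kappa> = "min \<kappa> \<rho>", OF h \<rho> hb _ hn Suc.prems(6)]) (use \<rho> Suc.prems(4) in auto)
  then have "norm x * norm (h x) \<le> norm x * (B / \<rho> * (norm x / \<rho>) ^ n)"
    by (intro mult_left_mono) auto
  then show ?case using fh[of x] Suc.prems(6) by (simp add: norm_mult mult_ac)
qed

section \<open>Injective arcs on a plane curve\<close>

text \<open>With \<open>X\<close> constant, \<open>Y\<close> would inject an uncountable disc into
  the finitely many roots of \<open>pfun D a (X 0)\<close>.\<close>

lemma arc_not_vertical:
  fixes X Y :: "complex \<Rightarrow> complex"
  assumes inj: "inj_on (\<lambda>t. (X t, Y t)) (ball 0 \<rho>)" and \<rho>: "\<rho> > 0"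
    and F: "\<And>t. t \<in> ball 0 \<rho> \<Longrightarrow> pfun D a (X t) (Y t) = 0" and nz: "pfun D a (X 0) y0 \<noteq> 0"
  shows "\<not> X constant_on ball 0 \<rho>"
proof
  assume "X constant_on ball 0 \<rho>"
  then have X: "X t = X 0" if "t \<in> ball 0 \<rho>" for t
    using that \<rho> by (auto simp: constant_on_def)
  have "inj_on Y (ball 0 \<rho>)"
    using inj X unfolding inj_on_def by (metis prod.inject)
  moreover have "Y ` ball 0 \<rho> \<subseteq> {y. pfun D a (X 0) y = 0}" using F X by fastforce
  then have "finite (Y ` ball 0 \<rho>)" using finite_roots_pfun[OF nz] finite_subset by blast
  ultimately have "finite (ball (0::complex) \<rho>)" by (metis finite_image_iff)
  then show False using uncountable_ball[OF \<rho>, of 0] countable_finite by blast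
qed

lemma DERIV_pfun_chain:
  assumes "(X has_field_derivative X') (at t)" "(Y has_field_derivative Y') (at t)"
  shows "((\<lambda>t. pfun D a (X t) (Y t)) has_field_derivative
    pfun D (coeff_dx D a) (X t) (Y t) * X' + pfun D (coeff_dy D a) (X t) (Y t) * Y') (at t)"
proof -
  have dx: "pfun D (coeff_dx D a) x y = (\<Sum>i\<le>D. \<Sum>j\<le>D. a i j * (of_nat i * x ^ (i - 1)) * y ^ j)" for x y
    by (rule DERIV_unique[OF DERIV_pfun_x])
       (auto simp: pfun_def intro!: derivative_eq_intros sum.cong)
  have dy: "pfun D (coeff_dy D a) x y = (\<Sum>i\<le>D. \<Sum>j\<le>D. a i j * x ^ i * (of_nat j * y ^ (j - 1)))" for x y
    by (rule DERIV_unique[OF DERIV_pfun_y])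
       (auto simp: pfun_def intro!: derivative_eq_intros sum.cong)
  show ?thesis
    unfolding pfun_def[of D a] dx dy sum_distrib_right sum.distrib[symmetric]
    by (auto intro!: derivative_eq_intros sum.cong assms simp: algebra_simps)
qed

text \<open>Guarantees that the roots carried by the arc are simple away from its base point, so
  that each enters the norm with exponent 1.\<close>

lemma arc_partial_y_nonzero:
  assumes X: "X holomorphic_on ball 0 \<rho>" and Y: "Y holomorphic_on ball 0 \<rho>" and \<rho>: "\<rho> > 0"
    and inj: "inj_on (\<lambda>t. (X t, Y t)) (ball 0 \<rho>)"
    and F: "\<And>t. t \<in> ball 0 \<rho> \<Longrightarrow> pfun D a (X t) (Y t) = 0"
    and nc: "\<not> X constant_on ball 0 \<rho>"
    and W: "open W" "(X 0, Y 0) \<in> W"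
      "\<And>x y. (x, y) \<in> W \<Longrightarrow> pfun D a x y = 0 \<Longrightarrow> pfun D (coeff_dx D a) x y = 0 \<Longrightarrow>
        pfun D (coeff_dy D a) x y = 0 \<Longrightarrow> (x, y) = (X 0, Y 0)"
  obtains \<eta> where "\<eta> > 0" "\<And>t. 0 < norm t \<Longrightarrow> norm t < \<eta> \<Longrightarrow> pfun D (coeff_dy D a) (X t) (Y t) \<noteq> 0"
proof -
  let ?Fx = "\<lambda>t. pfun D (coeff_dx D a) (X t) (Y t)" and ?Fy = "\<lambda>t. pfun D (coeff_dy D a) (X t) (Y t)"
  have hol: "?Fx holomorphic_on ball 0 \<rho>" "?Fy holomorphic_on ball 0 \<rho>"
    by (intro holomorphic_intros X Y)+
  have cX: "continuous_on (ball 0 \<rho>) X" and cY: "continuous_on (ball 0 \<rho>) Y"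
    using X Y by (auto intro: holomorphic_on_imp_continuous_on)
  \<comment> \<open>If the \<open>y\<close>-derivative vanished along the arc, then by the chain rule so would the
     \<open>x\<close>-derivative, and the arc would consist of singular points.\<close>
  have "\<exists>t0\<in>ball 0 \<rho>. ?Fy t0 \<noteq> 0"
  proof (rule ccontr)
    assume "\<not> ?thesis"
    then have Fy0: "?Fy t = 0" if "t \<in> ball 0 \<rho>" for t using that by blast
    have prod0: "?Fx t * deriv X t = 0" if t: "t \<in> ball 0 \<rho>" for t
    proof -
      have "((\<lambda>t. pfun D a (X t) (Y t)) has_field_derivative
          ?Fx t * deriv X t + ?Fy t * deriv Y t) (at t)"
        using t by (intro DERIV_pfun_chain holomorphic_derivI[OF X] holomorphic_derivI[OF Y]) auto
      moreover have "((\<lambda>t. pfun D a (X t) (Y t)) has_field_derivative 0) (at t)"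
        by (rule has_field_derivative_transform_within_open[OF DERIV_const[of 0] open_ball t]) (use F in auto)
      ultimately show ?thesis using Fy0[OF t] DERIV_unique by fastforce
    qed
    \<comment> \<open>As \<open>X\<close> is not constant, its derivative is not identically zero
      and can be cancelled from \<open>prod0\<close>.\<close>
    have "\<exists>t1\<in>ball 0 \<rho>. deriv X t1 \<noteq> 0"
    proof (rule ccontr)
      assume "\<not> ?thesis"
      then have "DERIV X t :> 0" if "t \<in> ball 0 \<rho>" for t
        using holomorphic_derivI[OF X open_ball that] that by force
      then have "X constant_on ball 0 \<rho>"
        by (intro DERIV_zero_connected_constant_on[where K = "{}"] cX) auto
      then show False using nc by blast
    qed
    then obtain t1 where t1: "t1 \<in> ball 0 \<rho>" "deriv X t1 \<noteq> 0" by blast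
    have Fx0: "?Fx t = 0" if "t \<in> ball 0 \<rho>" for t
      using holomorphic_mult_eq_0[OF holomorphic_deriv[OF X open_ball] hol(1) open_ball connected_ball _ t1 that]
        prod0 by (simp add: mult.commute)
    have "open (ball 0 \<rho> \<inter> (\<lambda>t. (X t, Y t)) -` W)"
      by (rule continuous_open_preimage[OF continuous_on_Pair[OF cX cY] open_ball W(1)])
    moreover have "0 \<in> ball 0 \<rho> \<inter> (\<lambda>t. (X t, Y t)) -` W" using W(2) \<rho> by simp
    ultimately obtain d where d: "d > 0" "ball 0 d \<subseteq> ball 0 \<rho> \<inter> (\<lambda>t. (X t, Y t)) -` W"
      by (meson open_contains_ball)
    \<comment> \<open>A nonzero parameter so small that the arc is still in \<open>W\<close>: its
      image is singular, hence the base point, against injectivity.\<close>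
    define t where "t = complex_of_real (d / 2)"
    have t: "t \<in> ball 0 d" "t \<noteq> 0" using d by (auto simp: t_def)
    then have t': "t \<in> ball 0 \<rho>" "(X t, Y t) \<in> W" using d by auto
    then have "(X t, Y t) = (X 0, Y 0)" using W(3) F Fx0 Fy0 by blast
    then show False using inj t t' \<rho> by (auto simp: inj_on_def)
  qed
  then obtain t0 where t0: "t0 \<in> ball 0 \<rho>" "?Fy t0 \<noteq> 0" by blast
  show thesis
  proof (cases "?Fy 0 = 0")
    case True
    obtain r where r: "0 < r" "\<And>z. z \<in> ball 0 r - {0} \<Longrightarrow> ?Fy z \<noteq> 0"
      using isolated_zeros[OF hol(2) open_ball connected_ball _ True t0] \<rho> by (metis centre_in_ball)
    then show thesis by (intro that[of r]) auto
  next
    case False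
    have "isCont ?Fy 0"
      using holomorphic_on_imp_continuous_on[OF hol(2)] \<rho> by (simp add: continuous_on_eq_continuous_at)
    then obtain r where r: "r > 0" "\<And>z. dist 0 z < r \<Longrightarrow> ?Fy z \<noteq> 0"
      using continuous_at_avoid[of 0 ?Fy 0] False by auto
    then show thesis by (intro that[of r]) auto
  qed
qed

section \<open>Growth of the norm on the central and on the nearby fibres\<close>

text \<open>Let \<open>\<mu>\<close> be the minimum of the modulus on the circle over
  \<open>x = 0\<close>. Half of it pays for moving \<open>x\<close>, by uniform continuity, the
  other half for perturbing the coefficients. Radii of at most 1 let the sum of the moduli of the
  coefficients bound a polynomial.\<close>

lemma circle_nonzero_nhd:
  assumes nz: "circle_nonzero D a \<delta> 0" and \<delta>: "0 < \<delta>" "\<delta> \<le> 1"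
    and ak: "\<And>i j. (\<lambda>k. ak k i j) \<longlonglongrightarrow> a i j"
  obtains \<epsilon> where "0 < \<epsilon>" "\<epsilon> \<le> 1" "\<And>x. x \<in> ball 0 \<epsilon> \<Longrightarrow> circle_nonzero D a \<delta> x"
    "eventually (\<lambda>k. \<forall>x\<in>ball 0 \<epsilon>. circle_nonzero D (ak k) \<delta> x) sequentially"
proof -
  have "compact (sphere (0::complex) \<delta>)" "sphere (0::complex) \<delta> \<noteq> {}" using \<delta> by auto
  moreover have "continuous_on (sphere 0 \<delta>) (\<lambda>y. norm (pfun D a 0 y))" by (intro continuous_intros)
  ultimately obtain y0 where y0: "norm y0 = \<delta>"
    "\<And>y. norm y = \<delta> \<Longrightarrow> norm (pfun D a 0 y0) \<le> norm (pfun D a 0 y)"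
    using continuous_attains_inf[of "sphere 0 \<delta>" "\<lambda>y. norm (pfun D a 0 y)"] by auto
  define \<mu> where "\<mu> = norm (pfun D a 0 y0)"
  have \<mu>: "\<mu> > 0" "\<And>y. norm y = \<delta> \<Longrightarrow> \<mu> \<le> norm (pfun D a 0 y)"
    using y0 nz by (auto simp: \<mu>_def circle_nonzero_def)
  have "uniformly_continuous_on (cball 0 1 \<times> cball 0 1) (\<lambda>z. pfun D a (fst z) (snd z))"
    by (intro compact_uniformly_continuous continuous_intros compact_Times) auto
  then obtain d where d: "d > 0" "\<And>z z'. z \<in> cball 0 1 \<times> cball 0 1 \<Longrightarrow> z' \<in> cball 0 1 \<times> cball 0 1 \<Longrightarrow>
      dist z' z < d \<Longrightarrow> dist (pfun D a (fst z') (snd z')) (pfun D a (fst z) (snd z)) < \<mu> / 2"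
    using \<mu>(1) unfolding uniformly_continuous_on_def by (meson half_gt_zero)
  define \<epsilon> where "\<epsilon> = min d 1"
  have low: "\<mu> / 2 < norm (pfun D a x y)" if "x \<in> ball 0 \<epsilon>" "norm y = \<delta>" for x y
  proof -
    have "dist (pfun D a x y) (pfun D a 0 y) < \<mu> / 2"
      using d(2)[of "(0, y)" "(x, y)"] that \<delta> by (auto simp: \<epsilon>_def dist_Pair_Pair)
    then show ?thesis using \<mu>(2)[OF that(2)] norm_triangle_ineq2[of "pfun D a 0 y" "pfun D a x y"]
      by (simp add: dist_norm norm_minus_commute)
  qed
  have "(\<lambda>k. \<Sum>i\<le>D. \<Sum>j\<le>D. norm (ak k i j - a i j)) \<longlonglongrightarrow> (\<Sum>i\<le>D. \<Sum>j\<le>D. norm (a i j - a i j))"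
    by (intro tendsto_intros ak)
  then have "(\<lambda>k. \<Sum>i\<le>D. \<Sum>j\<le>D. norm (ak k i j - a i j)) \<longlonglongrightarrow> 0" by simp
  then have ev: "eventually (\<lambda>k. (\<Sum>i\<le>D. \<Sum>j\<le>D. norm (ak k i j - a i j)) < \<mu> / 2) sequentially"
    using \<mu>(1) by (intro order_tendstoD) auto
  show thesis
  proof (rule that[of \<epsilon>])
    show "circle_nonzero D a \<delta> x" if "x \<in> ball 0 \<epsilon>" for x
      unfolding circle_nonzero_def using low[OF that] \<mu>(1) by (metis half_gt_zero norm_zero not_less_iff_gr_or_eq)
    show "eventually (\<lambda>k. \<forall>x\<in>ball 0 \<epsilon>. circle_nonzero D (ak k) \<delta> x) sequentially"
      using ev
    proof eventually_elim
      case (elim k)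
      show ?case
        unfolding circle_nonzero_def
      proof (intro ballI allI impI notI)
        fix x y assume x: "x \<in> ball (0::complex) \<epsilon>" and y: "norm y = \<delta>" and 0: "pfun D (ak k) x y = 0"
        have "norm (pfun D (ak k) x y - pfun D a x y) \<le> (\<Sum>i\<le>D. \<Sum>j\<le>D. norm (ak k i j - a i j))"
          unfolding pfun_diff using x y \<delta> by (intro norm_pfun_le) (auto simp: \<epsilon>_def)
        then show False using elim low[OF x y] 0 by simp
      qed
    qed
  qed (use d in \<open>auto simp: \<epsilon>_def\<close>)
qed

lemma root_mult_simple:
  assumes "pfun D a x y = 0" "pfun D (coeff_dy D a) x y \<noteq> 0"
  shows "root_mult D a x y = 1"
proof -
  have "deriv (pfun D a x) y = pfun D (coeff_dy D a) x y"
    by (intro DERIV_imp_deriv DERIV_pfun_y)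
  moreover have "pfun D a x holomorphic_on UNIV" by (intro holomorphic_intros)
  ultimately have "zorder (pfun D a x) y = 1"
    using assms by (intro zorder_zero_eqI[of _ UNIV]) auto
  then show ?thesis by (simp add: root_mult_def)
qed

text \<open>Over a small \<open>x \<noteq> 0\<close> the roots in the disc are exactly the points
  \<open>Y t\<close> with \<open>X t = x\<close>; there are \<open>e\<close> of them, all simple.
  The norm is the product of the \<open>e\<close> values of the test function, each at least
  \<open>c * norm t ^ m\<close>, and \<open>norm t ^ e\<close> is comparable to
  \<open>norm x\<close>; this multiplies up to the power \<open>m\<close> of
  \<open>norm x\<close>.\<close>

lemma root_norm_lower_bound:
  fixes X Y :: "complex \<Rightarrow> complex"
  assumes X: "X holomorphic_on ball 0 \<rho>" and Y: "Y holomorphic_on ball 0 \<rho>" and \<rho>: "\<rho> > 0"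
    and X0: "X 0 = 0" and Y0: "Y 0 = 0"
    and inj: "inj_on (\<lambda>t. (X t, Y t)) (ball 0 \<rho>)"
    and F: "\<And>t. t \<in> ball 0 \<rho> \<Longrightarrow> pfun D a (X t) (Y t) = 0"
    and param: "\<And>\<eta>. 0 < \<eta> \<Longrightarrow> \<eta> \<le> \<rho> \<Longrightarrow> \<exists>U. open U \<and> (0, 0) \<in> U \<and>
        (\<forall>x y. (x, y) \<in> U \<longrightarrow> pfun D a x y = 0 \<longrightarrow> (x, y) \<in> (\<lambda>t. (X t, Y t)) ` ball 0 \<eta>)"
    and W: "open W" "(0, 0) \<in> W"
      "\<And>x y. (x, y) \<in> W \<Longrightarrow> pfun D a x y = 0 \<Longrightarrow> pfun D (coeff_dx D a) x y = 0 \<Longrightarrow>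
        pfun D (coeff_dy D a) x y = 0 \<Longrightarrow> (x, y) = (0, 0)"
    and nz: "pfun D a 0 y0 \<noteq> 0"
    and c: "c > 0" and G: "\<And>t. t \<in> ball 0 \<rho> \<Longrightarrow> c * norm t ^ m \<le> norm (pfun E b (X t) (Y t))"
  obtains \<delta> \<epsilon> c' where "0 < \<delta>" "\<delta> \<le> 1" "circle_nonzero D a \<delta> 0" "\<epsilon> > 0" "c' > 0"
    "\<And>x. 0 < norm x \<Longrightarrow> norm x < \<epsilon> \<Longrightarrow> c' * norm x ^ m \<le> norm (root_norm D a E b \<delta> x)"
proof -
  have nc: "\<not> X constant_on ball 0 \<rho>"
    by (rule arc_not_vertical[OF inj \<rho> F, of y0]) (use nz X0 in auto)
  obtain \<eta>1 where \<eta>1: "\<eta>1 > 0"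
    "\<And>t. 0 < norm t \<Longrightarrow> norm t < \<eta>1 \<Longrightarrow> pfun D (coeff_dy D a) (X t) (Y t) \<noteq> 0"
    using arc_partial_y_nonzero[OF X Y \<rho> inj F nc W(1)] W(2,3) unfolding X0 Y0 by blast
  obtain e r c1 C1 where e: "e > 0" and r: "0 < r" "r \<le> \<rho>" and C1: "C1 > 0"
    and Xe: "\<And>t. t \<in> ball 0 r \<Longrightarrow> c1 * norm t ^ e \<le> norm (X t - X 0) \<and> norm (X t - X 0) \<le> C1 * norm t ^ e"
    and fib: "\<And>\<eta>. 0 < \<eta> \<Longrightarrow> \<eta> \<le> r \<Longrightarrow> \<exists>\<kappa>>0. \<forall>x. 0 < norm (x - X 0) \<and> norm (x - X 0) < \<kappa> \<longrightarrow>
        card {t \<in> ball 0 \<eta>. X t = x} = e"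
    by (rule holomorphic_local_power_map[OF X \<rho> nc]) blast
  define \<eta> where "\<eta> = min r \<eta>1"
  have \<eta>: "0 < \<eta>" "\<eta> \<le> r" "\<eta> \<le> \<eta>1" "\<eta> \<le> \<rho>" using r \<eta>1 by (auto simp: \<eta>_def)
  obtain U where U: "open U" "(0, 0) \<in> U"
    "\<And>x y. (x, y) \<in> U \<Longrightarrow> pfun D a x y = 0 \<Longrightarrow> (x, y) \<in> (\<lambda>t. (X t, Y t)) ` ball 0 \<eta>"
    using param[OF \<eta>(1,4)] by blast
  obtain \<delta>1 where \<delta>1: "\<delta>1 > 0" "ball (0, 0) \<delta>1 \<subseteq> U" using U(1,2) open_contains_ball by blast
  obtain \<delta>0 where \<delta>0: "\<delta>0 > 0" "\<And>y. pfun D a 0 y = 0 \<Longrightarrow> y \<noteq> 0 \<Longrightarrow> \<delta>0 \<le> dist 0 y"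
    using finite_set_avoid[OF finite_roots_pfun[OF nz], of 0] by blast
  \<comment> \<open>Below \<open>\<delta>0\<close> the circle avoids the nonzero roots over
    \<open>x = 0\<close>; half of \<open>\<delta>1\<close> keeps the bidisc inside \<open>U\<close>,
    where the curve is covered by the arc.\<close>
  define \<delta> where "\<delta> = min 1 (min (\<delta>0 / 2) (\<delta>1 / 2))"
  have \<delta>: "0 < \<delta>" "\<delta> \<le> 1" "\<delta> < \<delta>0" "\<delta> \<le> \<delta>1 / 2" using \<delta>0 \<delta>1 by (auto simp: \<delta>_def)
  have circ: "circle_nonzero D a \<delta> 0"
    unfolding circle_nonzero_def using \<delta>0(2) \<delta> by fastforce
  have "isCont Y 0"
    using holomorphic_on_imp_continuous_on[OF Y] \<rho> by (simp add: continuous_on_eq_continuous_at)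
  then obtain d where d: "d > 0" "\<And>t. dist t 0 < d \<Longrightarrow> dist (Y t) (Y 0) < \<delta>"
    using \<delta>(1) unfolding continuous_at_eps_delta by meson
  \<comment> \<open>On the smaller disc \<open>Y\<close> stays below \<open>\<delta>\<close>. Both
    discs contain \<open>e\<close> preimages of a small \<open>x \<noteq> 0\<close>, so these
    coincide and all of them give roots inside the circle.\<close>
  define \<eta>2 where "\<eta>2 = min d \<eta>"
  have \<eta>2: "0 < \<eta>2" "\<eta>2 \<le> \<eta>" "\<eta>2 \<le> r" "\<And>t. t \<in> ball 0 \<eta>2 \<Longrightarrow> norm (Y t) < \<delta>"
    using d \<eta> by (auto simp: \<eta>2_def Y0 dist_norm)
  obtain \<kappa>1 where \<kappa>1: "\<kappa>1 > 0" "\<And>x. 0 < norm x \<Longrightarrow> norm x < \<kappa>1 \<Longrightarrow> card {t \<in> ball 0 \<eta>. X t = x} = e"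
    using fib[OF \<eta>(1,2)] unfolding X0 by auto
  obtain \<kappa>2 where \<kappa>2: "\<kappa>2 > 0" "\<And>x. 0 < norm x \<Longrightarrow> norm x < \<kappa>2 \<Longrightarrow> card {t \<in> ball 0 \<eta>2. X t = x} = e"
    using fib[OF \<eta>2(1,3)] unfolding X0 by auto
  define \<epsilon> where "\<epsilon> = min \<kappa>1 (min \<kappa>2 (\<delta>1 / 2))"
  show thesis
  proof (rule that[OF \<delta>(1,2) circ, of \<epsilon> "c ^ e / C1 ^ m"])
    show "\<epsilon> > 0" using \<kappa>1 \<kappa>2 \<delta>1 by (auto simp: \<epsilon>_def)
    show "c ^ e / C1 ^ m > 0" using c C1 by simp
    fix x :: complex assume x: "0 < norm x" "norm x < \<epsilon>"
    define T where "T = {t \<in> ball 0 \<eta>. X t = x}"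
    have cT: "card T = e" using \<kappa>1(2)[of x] x by (simp add: T_def \<epsilon>_def)
    then have finT: "finite T" using e by (intro card_ge_0_finite) auto
    have "{t \<in> ball 0 \<eta>2. X t = x} = T"
    proof (rule card_subset_eq[OF finT])
      show "{t \<in> ball 0 \<eta>2. X t = x} \<subseteq> T" using \<eta>2 by (auto simp: T_def)
      show "card {t \<in> ball 0 \<eta>2. X t = x} = card T" using \<kappa>2(2)[of x] x cT by (simp add: \<epsilon>_def)
    qed
    then have YT: "norm (Y t) < \<delta>" if "t \<in> T" for t using \<eta>2(4) that by blast
    have T\<rho>: "t \<in> ball 0 \<rho>" "t \<in> ball 0 r" "X t = x" "norm t < \<eta>1" "t \<noteq> 0" if "t \<in> T" for t
      using that \<eta> x X0 by (auto simp: T_def)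
    have roots: "root_set D a \<delta> x = Y ` T"
    proof (intro equalityI subsetI)
      fix y assume y: "y \<in> root_set D a \<delta> x"
      have "norm (x, y) \<le> norm x + norm y" by (rule norm_Pair_le)
      also have "\<dots> < \<delta>1" using x y \<delta> by (auto simp: root_set_def \<epsilon>_def)
      finally have "(x, y) \<in> U" using \<delta>1 by (auto simp: dist_norm zero_prod_def[symmetric])
      then have "(x, y) \<in> (\<lambda>t. (X t, Y t)) ` ball 0 \<eta>" using U(3) y by (auto simp: root_set_def)
      then show "y \<in> Y ` T" by (auto simp: T_def)
    next
      fix y assume "y \<in> Y ` T"
      then show "y \<in> root_set D a \<delta> x" using YT T\<rho> F by (fastforce simp: root_set_def)
    qed
    have injY: "inj_on Y T"
      using inj T\<rho>(1,3) unfolding inj_on_def by (metis prod.inject)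
    have mult: "root_mult D a x (Y t) = 1" if "t \<in> T" for t
      using root_mult_simple[of D a x "Y t"] F[of t] \<eta>1(2)[of t] T\<rho>[OF that] by auto
    have "root_norm D a E b \<delta> x = (\<Prod>t\<in>T. pfun E b (X t) (Y t))"
      unfolding root_norm_def roots by (subst prod.reindex[OF injY]) (auto simp: mult T\<rho> intro!: prod.cong)
    then have R: "norm (root_norm D a E b \<delta> x) = (\<Prod>t\<in>T. norm (pfun E b (X t) (Y t)))"
      by (simp add: prod_norm)
    \<comment> \<open>A lower bound for the modulus of every preimage, read off from
      \<open>norm x \<le> C1 * norm t ^ e\<close>.\<close>
    define u where "u = root e (norm x / C1)"
    have u: "u \<ge> 0" "u ^ e = norm x / C1" using e C1 by (auto simp: u_def real_root_pow_pos2)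
    have "(\<Prod>t\<in>T. c * u ^ m) \<le> (\<Prod>t\<in>T. norm (pfun E b (X t) (Y t)))"
    proof (rule prod_mono, rule conjI)
      fix t assume t: "t \<in> T"
      have "norm x \<le> C1 * norm t ^ e" using Xe[of t] T\<rho>[OF t] X0 by auto
      then have "u ^ e \<le> norm t ^ e" unfolding u(2) using C1 by (simp add: field_simps)
      then have "u \<le> norm t" using e u(1) by (metis norm_ge_zero power_mono_iff)
      then have "c * u ^ m \<le> c * norm t ^ m" using c u by (intro mult_left_mono power_mono) auto
      also have "\<dots> \<le> norm (pfun E b (X t) (Y t))" using G T\<rho>[OF t] by auto
      finally show "c * u ^ m \<le> norm (pfun E b (X t) (Y t))" .
    qed (use c u in auto)
    \<comment> \<open>The \<open>e\<close>-th root disappears: \<open>e\<close> factors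
      \<open>u ^ m\<close> make \<open>(u ^ e) ^ m\<close>.\<close>
    also have "(\<Prod>t\<in>T. c * u ^ m) = c ^ e * (u ^ e) ^ m"
      by (simp add: cT power_mult_distrib flip: power_mult) (simp add: mult.commute)
    finally show "c ^ e / C1 ^ m * norm x ^ m \<le> norm (root_norm D a E b \<delta> x)"
      unfolding R u(2) by (simp add: power_divide)
  qed
qed

text \<open>Other branches may meet the disc here, so the arc supplies only some of the roots; the
  remaining ones are absorbed by \<open>M\<close>. The constants may depend on the arc, as only the
  order of vanishing is used afterwards.\<close>

lemma root_norm_local_upper_bound:
  fixes X Y :: "complex \<Rightarrow> complex"
  assumes X: "X holomorphic_on ball 0 \<rho>" and Y: "Y holomorphic_on ball 0 \<rho>" and \<rho>: "\<rho> > 0"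
    and inj: "inj_on (\<lambda>t. (X t, Y t)) (ball 0 \<rho>)"
    and F: "\<And>t. t \<in> ball 0 \<rho> \<Longrightarrow> pfun D a (X t) (Y t) = 0"
    and G: "\<And>t. t \<in> ball 0 \<rho> \<Longrightarrow> norm (pfun E b (X t) (Y t)) \<le> C * norm t ^ n"
    and \<delta>: "0 < \<delta>" and circ: "\<And>x. x \<in> ball 0 \<epsilon> \<Longrightarrow> circle_nonzero D a \<delta> x"
    and X0: "norm (X 0) < \<epsilon>" and Y0: "norm (Y 0) < \<delta>"
    and M: "M \<ge> 1" "\<And>x y. norm x < \<epsilon> \<Longrightarrow> norm y < \<delta> \<Longrightarrow> norm (pfun E b x y) \<le> M"
  obtains \<kappa> C' where "\<kappa> > 0"
    "\<And>x. 0 < norm (x - X 0) \<Longrightarrow> norm (x - X 0) < \<kappa> \<Longrightarrow>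
      norm (root_norm D a E b \<delta> x) \<le> C' * norm (x - X 0) ^ n"
proof -
  obtain y0 where y0: "pfun D a (X 0) y0 \<noteq> 0" using circle_nonzero_ex[OF circ \<delta>] X0 by auto
  have nc: "\<not> X constant_on ball 0 \<rho>"
    by (rule arc_not_vertical[OF inj \<rho> F y0])
  obtain e r c1 C1 where e: "e > 0" and r: "0 < r" "r \<le> \<rho>" and c1: "c1 > 0"
    and Xe: "\<And>t. t \<in> ball 0 r \<Longrightarrow> c1 * norm t ^ e \<le> norm (X t - X 0) \<and> norm (X t - X 0) \<le> C1 * norm t ^ e"
    and fib: "\<And>\<eta>. 0 < \<eta> \<Longrightarrow> \<eta> \<le> r \<Longrightarrow> \<exists>\<kappa>>0. \<forall>x. 0 < norm (x - X 0) \<and> norm (x - X 0) < \<kappa> \<longrightarrow>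
        card {t \<in> ball 0 \<eta>. X t = x} = e"
    by (rule holomorphic_local_power_map[OF X \<rho> nc]) blast
  have "isCont Y 0"
    using holomorphic_on_imp_continuous_on[OF Y] \<rho> by (simp add: continuous_on_eq_continuous_at)
  then obtain d where d: "d > 0" "\<And>t. dist t 0 < d \<Longrightarrow> dist (Y t) (Y 0) < \<delta> - norm (Y 0)"
    using Y0 unfolding continuous_at_eps_delta by (meson diff_gt_0_iff_gt)
  define \<eta> where "\<eta> = min d r"
  have \<eta>: "0 < \<eta>" "\<eta> \<le> r" "\<eta> \<le> \<rho>" using d r by (auto simp: \<eta>_def)
  have Y\<eta>: "norm (Y t) < \<delta>" if "t \<in> ball 0 \<eta>" for t
  proof -
    have "norm (Y t - Y 0) < \<delta> - norm (Y 0)" using d(2)[of t] that by (simp add: \<eta>_def dist_norm)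
    then show ?thesis using norm_triangle_ineq2[of "Y t" "Y 0"] by linarith
  qed
  obtain \<kappa>1 where \<kappa>1: "\<kappa>1 > 0"
    "\<And>x. 0 < norm (x - X 0) \<Longrightarrow> norm (x - X 0) < \<kappa>1 \<Longrightarrow> card {t \<in> ball 0 \<eta>. X t = x} = e"
    using fib[OF \<eta>(1,2)] by auto
  define \<kappa> where "\<kappa> = min \<kappa>1 (\<epsilon> - norm (X 0))"
  \<comment> \<open>From here on \<open>d\<close> is the number of roots and no longer a
    radius.\<close>
  define d where "d = root_count D a \<delta> 0"
  \<comment> \<open>\<open>C\<close> is not known to be nonnegative, which monotonicity in
    \<open>norm t ^ n\<close> requires.\<close>
  define C0 where "C0 = max C 0"
  have G: "norm (pfun E b (X t) (Y t)) \<le> C0 * norm t ^ n" if "t \<in> ball 0 \<rho>" for t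
    by (rule order.trans[OF G[OF that]]) (auto simp: C0_def intro!: mult_right_mono)
  show thesis
  proof (rule that[of \<kappa> "M ^ d * C0 ^ e / c1 ^ n"])
    show "\<kappa> > 0" using \<kappa>1 X0 by (auto simp: \<kappa>_def)
    fix x assume x: "0 < norm (x - X 0)" "norm (x - X 0) < \<kappa>"
    have xe: "norm x < \<epsilon>" using x norm_triangle_ineq2[of x "X 0"] by (simp add: \<kappa>_def)
    define T where "T = {t \<in> ball 0 \<eta>. X t = x}"
    have cT: "card T = e" using \<kappa>1(2)[of x] x by (simp add: T_def \<kappa>_def)
    have T\<rho>: "t \<in> ball 0 \<rho>" "t \<in> ball 0 r" "X t = x" "norm (Y t) < \<delta>" if "t \<in> T" for t
      using that \<eta> Y\<eta> by (auto simp: T_def)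
    have sub: "Y ` T \<subseteq> root_set D a \<delta> x" using T\<rho> F by (fastforce simp: root_set_def)
    have injY: "inj_on Y T"
      using inj T\<rho>(1,3) unfolding inj_on_def by (metis prod.inject)
    define u where "u = root e (norm (x - X 0) / c1)"
    have u: "u \<ge> 0" "u ^ e = norm (x - X 0) / c1" using e c1 by (auto simp: u_def real_root_pow_pos2)
    have "norm (root_norm D a E b \<delta> x) \<le> M ^ root_count D a \<delta> x * (\<Prod>y\<in>Y ` T. norm (pfun E b x y))"
      using xe circ M sub \<delta> by (intro norm_root_norm_le) auto
    also have "root_count D a \<delta> x = d"
      unfolding d_def by (rule root_count_constant[OF circ \<delta>]) (use xe in auto)
    also have "(\<Prod>y\<in>Y ` T. norm (pfun E b x y)) = (\<Prod>t\<in>T. norm (pfun E b (X t) (Y t)))"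
      by (subst prod.reindex[OF injY]) (auto simp: T\<rho> intro!: prod.cong)
    also have "\<dots> \<le> (\<Prod>t\<in>T. C0 * u ^ n)"
    proof (rule prod_mono, rule conjI)
      fix t assume t: "t \<in> T"
      have "c1 * norm t ^ e \<le> norm (x - X 0)" using Xe[of t] T\<rho>[OF t] by auto
      then have "norm t ^ e \<le> u ^ e" unfolding u(2) using c1 by (simp add: field_simps)
      then have "norm t \<le> u" using e u(1) by (metis norm_ge_zero power_mono_iff)
      then have "C0 * norm t ^ n \<le> C0 * u ^ n" by (intro mult_left_mono power_mono) (auto simp: C0_def)
      then show "norm (pfun E b (X t) (Y t)) \<le> C0 * u ^ n" using G[of t] T\<rho>[OF t] by auto
    qed auto
    also have "(\<Prod>t\<in>T. C0 * u ^ n) = C0 ^ e * (u ^ e) ^ n"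
      by (simp add: cT power_mult_distrib flip: power_mult) (simp add: mult.commute)
    finally show "norm (root_norm D a E b \<delta> x) \<le> M ^ d * C0 ^ e / c1 ^ n * norm (x - X 0) ^ n"
      unfolding u(2) using M(1) by (simp add: power_divide mult_left_mono)
  qed
qed

text \<open>Near 0 the norm of the limit is caught between \<open>c' * norm x ^ m\<close> and a
  multiple of \<open>norm x ^ n\<close>, which forces \<open>n \<le> m\<close>. The arcs on the
  approximating curves have radii and constants depending on \<open>k\<close>; the Schwarz bound is
  what makes the upper estimate uniform.\<close>

lemma intersection_order_semicontinuous:
  fixes X Y :: "complex \<Rightarrow> complex" and ak bk :: "nat \<Rightarrow> nat \<Rightarrow> nat \<Rightarrow> complex"
  assumes X: "X holomorphic_on ball 0 \<rho>" and Y: "Y holomorphic_on ball 0 \<rho>" and \<rho>: "\<rho> > 0"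
    and X0: "X 0 = 0" and Y0: "Y 0 = 0"
    and inj: "inj_on (\<lambda>t. (X t, Y t)) (ball 0 \<rho>)"
    and F: "\<And>t. t \<in> ball 0 \<rho> \<Longrightarrow> pfun D a (X t) (Y t) = 0"
    and param: "\<And>\<eta>. 0 < \<eta> \<Longrightarrow> \<eta> \<le> \<rho> \<Longrightarrow> \<exists>U. open U \<and> (0, 0) \<in> U \<and>
        (\<forall>x y. (x, y) \<in> U \<longrightarrow> pfun D a x y = 0 \<longrightarrow> (x, y) \<in> (\<lambda>t. (X t, Y t)) ` ball 0 \<eta>)"
    and W: "open W" "(0, 0) \<in> W"
      "\<And>x y. (x, y) \<in> W \<Longrightarrow> pfun D a x y = 0 \<Longrightarrow> pfun D (coeff_dx D a) x y = 0 \<Longrightarrow>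
        pfun D (coeff_dy D a) x y = 0 \<Longrightarrow> (x, y) = (0, 0)"
    and nz: "pfun D a 0 y0 \<noteq> 0"
    and c: "c > 0" and G: "\<And>t. t \<in> ball 0 \<rho> \<Longrightarrow> c * norm t ^ m \<le> norm (pfun E b (X t) (Y t))"
    and ak: "\<And>i j. (\<lambda>k. ak k i j) \<longlonglongrightarrow> a i j" and bk: "\<And>i j. (\<lambda>k. bk k i j) \<longlonglongrightarrow> b i j"
    and pk: "pk \<longlonglongrightarrow> 0" and qk: "qk \<longlonglongrightarrow> 0"
    and arcs: "\<And>k. \<exists>\<rho> \<xi> \<upsilon> C. \<rho> > 0 \<and> \<xi> holomorphic_on ball 0 \<rho> \<and> \<upsilon> holomorphic_on ball 0 \<rho> \<and>
        \<xi> 0 = pk k \<and> \<upsilon> 0 = qk k \<and> inj_on (\<lambda>t. (\<xi> t, \<upsilon> t)) (ball 0 \<rho>) \<and>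
        (\<forall>t\<in>ball 0 \<rho>. pfun D (ak k) (\<xi> t) (\<upsilon> t) = 0 \<and>
           norm (pfun E (bk k) (\<xi> t) (\<upsilon> t)) \<le> C * norm t ^ n)"
  shows "n \<le> m"
proof -
  obtain \<delta> \<epsilon>1 c' where \<delta>: "0 < \<delta>" "\<delta> \<le> 1" and circ0: "circle_nonzero D a \<delta> 0"
    and \<epsilon>1: "\<epsilon>1 > 0" and c': "c' > 0"
    and low: "\<And>x. 0 < norm x \<Longrightarrow> norm x < \<epsilon>1 \<Longrightarrow> c' * norm x ^ m \<le> norm (root_norm D a E b \<delta> x)"
    by (rule root_norm_lower_bound[OF X Y \<rho> X0 Y0 inj F param W nz c G]) blast+
  obtain \<epsilon> where \<epsilon>: "0 < \<epsilon>" "\<epsilon> \<le> 1" and circ: "\<And>x. x \<in> ball 0 \<epsilon> \<Longrightarrow> circle_nonzero D a \<delta> x"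
    and circk: "eventually (\<lambda>k. \<forall>x\<in>ball 0 \<epsilon>. circle_nonzero D (ak k) \<delta> x) sequentially"
    by (rule circle_nonzero_nhd[OF circ0 \<delta> ak]) blast
  define M where "M = (\<Sum>i\<le>E. \<Sum>j\<le>E. norm (b i j)) + 1"
  have M: "M \<ge> 1" unfolding M_def by (simp add: sum_nonneg)
  have "(\<lambda>k. \<Sum>i\<le>E. \<Sum>j\<le>E. norm (bk k i j)) \<longlonglongrightarrow> (\<Sum>i\<le>E. \<Sum>j\<le>E. norm (b i j))"
    by (intro tendsto_sum tendsto_norm bk)
  then have Mk: "eventually (\<lambda>k. (\<Sum>i\<le>E. \<Sum>j\<le>E. norm (bk k i j)) < M) sequentially"
    by (rule order_tendstoD) (simp add: M_def)
  have pk': "eventually (\<lambda>k. norm (pk k) < \<epsilon> / 4) sequentially"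
    using tendstoD[OF pk, of "\<epsilon> / 4"] \<epsilon> by simp
  have qk': "eventually (\<lambda>k. norm (qk k) < \<delta>) sequentially"
    using tendstoD[OF qk, of \<delta>] \<delta> by simp
  obtain K where K: "\<And>k. k \<ge> K \<Longrightarrow> (\<forall>x\<in>ball 0 \<epsilon>. circle_nonzero D (ak k) \<delta> x) \<and>
      (\<Sum>i\<le>E. \<Sum>j\<le>E. norm (bk k i j)) < M \<and> norm (pk k) < \<epsilon> / 4 \<and> norm (qk k) < \<delta>"
    using eventually_conj[OF circk eventually_conj[OF Mk eventually_conj[OF pk' qk']]]
    unfolding eventually_sequentially by blast
  \<comment> \<open>Shifted so that the estimates of \<open>K\<close> hold for every index, as the
    limit lemmas for the norm want a zero-free circle for all \<open>k\<close>.\<close>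
  define ak' bk' pk1 where "ak' k = ak (k + K)" and "bk' k = bk (k + K)" and "pk1 k = pk (k + K)" for k
  have ak': "(\<lambda>k. ak' k i j) \<longlonglongrightarrow> a i j" and bk': "(\<lambda>k. bk' k i j) \<longlonglongrightarrow> b i j" for i j
    unfolding ak'_def bk'_def by (intro LIMSEQ_ignore_initial_segment ak bk)+
  have pk1: "pk1 \<longlonglongrightarrow> 0" unfolding pk1_def by (intro LIMSEQ_ignore_initial_segment pk)
  have circk': "circle_nonzero D (ak' k) \<delta> x" if "x \<in> ball 0 \<epsilon>" for k x
    using K[of "k + K"] that by (simp add: ak'_def)
  have Mk': "norm (pfun E (bk' k) x y) \<le> M" if "norm x < \<epsilon>" "norm y < \<delta>" for k x y
    using K[of "k + K"] that \<delta> \<epsilon> by (intro order.trans[OF norm_pfun_le]) (auto simp: bk'_def)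
  define d where "d = root_count D a \<delta> 0"
  have dk: "eventually (\<lambda>k. root_count D (ak' k) \<delta> 0 = d) sequentially"
    unfolding d_def using \<epsilon> by (intro tendsto_root_norm(1)[OF circ0 circk' \<delta>(1) ak' bk']) auto
  have upper_k: "norm (root_norm D (ak' k) E (bk' k) \<delta> x) \<le> M ^ d * (norm (x - pk1 k) / (\<epsilon> / 2)) ^ n"
    if dk: "root_count D (ak' k) \<delta> 0 = d" and x: "norm x < \<epsilon> / 4" for k x
  proof -
    let ?R = "root_norm D (ak' k) E (bk' k) \<delta>"
    have p: "norm (pk1 k) < \<epsilon> / 4" using K[of "k + K"] by (simp add: pk1_def)
    have R: "?R holomorphic_on ball 0 \<epsilon>" by (rule holomorphic_on_root_norm[OF circk' \<delta>(1)])
    have bound: "norm (?R z) \<le> M ^ d" if "z \<in> ball 0 \<epsilon>" for z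
    proof -
      \<comment> \<open>No root is singled out: every factor is bounded by \<open>M\<close>.\<close>
      have "norm (?R z) \<le> M ^ root_count D (ak' k) \<delta> z * (\<Prod>y\<in>{}. norm (pfun E (bk' k) z y))"
        using that by (intro norm_root_norm_le circk' \<delta> M Mk') auto
      then show ?thesis using root_count_constant[OF circk' \<delta>(1) that] dk by simp
    qed
    obtain \<rho>' \<xi> \<upsilon> C where \<rho>': "\<rho>' > 0" and \<xi>: "\<xi> holomorphic_on ball 0 \<rho>'"
      and \<upsilon>: "\<upsilon> holomorphic_on ball 0 \<rho>'" and 0: "\<xi> 0 = pk1 k" "\<upsilon> 0 = qk (k + K)"
      and inj': "inj_on (\<lambda>t. (\<xi> t, \<upsilon> t)) (ball 0 \<rho>')"
      and FG: "\<And>t. t \<in> ball 0 \<rho>' \<Longrightarrow> pfun D (ak' k) (\<xi> t) (\<upsilon> t) = 0"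
        "\<And>t. t \<in> ball 0 \<rho>' \<Longrightarrow> norm (pfun E (bk' k) (\<xi> t) (\<upsilon> t)) \<le> C * norm t ^ n"
      using arcs[of "k + K"] unfolding pk1_def ak'_def bk'_def by blast
    have X0: "norm (\<xi> 0) < \<epsilon>" and Y0: "norm (\<upsilon> 0) < \<delta>"
      using p \<epsilon> 0 K[of "k + K"] by auto
    obtain \<kappa> C' where \<kappa>: "\<kappa> > 0"
      "\<And>x. 0 < norm (x - \<xi> 0) \<Longrightarrow> norm (x - \<xi> 0) < \<kappa> \<Longrightarrow> norm (?R x) \<le> C' * norm (x - \<xi> 0) ^ n"
      by (rule root_norm_local_upper_bound[OF \<xi> \<upsilon> \<rho>' inj' FG \<delta>(1) circk' X0 Y0 M Mk']) blast+
    \<comment> \<open>Recentred at \<open>pk1 k\<close>, where the order of vanishing is known.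
      Since \<open>norm (pk1 k) < \<epsilon> / 4\<close>, the disc of radius
      \<open>\<epsilon> / 2\<close> about it lies in the common disc and contains every
      \<open>x\<close> with \<open>norm x < \<epsilon> / 4\<close>.\<close>
    define f where "f z = ?R (pk1 k + z)" for z
    have in_ball: "pk1 k + z \<in> ball 0 \<epsilon>" if "z \<in> ball 0 (\<epsilon> / 2)" for z
      using that p \<epsilon>(1) norm_triangle_ineq[of "pk1 k" z] by auto
    have sub: "(\<lambda>z. pk1 k + z) ` ball 0 (\<epsilon> / 2) \<subseteq> ball 0 \<epsilon>" using in_ball by blast
    have "norm (f (x - pk1 k)) \<le> M ^ d * (norm (x - pk1 k) / (\<epsilon> / 2)) ^ n"
    proof (rule Schwarz_higher_order)
      show "f holomorphic_on ball 0 (\<epsilon> / 2)"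
        unfolding f_def
        by (rule holomorphic_on_compose_gen[OF _ R sub, unfolded o_def]) (intro holomorphic_intros)
      show "norm (f z) \<le> M ^ d" if "z \<in> ball 0 (\<epsilon> / 2)" for z
        unfolding f_def using bound in_ball[OF that] by blast
      show "norm (f z) \<le> C' * norm z ^ n" if "0 < norm z" "norm z < \<kappa>" for z
        using \<kappa>(2)[of "pk1 k + z"] that 0 by (simp add: f_def)
      show "x - pk1 k \<in> ball 0 (\<epsilon> / 2)"
        using x p norm_triangle_ineq4[of x "pk1 k"] by auto
    qed (use \<epsilon> \<kappa> in auto)
    then show ?thesis by (simp add: f_def)
  qed
  have upper: "norm (root_norm D a E b \<delta> x) \<le> M ^ d * (norm x / (\<epsilon> / 2)) ^ n" if x: "norm x < \<epsilon> / 4" for x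
  proof (rule tendsto_le)
    show "(\<lambda>k. norm (root_norm D (ak' k) E (bk' k) \<delta> x)) \<longlonglongrightarrow> norm (root_norm D a E b \<delta> x)"
      using x \<epsilon> by (intro tendsto_norm tendsto_root_norm(2) circ circk' \<delta> ak' bk') auto
    have "(\<lambda>k. M ^ d * (norm (x - pk1 k) / (\<epsilon> / 2)) ^ n) \<longlonglongrightarrow> M ^ d * (norm (x - 0) / (\<epsilon> / 2)) ^ n"
      using \<epsilon> by (intro tendsto_intros pk1) auto
    then show "(\<lambda>k. M ^ d * (norm (x - pk1 k) / (\<epsilon> / 2)) ^ n) \<longlonglongrightarrow> M ^ d * (norm x / (\<epsilon> / 2)) ^ n"
      by simp
    show "eventually (\<lambda>k. norm (root_norm D (ak' k) E (bk' k) \<delta> x) \<le>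
        M ^ d * (norm (x - pk1 k) / (\<epsilon> / 2)) ^ n) sequentially"
      using dk by eventually_elim (rule upper_k[OF _ x])
  qed simp
  show "n \<le> m"
  proof (rule ccontr)
    assume "\<not> n \<le> m"
    then have mn: "n = m + Suc (n - m - 1)" by simp
    define l where "l = n - m - 1"
    define A where "A = M ^ d / (\<epsilon> / 2) ^ n"
    have A: "A > 0" using M \<epsilon> by (simp add: A_def)
    \<comment> \<open>Small enough for both estimates, and with \<open>A * s \<le> c' / 2\<close>,
      against \<open>c' \<le> A * s ^ (n - m)\<close>.\<close>
    define s where "s = min (\<epsilon> / 8) (min (\<epsilon>1 / 2) (c' / (2 * A)))"
    have s: "0 < s" "s < \<epsilon> / 4" "s < \<epsilon>1" "s \<le> c' / (2 * A)" "s \<le> 1"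
      using \<epsilon> \<epsilon>1 c' A by (auto simp: s_def min_def)
    have "c' * s ^ m \<le> A * s ^ n"
      using order.trans[OF low upper, of "of_real s"] s by (simp add: A_def power_divide mult_ac)
    also have "\<dots> = A * s ^ Suc l * s ^ m" by (subst mn) (simp add: power_add l_def mult_ac)
    finally have "c' \<le> A * s ^ Suc l" using s by simp
    also have "\<dots> \<le> A * s"
      using s A by (intro mult_left_mono) (auto simp: mult_left_le power_le_one)
    also have "\<dots> \<le> A * (c' / (2 * A))" using s A by (intro mult_left_mono) auto
    also have "\<dots> < c'" using A c' by simp
    finally show False by simp
  qed
qed

section \<open>Substitution into power series in two variables\<close>

lemma fps_mult_power_nth_eq_0:
  fixes Y :: "'a::idom fps"
  assumes "fps_nth Y 0 = 0" "m < j"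
  shows "fps_nth (h * Y ^ j) m = 0"
  unfolding fps_mult_nth
  using startsby_zero_power_prefix[OF assms(1), of j] assms(2) by (intro sum.neutral) auto

lemma fps2_compose_nth_column:
  assumes Y: "fps_nth Y 0 = 0" and "m \<le> N"
  shows "fps_nth (fps2_compose G X Y) m = (\<Sum>j\<le>N. fps_nth (fps_compose (fps_nth G j) X * Y ^ j) m)"
  unfolding fps2_compose_def fps_nth_Abs_fps
  using assms by (intro sum.mono_neutral_left) (auto intro!: fps_mult_power_nth_eq_0)

lemma fps_compose_mult_nth:
  assumes X: "fps_nth X 0 = (0::'a::idom)" and "m \<le> N"
  shows "fps_nth (fps_compose h X * g) m = (\<Sum>i\<le>N. fps_nth h i * fps_nth (X ^ i * g) m)"
proof -
  have *: "fps_nth (fps_compose h X) l = (\<Sum>i\<le>N. fps_nth h i * fps_nth (X ^ i) l)" if "l \<le> m" for l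
    unfolding fps_compose_nth atLeast0AtMost
    using startsby_zero_power_prefix[OF X] that assms(2) by (intro sum.mono_neutral_left) auto
  have "fps_nth (fps_compose h X * g) m =
      (\<Sum>l = 0..m. (\<Sum>i\<le>N. fps_nth h i * fps_nth (X ^ i) l) * fps_nth g (m - l))"
    unfolding fps_mult_nth by (intro sum.cong) (auto simp: *)
  also have "\<dots> = (\<Sum>i\<le>N. fps_nth h i * fps_nth (X ^ i * g) m)"
    unfolding sum_distrib_right fps_mult_nth sum_distrib_left
    by (subst sum.swap) (simp add: mult.assoc)
  finally show ?thesis .
qed

text \<open>Powers above \<open>m\<close> of \<open>X\<close> or \<open>Y\<close> do not reach the
  coefficient \<open>m\<close>, so the box may have any side \<open>N \<ge> m\<close>; this freedom
  makes truncation to a polynomial harmless.\<close>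

lemma fps2_compose_nth:
  assumes X: "fps_nth X 0 = 0" and Y: "fps_nth Y 0 = 0" and "m \<le> N"
  shows "fps_nth (fps2_compose G X Y) m =
    (\<Sum>j\<le>N. \<Sum>i\<le>N. fps_nth (fps_nth G j) i * fps_nth (X ^ i * Y ^ j) m)"
  using fps2_compose_nth_column[OF Y assms(3)] fps_compose_mult_nth[OF X assms(3)] by simp

lemma fps2_compose_add:
  assumes "fps_nth X 0 = 0" "fps_nth Y 0 = 0"
  shows "fps2_compose (A + B) X Y = fps2_compose A X Y + fps2_compose B X Y"
  by (rule fps_ext) (simp add: fps2_compose_nth[OF assms order.refl] sum.distrib algebra_simps)

lemma fps2_compose_0 [simp]: "fps2_compose 0 X Y = 0"
  by (rule fps_ext) (simp add: fps2_compose_def)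

lemma fps2_compose_sum:
  assumes "fps_nth X 0 = 0" "fps_nth Y 0 = 0"
  shows "fps2_compose (\<Sum>i\<in>S. A i) X Y = (\<Sum>i\<in>S. fps2_compose (A i) X Y)"
  by (induction S rule: infinite_finite_induct) (simp_all add: fps2_compose_add[OF assms])

lemma fps2_compose_const:
  assumes "fps_nth X 0 = 0" "fps_nth Y 0 = 0"
  shows "fps2_compose (fps_const (fps_const c)) X Y = fps_const c"
proof (rule fps_ext)
  fix m
  have "fps_nth (fps2_compose (fps_const (fps_const c)) X Y) m =
      (\<Sum>j\<le>m. if j = 0 then fps_nth (fps_const c) m else 0)"
    unfolding fps2_compose_def fps_nth_Abs_fps by (intro sum.cong) auto
  then show "fps_nth (fps2_compose (fps_const (fps_const c)) X Y) m = fps_nth (fps_const c) m"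
    by (simp only: sum.delta finite_atMost) simp
qed

text \<open>In degree \<open>m\<close> both factors reduce to finite sums of powers of
  \<open>Y\<close>. Pairs \<open>(i, j)\<close> with \<open>i + j > m\<close> drop out of the
  product, and regrouping the rest by \<open>i + j\<close> gives the Cauchy product.\<close>

lemma fps2_compose_mult:
  assumes X: "fps_nth X 0 = 0" and Y: "fps_nth Y 0 = 0"
  shows "fps2_compose (A * B) X Y = fps2_compose A X Y * fps2_compose B X Y"
proof (rule fps_ext)
  fix m
  define a b where "a j = fps_compose (fps_nth A j) X" and "b j = fps_compose (fps_nth B j) X" for j
  have AB: "fps_compose (fps_nth (A * B) j) X = (\<Sum>i\<le>j. a i * b (j - i))" for j
    by (simp add: fps_mult_nth fps_compose_sum_distrib fps_compose_mult_distrib[OF X] a_def b_def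
        atLeast0AtMost)
  have "fps_nth (fps2_compose A X Y * fps2_compose B X Y) m =
      (\<Sum>l = 0..m. fps_nth (\<Sum>j\<le>m. a j * Y ^ j) l * fps_nth (\<Sum>j\<le>m. b j * Y ^ j) (m - l))"
    unfolding fps_mult_nth a_def b_def
    by (intro sum.cong) (auto simp: fps2_compose_nth_column[OF Y, where N = m] fps_sum_nth fps_mult_nth)
  also have "\<dots> = fps_nth ((\<Sum>j\<le>m. a j * Y ^ j) * (\<Sum>j\<le>m. b j * Y ^ j)) m"
    by (simp only: fps_mult_nth)
  also have "\<dots> = (\<Sum>i\<le>m. \<Sum>j\<le>m. fps_nth (a i * b j * Y ^ (i + j)) m)"
    unfolding sum_product fps_sum_nth by (simp add: power_add mult_ac)
  also have "\<dots> = (\<Sum>(i, j)\<in>{..m} \<times> {..m}. fps_nth (a i * b j * Y ^ (i + j)) m)"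
    by (simp add: sum.cartesian_product)
  also have "\<dots> = (\<Sum>(i, j)\<in>{(i, j). i + j \<le> m}. fps_nth (a i * b j * Y ^ (i + j)) m)"
    by (rule sum.mono_neutral_right) (auto intro: fps_mult_power_nth_eq_0[OF Y])
  also have "\<dots> = (\<Sum>k\<le>m. \<Sum>i\<le>k. fps_nth (a i * b (k - i) * Y ^ (i + (k - i))) m)"
    by (rule sum.triangle_reindex_eq)
  also have "\<dots> = fps_nth (fps2_compose (A * B) X Y) m"
    unfolding fps2_compose_def fps_nth_Abs_fps AB sum_distrib_right fps_sum_nth
    by (intro sum.cong) auto
  finally show "fps_nth (fps2_compose (A * B) X Y) m = fps_nth (fps2_compose A X Y * fps2_compose B X Y) m"
    by simp
qed

lemma fps2_compose_power:
  assumes "fps_nth X 0 = 0" "fps_nth Y 0 = 0"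
  shows "fps2_compose (A ^ n) X Y = fps2_compose A X Y ^ n"
proof (induction n)
  case 0
  then show ?case using fps2_compose_const[OF assms, of 1] by simp
qed (simp add: fps2_compose_mult[OF assms])

definition fps_pfun :: "nat \<Rightarrow> (nat \<Rightarrow> nat \<Rightarrow> complex) \<Rightarrow> complex fps \<Rightarrow> complex fps \<Rightarrow> complex fps" where
  "fps_pfun D a X Y = (\<Sum>i\<le>D. \<Sum>j\<le>D. fps_const (a i j) * X ^ i * Y ^ j)"

lemma fps2_compose_pfun:
  assumes "fps_nth X 0 = 0" "fps_nth Y 0 = 0"
  shows "fps2_compose (\<Sum>i\<le>D. \<Sum>j\<le>D. fps_const (fps_const (a i j)) * A ^ i * B ^ j) X Y =
    fps_pfun D a (fps2_compose A X Y) (fps2_compose B X Y)"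
  unfolding fps_pfun_def
  by (simp add: fps2_compose_sum[OF assms] fps2_compose_mult[OF assms] fps2_compose_power[OF assms]
      fps2_compose_const[OF assms])

lemma fps_pfun_has_fps_expansion:
  assumes "f has_fps_expansion X" "g has_fps_expansion Y"
  shows "(\<lambda>t. pfun D a (f t) (g t)) has_fps_expansion fps_pfun D a X Y"
  unfolding pfun_def fps_pfun_def
  by (intro fps_expansion_intros assms)

text \<open>A monomial with an exponent above \<open>D\<close> has order above \<open>D\<close> on
  the branch, so a polynomial realizes the orders of a power series in the range of
  interest.\<close>

lemma fps_nth_fps_pfun_truncate:
  assumes X: "fps_nth X 0 = 0" and Y: "fps_nth Y 0 = 0" and "m \<le> D"
  shows "fps_nth (fps_pfun D (\<lambda>i j. fps_nth (fps_nth G j) i) X Y) m = fps_nth (fps2_compose G X Y) m"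
  unfolding fps2_compose_nth[OF assms] fps_pfun_def
  by (subst sum.swap) (simp add: fps_sum_nth mult.assoc)

text \<open>Links convergent with formal substitution. Absolute convergence at \<open>(r, r)\<close>
  gives a majorant for the Weierstrass test where both coordinates stay below \<open>r\<close>.
  Derivatives at 0 then pass to the limit, and the \<open>m\<close>-th is already attained by every
  finite partial sum containing the box of side \<open>m\<close>.\<close>

lemma fps2_compose_has_fps_expansion:
  assumes X: "fps_nth X 0 = 0" "fps_conv_radius X > 0" and Y: "fps_nth Y 0 = 0" "fps_conv_radius Y > 0"
    and A: "\<forall>\<^sub>F h in nhds (0, 0).
        ((\<lambda>(i, j). fps_nth (fps_nth A j) i * fst h ^ i * snd h ^ j) has_sum f h) UNIV"
  shows "(\<lambda>t. f (eval_fps X t, eval_fps Y t)) has_fps_expansion fps2_compose A X Y"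
proof -
  let ?T = "\<lambda>h (i, j). fps_nth (fps_nth A j) i * fst h ^ i * snd h ^ j"
  obtain S where S: "open S" "(0, 0) \<in> S" "\<And>h. h \<in> S \<Longrightarrow> (?T h has_sum f h) UNIV"
    using A unfolding eventually_nhds by blast
  obtain d where d: "d > 0" "ball (0, 0) d \<subseteq> S" using S open_contains_ball by blast
  have inS: "(x, y) \<in> S" if "norm x \<le> d / 3" "norm y \<le> d / 3" for x y
  proof -
    have "norm (x, y) \<le> norm x + norm y" by (rule norm_Pair_le)
    also have "\<dots> < d" using that d by simp
    finally show ?thesis using d by (auto simp: dist_norm zero_prod_def[symmetric])
  qed
  define r where "r = d / 3"
  have r: "r > 0" using d by (simp add: r_def)
  have "?T (complex_of_real r, complex_of_real r) summable_on UNIV"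
    using S(3)[OF inS[of "of_real r" "of_real r"]] r by (auto simp: r_def summable_on_def)
  \<comment> \<open>Summability over an index set is unconditional, hence absolute.\<close>
  then have "(\<lambda>p. norm (?T (complex_of_real r, complex_of_real r) p)) summable_on UNIV"
    by (simp add: summable_on_iff_abs_summable_on_complex)
  then have summ: "(\<lambda>(i, j). norm (fps_nth (fps_nth A j) i) * r ^ i * r ^ j) summable_on UNIV"
    using r by (simp add: case_prod_unfold norm_mult norm_power)
  have Xe: "eval_fps X has_fps_expansion X" and Ye: "eval_fps Y has_fps_expansion Y"
    using X Y by (auto intro: eval_fps_has_fps_expansion)
  have "isCont (eval_fps X) 0" "isCont (eval_fps Y) 0"
    using has_fps_expansion_imp_continuous[OF Xe, of UNIV] has_fps_expansion_imp_continuous[OF Ye, of UNIV]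
    by simp_all
  then obtain d1 d2 where d1: "d1 > 0" "\<And>t. dist t 0 < d1 \<Longrightarrow> norm (eval_fps X t) < r"
    and d2: "d2 > 0" "\<And>t. dist t 0 < d2 \<Longrightarrow> norm (eval_fps Y t) < r"
    using r X(1) Y(1) unfolding continuous_at_eps_delta
    by (metis eval_fps_at_0 dist_0_norm dist_commute)
  obtain r1 where r1: "r1 > 0" "ereal r1 < fps_conv_radius X"
    using X(2) ereal_dense2[of 0] by (auto simp: zero_ereal_def)
  obtain r2 where r2: "r2 > 0" "ereal r2 < fps_conv_radius Y"
    using Y(2) ereal_dense2[of 0] by (auto simp: zero_ereal_def)
  define \<rho> where "\<rho> = min (min d1 d2) (min r1 r2)"
  have \<rho>: "\<rho> > 0" using d1 d2 r1 r2 by (auto simp: \<rho>_def)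
  define B where "B = ball (0::complex) \<rho>"
  have B: "norm (eval_fps X t) < r" "norm (eval_fps Y t) < r" if "t \<in> B" for t
    using d1(2)[of t] d2(2)[of t] that by (auto simp: B_def \<rho>_def)
  have Xhol: "eval_fps X holomorphic_on B" and Yhol: "eval_fps Y holomorphic_on B"
    unfolding B_def
    by (intro holomorphic_on_subset[OF holomorphic_on_eval_fps[OF order.refl]] subsetI;
        use r1 r2 in \<open>auto simp: \<rho>_def intro: less_trans[rotated]\<close>)+
  let ?g = "\<lambda>p t. ?T (eval_fps X t, eval_fps Y t) p"
  let ?f = "\<lambda>t. f (eval_fps X t, eval_fps Y t)"
  have lim: "uniform_limit B (\<lambda>P t. \<Sum>p\<in>P. ?g p t) ?f (finite_subsets_at_top UNIV)"
  proof (rule Weierstrass_m_test_general'[OF _ _ summ])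
    fix p :: "nat \<times> nat" and t assume t: "t \<in> B"
    obtain i j where p: "p = (i, j)" by (cases p)
    show "norm (?g p t) \<le> (case p of (i, j) \<Rightarrow> norm (fps_nth (fps_nth A j) i) * r ^ i * r ^ j)"
      using B[OF t] r unfolding p by (auto simp: norm_mult norm_power intro!: mult_mono power_mono)
  next
    fix t assume t: "t \<in> B"
    then show "((\<lambda>p. ?g p t) has_sum ?f t) UNIV"
      using S(3)[OF inS[of "eval_fps X t" "eval_fps Y t"]] B[OF t] by (simp add: r_def)
  qed
  have ghol: "(\<lambda>t. \<Sum>p\<in>P. ?g p t) holomorphic_on B" for P
    unfolding case_prod_beta fst_conv snd_conv by (intro holomorphic_intros Xhol Yhol)
  have f_hol: "?f holomorphic_on B"
  proof -
    \<comment> \<open>The uniform limit theorem is applied on closed discs, and those of radius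
      \<open>s < \<rho>\<close> exhaust \<open>B\<close>.\<close>
    have *: "?f holomorphic_on ball 0 s" if "s < \<rho>" for s
    proof -
      have sub: "cball 0 s \<subseteq> B" using that by (auto simp: B_def)
      have "continuous_on (cball 0 s) (\<lambda>t. \<Sum>p\<in>P. ?g p t) \<and> (\<lambda>t. \<Sum>p\<in>P. ?g p t) holomorphic_on ball 0 s" for P
        by (intro conjI holomorphic_on_imp_continuous_on holomorphic_on_subset[OF ghol] sub
            order.trans[OF ball_subset_cball sub])
      then have ev: "eventually (\<lambda>P. continuous_on (cball 0 s) (\<lambda>t. \<Sum>p\<in>P. ?g p t) \<and>
          (\<lambda>t. \<Sum>p\<in>P. ?g p t) holomorphic_on ball 0 s) (finite_subsets_at_top UNIV)"
        by (intro always_eventually allI)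
      show ?thesis
        by (rule holomorphic_uniform_limit[OF ev uniform_limit_on_subset[OF lim sub]
            finite_subsets_at_top_neq_bot])
    qed
    have "?f field_differentiable at t" if t: "t \<in> B" for t
    proof -
      obtain s where s: "norm t < s" "s < \<rho>" using t dense[of "norm t" \<rho>] by (auto simp: B_def)
      then show ?thesis using *[OF s(2)] by (auto simp: holomorphic_on_open field_differentiable_def)
    qed
    then show ?thesis by (simp add: holomorphic_on_def field_differentiable_at_within)
  qed
  have nth: "(deriv ^^ m) ?f 0 = fact m * fps_nth (fps2_compose A X Y) m" for m
  proof -
    have lim_m: "((\<lambda>P. (deriv ^^ m) (\<lambda>t. \<Sum>p\<in>P. ?g p t) 0) \<longlongrightarrow> (deriv ^^ m) ?f 0) (finite_subsets_at_top UNIV)"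
      by (rule higher_deriv_complex_uniform_limit[OF lim]) (use ghol \<rho> in \<open>auto simp: B_def\<close>)
    have ev: "eventually (\<lambda>P. (deriv ^^ m) (\<lambda>t. \<Sum>p\<in>P. ?g p t) 0 =
        fact m * fps_nth (fps2_compose A X Y) m) (finite_subsets_at_top UNIV)"
      unfolding eventually_finite_subsets_at_top
    proof (intro exI[of _ "{..m} \<times> {..m}"] conjI allI impI)
      fix P :: "(nat \<times> nat) set" assume P: "finite P \<and> {..m} \<times> {..m} \<subseteq> P \<and> P \<subseteq> UNIV"
      have "(\<lambda>t. \<Sum>p\<in>P. ?g p t) has_fps_expansion
          (\<Sum>p\<in>P. fps_const (fps_nth (fps_nth A (snd p)) (fst p)) * X ^ fst p * Y ^ snd p)"
        unfolding case_prod_beta fst_conv snd_conv by (intro fps_expansion_intros Xe Ye)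
      from fps_nth_fps_expansion[OF this, of m]
      have "(deriv ^^ m) (\<lambda>t. \<Sum>p\<in>P. ?g p t) 0 = fact m * fps_nth
          (\<Sum>p\<in>P. fps_const (fps_nth (fps_nth A (snd p)) (fst p)) * X ^ fst p * Y ^ snd p) m"
        by (simp only: nonzero_mult_div_cancel_left times_divide_eq_right fact_nonzero not_False_eq_True)
      also have "fps_nth (\<Sum>p\<in>P. fps_const (fps_nth (fps_nth A (snd p)) (fst p)) * X ^ fst p * Y ^ snd p) m =
          (\<Sum>p\<in>P. fps_nth (fps_nth A (snd p)) (fst p) * fps_nth (X ^ fst p * Y ^ snd p) m)"
        by (simp add: fps_sum_nth mult.assoc)
      also have "(\<Sum>p\<in>P. fps_nth (fps_nth A (snd p)) (fst p) * fps_nth (X ^ fst p * Y ^ snd p) m) =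
          (\<Sum>p\<in>{..m} \<times> {..m}. fps_nth (fps_nth A (snd p)) (fst p) * fps_nth (X ^ fst p * Y ^ snd p) m)"
      proof (rule sum.mono_neutral_right)
        show "\<forall>p\<in>P - {..m} \<times> {..m}.
            fps_nth (fps_nth A (snd p)) (fst p) * fps_nth (X ^ fst p * Y ^ snd p) m = 0"
        proof
          fix p assume "p \<in> P - {..m} \<times> {..m}"
          then have "m < fst p \<or> m < snd p" by (cases p) auto
          then have "fps_nth (X ^ fst p * Y ^ snd p) m = 0"
            using fps_mult_power_nth_eq_0[OF Y(1), of m "snd p" "X ^ fst p"]
              fps_mult_power_nth_eq_0[OF X(1), of m "fst p" "Y ^ snd p"] by (auto simp: mult.commute)
          then show "fps_nth (fps_nth A (snd p)) (fst p) * fps_nth (X ^ fst p * Y ^ snd p) m = 0" by simp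
        qed
      qed (use P in auto)
      also have "\<dots> = fps_nth (fps2_compose A X Y) m"
        unfolding fps2_compose_nth[OF X(1) Y(1) order.refl]
        by (subst sum.swap) (simp add: sum.cartesian_product case_prod_beta)
      finally show "(deriv ^^ m) (\<lambda>t. \<Sum>p\<in>P. ?g p t) 0 = fact m * fps_nth (fps2_compose A X Y) m" .
    qed auto
    show ?thesis
      by (rule tendsto_unique[OF finite_subsets_at_top_neq_bot lim_m])
         (rule tendsto_eventually[OF ev])
  qed
  have "?f has_fps_expansion fps_expansion ?f 0"
    using f_hol \<rho> by (intro has_fps_expansion_fps_expansion[of B]) (auto simp: B_def)
  also have "fps_expansion ?f 0 = fps2_compose A X Y"
    by (rule fps_ext) (simp add: fps_expansion_def nth)
  finally show ?thesis .
qed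

section \<open>Analytic families and their branches\<close>

definition poly2_coeff :: "complex poly poly \<Rightarrow> nat \<Rightarrow> nat \<Rightarrow> complex" where
  "poly2_coeff F i j = coeff (coeff F j) i"

definition bidegree_le :: "nat \<Rightarrow> complex poly poly \<Rightarrow> bool" where
  "bidegree_le D F \<longleftrightarrow> (\<forall>i j. D < i \<or> D < j \<longrightarrow> poly2_coeff F i j = 0)"

lemma poly_eq_sum_atMost:
  fixes p :: "'a::comm_semiring_1 poly"
  assumes "\<And>i. D < i \<Longrightarrow> coeff p i = 0"
  shows "poly p x = (\<Sum>i\<le>D. coeff p i * x ^ i)"
proof -
  have "degree p \<le> D" using assms by (intro degree_le) auto
  then show ?thesis
    unfolding poly_altdef by (intro sum.mono_neutral_left) (auto simp: coeff_eq_0)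
qed

lemma eval2_eq_pfun:
  assumes "bidegree_le D F"
  shows "eval2 F z = pfun D (poly2_coeff F) (fst z) (snd z)"
proof -
  have "coeff F j = 0" if "D < j" for j
    using assms that by (intro poly_eqI) (simp add: bidegree_le_def poly2_coeff_def)
  then have "poly F [:snd z:] = (\<Sum>j\<le>D. coeff F j * [:snd z:] ^ j)"
    by (rule poly_eq_sum_atMost)
  then have "eval2 F z = (\<Sum>j\<le>D. poly (coeff F j) (fst z) * snd z ^ j)"
    by (simp add: eval2_def poly_sum)
  also have "\<dots> = (\<Sum>j\<le>D. (\<Sum>i\<le>D. poly2_coeff F i j * fst z ^ i) * snd z ^ j)"
    using assms unfolding poly2_coeff_def bidegree_le_def
    by (intro sum.cong refl arg_cong2[of _ _ _ _ "(*)"] poly_eq_sum_atMost) auto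
  finally show ?thesis by (simp add: pfun_swap)
qed

lemma poly2_coeff_pderiv_x:
  "bidegree_le D F \<Longrightarrow> poly2_coeff (pderiv_x F) = coeff_dx D (poly2_coeff F)"
  by (intro ext)
     (auto simp: poly2_coeff_def pderiv_x_def coeff_map_poly coeff_pderiv coeff_dx_def bidegree_le_def)

lemma poly2_coeff_pderiv_y:
  assumes "bidegree_le D F"
  shows "poly2_coeff (pderiv_y F) = coeff_dy D (poly2_coeff F)"
proof (intro ext)
  fix i j
  have "coeff (of_nat (Suc j) * coeff F (Suc j)) i = of_nat (Suc j) * coeff (coeff F (Suc j)) i"
    by (simp add: of_nat_poly del: of_nat_Suc)
  then show "poly2_coeff (pderiv_y F) i j = coeff_dy D (poly2_coeff F) i j"
    using assms
    by (auto simp: poly2_coeff_def pderiv_y_def coeff_pderiv coeff_dy_def bidegree_le_def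
        simp del: of_nat_Suc)
qed

lemma bidegree_le_pderiv:
  assumes "bidegree_le D F"
  shows "bidegree_le D (pderiv_x F)" "bidegree_le D (pderiv_y F)"
  using assms unfolding bidegree_le_def poly2_coeff_pderiv_x[OF assms] poly2_coeff_pderiv_y[OF assms]
  by (auto simp: coeff_dx_def coeff_dy_def)

lemma mem_sing_points_iff:
  assumes "bidegree_le D F"
  shows "z \<in> sing_points F \<longleftrightarrow> pfun D (poly2_coeff F) (fst z) (snd z) = 0 \<and>
    pfun D (coeff_dx D (poly2_coeff F)) (fst z) (snd z) = 0 \<and>
    pfun D (coeff_dy D (poly2_coeff F)) (fst z) (snd z) = 0"
  unfolding sing_points_def zero_set_def
  by (simp add: eval2_eq_pfun[OF assms] eval2_eq_pfun[OF bidegree_le_pderiv(1)[OF assms]]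
      eval2_eq_pfun[OF bidegree_le_pderiv(2)[OF assms]]
      poly2_coeff_pderiv_x[OF assms] poly2_coeff_pderiv_y[OF assms])

lemma ex_bidegree_le: "\<exists>D. bidegree_le D F"
proof -
  define D where "D = Max (insert (degree F) ((\<lambda>j. degree (coeff F j)) ` {..degree F}))"
  have "poly2_coeff F i j = 0" if "D < i \<or> D < j" for i j
  proof (cases "degree F < j")
    case False
    then have "degree (coeff F j) \<in> (\<lambda>j. degree (coeff F j)) ` {..degree F}" by auto
    then have "degree F \<le> D" "degree (coeff F j) \<le> D" unfolding D_def by (intro Max_ge; simp)+
    with False have "j \<le> D" "degree (coeff F j) \<le> D" by auto
    then show ?thesis using that by (auto simp: poly2_coeff_def coeff_eq_0)
  qed (simp add: poly2_coeff_def coeff_eq_0)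
  then show ?thesis by (auto simp: bidegree_le_def)
qed

text \<open>
  The degrees of the members of an analytic family are bounded: the sets of parameters with
  degree at most \<open>D\<close> cover the disc, so one of them is uncountable and hence accumulates.
\<close>

lemma analytic_family_bidegree_bounded:
  assumes "analytic_family F"
  obtains D where "\<And>s. s \<in> ball 0 1 \<Longrightarrow> bidegree_le D (F s)"
proof -
  \<comment> \<open>A closed disc of radius below 1: accumulation points remain inside the open disc
    where the coefficients are holomorphic.\<close>
  define C where "C D = {s \<in> cball (0::complex) (1/2). bidegree_le D (F s)}" for D
  have "cball 0 (1/2) = (\<Union>D. C D)" using ex_bidegree_le by (auto simp: C_def)
  moreover have "uncountable (cball (0::complex) (1/2))" by (simp add: uncountable_cball)
  ultimately obtain D where "uncountable (C D)" using countable_UN[of UNIV C] by auto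
  then have "infinite (C D)" using countable_finite by blast
  moreover have "C D \<subseteq> cball 0 (1/2)" by (auto simp: C_def)
  ultimately have "\<exists>x\<in>cball 0 (1/2). x islimpt C D"
    using compact_cball[of "0::complex" "1/2"] unfolding compact_eq_Bolzano_Weierstrass by blast
  then obtain x where x: "x \<in> cball 0 (1/2)" "x islimpt C D" by blast
  show thesis
  proof (rule that[of D], unfold bidegree_le_def, intro allI impI)
    fix s :: complex and i j assume s: "s \<in> ball 0 1" and ij: "D < i \<or> D < j"
    show "poly2_coeff (F s) i j = 0"
    proof (rule analytic_continuation[where f = "\<lambda>s. poly2_coeff (F s) i j" and U = "C D"])
      show "(\<lambda>s. poly2_coeff (F s) i j) holomorphic_on ball 0 1"
        using assms by (simp add: analytic_family_def poly2_coeff_def)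
      show "C D \<subseteq> ball 0 1" "x \<in> ball 0 1" using x by (auto simp: C_def)
    qed (use x s ij in \<open>auto simp: C_def bidegree_le_def\<close>)
  qed
qed

text \<open>If \<open>x\<close> divided \<open>f\<close>, irreducibility would make \<open>f/x\<close> a unit, and the origin a smooth point.\<close>

lemma cusp_not_divisible_by_x:
  assumes irr: "irreducible (fps2_at f 0)" and sing: "0 \<in> sing_points f" and D: "bidegree_le D f"
  obtains y0 where "pfun D (poly2_coeff f) 0 y0 \<noteq> 0"
proof -
  have "\<exists>y0. pfun D (poly2_coeff f) 0 y0 \<noteq> 0"
  proof (rule ccontr)
    assume "\<not> ?thesis"
    then have zero: "poly (poly f [:y:]) 0 = 0" for y
      using eval2_eq_pfun[OF D, of "(0, y)"] by (simp add: eval2_def)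
    have "poly (map_poly (\<lambda>c. poly c 0) f) y = poly (poly f [:y:]) 0" for y
      by (induction f) (simp_all add: map_poly_pCons)
    then have "poly (map_poly (\<lambda>c. poly c 0) f) = poly 0" using zero by auto
    then have "map_poly (\<lambda>c. poly c 0) f = 0" by (simp only: poly_eq_poly_eq_iff)
    then have c0: "poly (coeff f j) 0 = 0" for j
      by (metis coeff_0 coeff_map_poly poly_0)
    define h where "h = map_poly (\<lambda>c. c div [:0, 1:]) f"
    have h: "coeff f j = [:0, 1:] * coeff h j" for j
    proof -
      have "[:0, 1:] dvd coeff f j" using c0[of j] by (simp add: poly_eq_0_iff_dvd)
      then show ?thesis by (simp only: h_def coeff_map_poly div_0 dvd_mult_div_cancel)
    qed
    have tr: "translate2 0 f = f"
    proof -
      have "map_poly (\<lambda>c. pcompose c [:0, 1:]) f = f"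
        by (intro poly_eqI) (simp add: coeff_map_poly pcompose_idR)
      then show ?thesis by (simp add: translate2_def pcompose_idR[of f, unfolded one_pCons])
    qed
    define P where "P = fps_of_poly (map_poly fps_of_poly h)"
    have fps: "fps2_at f 0 = fps_const fps_X * P"
      by (intro fps_ext) (simp add: fps2_at_def tr P_def coeff_map_poly h fps_of_poly_mult fps_of_poly_pCons
          del: mult_pCons_left)
    \<comment> \<open>A unit has nonzero constant coefficient. This shows that \<open>x\<close> is
      no unit and, once \<open>P\<close> is one, that \<open>h\<close> does not vanish at the
      origin.\<close>
    have dvd1: "fps_nth (fps_nth Q 0) 0 \<noteq> 0" if Q: "Q dvd 1" for Q :: "complex fps fps"
    proof -
      obtain R where "1 = Q * R" using Q unfolding dvd_def by blast
      then have "fps_nth (fps_nth 1 0) 0 = fps_nth (fps_nth (Q * R) 0) 0" by simp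
      then show ?thesis by auto
    qed
    have "\<not> fps_const (fps_X :: complex fps) dvd 1" using dvd1[of "fps_const fps_X"] by auto
    then have "P dvd 1" using irr unfolding fps by (auto dest: irreducibleD)
    then have unit: "coeff (coeff h 0) 0 \<noteq> 0"
      using dvd1[of P] by (simp add: P_def coeff_map_poly)
    have "eval2 (pderiv_x f) 0 = coeff (coeff h 0) 0"
    proof -
      have "eval2 (pderiv_x f) 0 = poly (coeff (pderiv_x f) 0) 0"
        by (simp add: eval2_def poly_0_coeff_0)
      also have "\<dots> = poly (pderiv ([:0, 1:] * coeff h 0)) 0"
        by (simp add: pderiv_x_def coeff_map_poly h)
      also have "\<dots> = coeff (coeff h 0) 0"
        by (simp add: pderiv_mult pderiv_pCons poly_0_coeff_0)
      finally show ?thesis .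
    qed
    then show False using unit sing by (simp add: sing_points_def)
  qed
  then show thesis using that by blast
qed

section \<open>Orders of vanishing as growth rates\<close>

lemma has_fps_expansion_factor:
  fixes f :: "complex \<Rightarrow> complex"
  assumes f: "f has_fps_expansion S" and S: "\<And>m. m < n \<Longrightarrow> fps_nth S m = 0"
  obtains g where "isCont g 0" "g 0 = fps_nth S n" "\<forall>\<^sub>F t in nhds 0. f t = t ^ n * g t"
proof -
  define T where "T = fps_shift n S"
  have "S = fps_X ^ n * T"
    by (rule fps_ext) (auto simp: fps_X_power_mult_nth T_def S)
  have "fps_conv_radius T > 0" using f by (simp add: T_def has_fps_expansion_def)
  then have T: "eval_fps T has_fps_expansion T" by (rule eval_fps_has_fps_expansion)
  then have "(\<lambda>t. t ^ n * eval_fps T t) has_fps_expansion S"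
    unfolding \<open>S = fps_X ^ n * T\<close> by (intro fps_expansion_intros)
  then have "\<forall>\<^sub>F t in nhds 0. eval_fps S t = t ^ n * eval_fps T t"
    by (simp add: has_fps_expansion_def)
  moreover have "\<forall>\<^sub>F t in nhds 0. eval_fps S t = f t" using f by (simp add: has_fps_expansion_def)
  ultimately have "\<forall>\<^sub>F t in nhds 0. f t = t ^ n * eval_fps T t" by eventually_elim simp
  moreover have "isCont (eval_fps T) 0" using has_fps_expansion_imp_continuous[OF T, of UNIV] by simp
  moreover have "eval_fps T 0 = fps_nth S n" by (simp add: eval_fps_at_0 T_def)
  ultimately show thesis using that by blast
qed

lemma has_fps_expansion_upper_bound:
  fixes f :: "complex \<Rightarrow> complex"
  assumes f: "f has_fps_expansion S" and S: "\<And>m. m < n \<Longrightarrow> fps_nth S m = 0"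
  obtains \<rho> C where "\<rho> > 0" "\<And>t. t \<in> ball 0 \<rho> \<Longrightarrow> norm (f t) \<le> C * norm t ^ n"
proof -
  obtain g where g: "isCont g 0" "\<forall>\<^sub>F t in nhds 0. f t = t ^ n * g t"
    by (rule has_fps_expansion_factor[OF assms]) blast+
  have "((\<lambda>t. norm (g t)) \<longlongrightarrow> norm (g 0)) (nhds 0)"
    using g(1) by (intro tendsto_norm) (simp add: isCont_def tendsto_at_iff_tendsto_nhds)
  then have "\<forall>\<^sub>F t in nhds 0. norm (g t) < norm (g 0) + 1" by (rule order_tendstoD) simp
  with g(2) have "\<forall>\<^sub>F t in nhds 0. norm (f t) \<le> (norm (g 0) + 1) * norm t ^ n"
  proof eventually_elim
    case (elim t)
    have "norm t ^ n * norm (g t) \<le> norm t ^ n * (norm (g 0) + 1)"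
      using elim by (intro mult_left_mono) auto
    then show ?case using elim by (simp add: norm_mult norm_power mult_ac)
  qed
  then obtain \<rho> where "\<rho> > 0" "\<And>t. dist t 0 < \<rho> \<Longrightarrow> norm (f t) \<le> (norm (g 0) + 1) * norm t ^ n"
    unfolding eventually_nhds_metric by blast
  then show thesis by (intro that[of \<rho> "norm (g 0) + 1"]) auto
qed

lemma has_fps_expansion_lower_bound:
  fixes f :: "complex \<Rightarrow> complex"
  assumes f: "f has_fps_expansion S" and S: "\<And>m. m < n \<Longrightarrow> fps_nth S m = 0" "fps_nth S n \<noteq> 0"
  obtains \<rho> c where "\<rho> > 0" "c > 0" "\<And>t. t \<in> ball 0 \<rho> \<Longrightarrow> c * norm t ^ n \<le> norm (f t)"
proof -
  obtain g where g: "isCont g 0" "g 0 = fps_nth S n" "\<forall>\<^sub>F t in nhds 0. f t = t ^ n * g t"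
    by (rule has_fps_expansion_factor[OF assms(1,2)]) blast+
  define c where "c = norm (g 0) / 2"
  have c: "c > 0" using g(2) S(2) by (simp add: c_def)
  have "((\<lambda>t. norm (g t)) \<longlongrightarrow> norm (g 0)) (nhds 0)"
    using g(1) by (intro tendsto_norm) (simp add: isCont_def tendsto_at_iff_tendsto_nhds)
  then have "\<forall>\<^sub>F t in nhds 0. c < norm (g t)" using c by (intro order_tendstoD) (auto simp: c_def)
  with g(3) have "\<forall>\<^sub>F t in nhds 0. c * norm t ^ n \<le> norm (f t)"
  proof eventually_elim
    case (elim t)
    have "norm t ^ n * c \<le> norm t ^ n * norm (g t)"
      using elim by (intro mult_left_mono) auto
    then show ?case using elim by (simp add: norm_mult norm_power mult_ac)
  qed
  then obtain \<rho> where "\<rho> > 0" "\<And>t. dist t 0 < \<rho> \<Longrightarrow> c * norm t ^ n \<le> norm (f t)"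
    unfolding eventually_nhds_metric by blast
  then show thesis using c by (intro that[of \<rho> c]) auto
qed

section \<open>Linear algebra and compactness for the combinations\<close>

text \<open>Gaussian elimination, one equation at a time: the unknown \<open>e0\<close> is solved
  from equation \<open>s\<close>, and \<open>A'\<close> is the system left for the other
  unknowns.\<close>

lemma underdetermined_system:
  fixes A :: "'a \<Rightarrow> 'b \<Rightarrow> complex"
  assumes "finite S" "finite T" "card S < card T"
  shows "\<exists>c. (\<exists>e\<in>T. c e \<noteq> 0) \<and> (\<forall>s\<in>S. (\<Sum>e\<in>T. c e * A e s) = 0)"
  using assms
proof (induction S arbitrary: T A rule: finite_induct)
  case empty
  then have "T \<noteq> {}" by auto
  then show ?case by (intro exI[of _ "\<lambda>_. 1"]) auto
next
  case (insert s S)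
  show ?case
  proof (cases "\<forall>e\<in>T. A e s = 0")
    case True
    then show ?thesis using insert.IH[of T A] insert.prems insert.hyps by auto
  next
    case False
    then obtain e0 where e0: "e0 \<in> T" "A e0 s \<noteq> 0" by blast
    define T' where "T' = T - {e0}"
    define A' where "A' e s' = A e s' - A e s / A e0 s * A e0 s'" for e s'
    have "finite T'" "card S < card T'" using insert e0 by (auto simp: T'_def)
    then obtain c where c: "\<exists>e\<in>T'. c e \<noteq> 0" "\<And>s'. s' \<in> S \<Longrightarrow> (\<Sum>e\<in>T'. c e * A' e s') = 0"
      using insert.IH[of T' A'] by blast
    define c' where "c' e = (if e = e0 then - (\<Sum>e\<in>T'. c e * A e s) / A e0 s else c e)" for e
    have sum: "(\<Sum>e\<in>T. c' e * A e s') = c' e0 * A e0 s' + (\<Sum>e\<in>T'. c e * A e s')" for s'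
    proof -
      have "(\<Sum>e\<in>T'. c' e * A e s') = (\<Sum>e\<in>T'. c e * A e s')"
        by (intro sum.cong) (auto simp: c'_def T'_def)
      then show ?thesis using sum.remove[OF insert.prems(1) e0(1), of "\<lambda>e. c' e * A e s'"]
        by (simp add: T'_def)
    qed
    have "(\<Sum>e\<in>T. c' e * A e s') = 0" if "s' \<in> insert s S" for s'
    proof (cases "s' = s")
      case True
      then show ?thesis unfolding sum using e0 by (simp add: c'_def)
    next
      case False
      then have "0 = (\<Sum>e\<in>T'. c e * A' e s')" using c(2) that by auto
      also have "\<dots> = (\<Sum>e\<in>T'. c e * A e s') - (\<Sum>e\<in>T'. c e * A e s) / A e0 s * A e0 s'"
        by (simp add: A'_def right_diff_distrib sum_subtractf sum_distrib_right sum_divide_distrib mult.assoc)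
      finally show ?thesis unfolding sum by (simp add: c'_def)
    qed
    moreover have "\<exists>e\<in>T. c' e \<noteq> 0" using c(1) by (auto simp: c'_def T'_def)
    ultimately show ?thesis by blast
  qed
qed

lemma bounded_convergent_subsequence_finite:
  fixes c :: "nat \<Rightarrow> 'a \<Rightarrow> complex"
  assumes "finite T" "\<And>k e. e \<in> T \<Longrightarrow> norm (c k e) \<le> 1"
  shows "\<exists>r l. strict_mono r \<and> (\<forall>e\<in>T. (\<lambda>k. c (r k) e) \<longlonglongrightarrow> l e)"
  using assms
proof (induction T rule: finite_induct)
  case empty
  then show ?case by (intro exI[of _ id]) (auto simp: strict_mono_def)
next
  case (insert x T)
  then obtain r l where r: "strict_mono r" "\<And>e. e \<in> T \<Longrightarrow> (\<lambda>k. c (r k) e) \<longlonglongrightarrow> l e" by blast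
  have "bounded (range (\<lambda>k. c (r k) x))"
    using insert.prems by (intro boundedI[of _ 1]) auto
  then obtain l' r' where r': "strict_mono r'" "((\<lambda>k. c (r k) x) \<circ> r') \<longlonglongrightarrow> l'"
    using bounded_imp_convergent_subsequence by blast
  have "(\<lambda>k. c ((r \<circ> r') k) e) \<longlonglongrightarrow> (l(x := l')) e" if "e \<in> insert x T" for e
  proof (cases "e = x")
    case True
    then show ?thesis using r'(2) by (simp add: o_def)
  next
    case False
    then show ?thesis using LIMSEQ_subseq_LIMSEQ[OF r(2) r'(1), of e] that by (simp add: o_def)
  qed
  then show ?case using strict_mono_o[OF r(1) r'(1)] by blast
qed

section \<open>Branches, their transport between fibres and the orders along them\<close>

lemma parametrization_small_balls:
  assumes "parametrization F p X Y"
  obtains \<rho> where "\<rho> > 0"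
    "\<And>\<eta>. 0 < \<eta> \<Longrightarrow> \<eta> \<le> \<rho> \<Longrightarrow> ereal \<eta> \<le> fps_conv_radius X \<and> ereal \<eta> \<le> fps_conv_radius Y \<and>
        (\<exists>N U. bij_betw (\<lambda>t. p + (eval_fps X t, eval_fps Y t)) (ball 0 \<eta>) N \<and>
               N \<subseteq> zero_set F \<and> open U \<and> p \<in> U \<and> U \<inter> zero_set F \<subseteq> N)"
proof -
  obtain b :: real where b: "b > 0"
    "\<And>\<eta>. 0 < \<eta> \<Longrightarrow> \<eta> < b \<Longrightarrow> ereal \<eta> \<le> fps_conv_radius X \<and> ereal \<eta> \<le> fps_conv_radius Y \<and>
        (\<exists>N U. bij_betw (\<lambda>t. p + (eval_fps X t, eval_fps Y t)) (ball 0 \<eta>) N \<and>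
               N \<subseteq> zero_set F \<and> open U \<and> p \<in> U \<and> U \<inter> zero_set F \<subseteq> N)"
    using assms unfolding parametrization_def eventually_at_right_field by blast
  show thesis by (rule that[of "b / 2"]) (use b in auto)
qed

text \<open>The parametrization of \<open>g\<close> at \<open>q\<close> is composed with the
  biholomorphism \<open>\<phi>\<close>. The expansions are kept as substitutions into the same
  \<open>X\<close> and \<open>Y\<close>, which turns orders on the new arc into orders on the branch
  of \<open>g\<close>.\<close>

lemma transported_arc:
  assumes par: "parametrization g q X Y" and type: "same_analytic_type g q F p"
  obtains A B \<xi> \<upsilon> \<rho> where
    "\<xi> has_fps_expansion fps2_compose A X Y" "\<upsilon> has_fps_expansion fps2_compose B X Y"
    "\<xi> 0 = fst p" "\<upsilon> 0 = snd p" "\<rho> > 0" "\<xi> holomorphic_on ball 0 \<rho>" "\<upsilon> holomorphic_on ball 0 \<rho>"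
    "inj_on (\<lambda>t. (\<xi> t, \<upsilon> t)) (ball 0 \<rho>)" "\<And>t. t \<in> ball 0 \<rho> \<Longrightarrow> (\<xi> t, \<upsilon> t) \<in> zero_set F"
proof -
  have X0: "fps_nth X 0 = 0" and Y0: "fps_nth Y 0 = 0" using par by (auto simp: parametrization_def)
  obtain \<rho>0 where \<rho>0: "\<rho>0 > 0"
    "\<And>\<eta>. 0 < \<eta> \<Longrightarrow> \<eta> \<le> \<rho>0 \<Longrightarrow> ereal \<eta> \<le> fps_conv_radius X \<and> ereal \<eta> \<le> fps_conv_radius Y \<and>
        (\<exists>N U. bij_betw (\<lambda>t. q + (eval_fps X t, eval_fps Y t)) (ball 0 \<eta>) N \<and>
               N \<subseteq> zero_set g \<and> open U \<and> q \<in> U \<and> U \<inter> zero_set g \<subseteq> N)"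
    by (rule parametrization_small_balls[OF par]) blast
  have "0 < ereal \<rho>0" using \<rho>0(1) by simp
  then have rad: "fps_conv_radius X > 0" "fps_conv_radius Y > 0"
    using \<rho>0(2)[OF \<rho>0(1) order.refl] by (meson less_le_trans)+
  define \<gamma> where "\<gamma> t = q + (eval_fps X t, eval_fps Y t)" for t
  obtain N where N: "bij_betw \<gamma> (ball 0 \<rho>0) N" "N \<subseteq> zero_set g"
    using \<rho>0(2)[OF \<rho>0(1) order.refl] unfolding \<gamma>_def by blast
  have \<gamma>0: "\<gamma> 0 = q" by (simp add: \<gamma>_def eval_fps_at_0 X0 Y0 zero_prod_def[symmetric])
  obtain \<phi> \<psi> where \<phi>: "\<phi> q = p" "analytic_map_at \<phi> q"
    and ev: "\<forall>\<^sub>F z in nhds q. \<psi> (\<phi> z) = z \<and> (z \<in> zero_set g \<longleftrightarrow> \<phi> z \<in> zero_set F)"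
    using type unfolding same_analytic_type_def by blast
  obtain A where A: "\<forall>\<^sub>F h in nhds (0, 0).
      ((\<lambda>(i, j). fps_nth (fps_nth A j) i * fst h ^ i * snd h ^ j) has_sum fst (\<phi> (q + h))) UNIV"
    using \<phi>(2) unfolding analytic_map_at_def analytic2_at_def by blast
  obtain B where B: "\<forall>\<^sub>F h in nhds (0, 0).
      ((\<lambda>(i, j). fps_nth (fps_nth B j) i * fst h ^ i * snd h ^ j) has_sum snd (\<phi> (q + h))) UNIV"
    using \<phi>(2) unfolding analytic_map_at_def analytic2_at_def by blast
  define \<xi> \<upsilon> where "\<xi> t = fst (\<phi> (\<gamma> t))" and "\<upsilon> t = snd (\<phi> (\<gamma> t))" for t
  have \<xi>: "\<xi> has_fps_expansion fps2_compose A X Y" and \<upsilon>: "\<upsilon> has_fps_expansion fps2_compose B X Y"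
    using fps2_compose_has_fps_expansion[OF X0 rad(1) Y0 rad(2) A]
      fps2_compose_has_fps_expansion[OF X0 rad(1) Y0 rad(2) B]
    unfolding \<xi>_def \<upsilon>_def \<gamma>_def by simp_all
  obtain S1 where S1: "open S1" "0 \<in> S1" "\<xi> holomorphic_on S1"
    using has_fps_expansion_imp_holomorphic[OF \<xi>] by metis
  obtain S2 where S2: "open S2" "0 \<in> S2" "\<upsilon> holomorphic_on S2"
    using has_fps_expansion_imp_holomorphic[OF \<upsilon>] by metis
  obtain V where V: "open V" "q \<in> V"
    "\<And>z. z \<in> V \<Longrightarrow> \<psi> (\<phi> z) = z \<and> (z \<in> zero_set g \<longleftrightarrow> \<phi> z \<in> zero_set F)"
    using ev unfolding eventually_nhds by blast
  have "isCont \<gamma> 0"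
    unfolding \<gamma>_def by (intro continuous_intros) (use rad in \<open>simp_all add: zero_ereal_def\<close>)
  then have "\<forall>\<^sub>F t in nhds 0. \<gamma> t \<in> V"
    using V(1,2) \<gamma>0 by (intro topological_tendstoD[where l = q])
      (auto simp: isCont_def tendsto_at_iff_tendsto_nhds)
  then obtain S3 where S3: "open S3" "0 \<in> S3" "\<And>t. t \<in> S3 \<Longrightarrow> \<gamma> t \<in> V"
    unfolding eventually_nhds by blast
  have "open (S1 \<inter> S2 \<inter> S3 \<inter> ball 0 \<rho>0)" "0 \<in> S1 \<inter> S2 \<inter> S3 \<inter> ball 0 \<rho>0"
    using S1 S2 S3 \<rho>0(1) by auto
  then obtain \<rho> where \<rho>: "\<rho> > 0" "ball 0 \<rho> \<subseteq> S1 \<inter> S2 \<inter> S3 \<inter> ball 0 \<rho>0"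
    using open_contains_ball by blast
  have pair: "(\<xi> t, \<upsilon> t) = \<phi> (\<gamma> t)" for t by (simp add: \<xi>_def \<upsilon>_def)
  show thesis
  proof (rule that[OF \<xi> \<upsilon> _ _ \<rho>(1)])
    show "\<xi> 0 = fst p" "\<upsilon> 0 = snd p" by (simp_all add: \<xi>_def \<upsilon>_def \<gamma>0 \<phi>(1))
    show "\<xi> holomorphic_on ball 0 \<rho>" "\<upsilon> holomorphic_on ball 0 \<rho>"
      using \<rho>(2) by (auto intro: holomorphic_on_subset[OF S1(3)] holomorphic_on_subset[OF S2(3)])
    show "inj_on (\<lambda>t. (\<xi> t, \<upsilon> t)) (ball 0 \<rho>)"
      unfolding pair
    proof (rule inj_onI)
      fix s t assume st: "s \<in> ball 0 \<rho>" "t \<in> ball 0 \<rho>" and eq: "\<phi> (\<gamma> s) = \<phi> (\<gamma> t)"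
      have "\<gamma> s \<in> V" "\<gamma> t \<in> V" using S3(3) st \<rho>(2) by blast+
      then have "\<gamma> s = \<gamma> t" using V(3) eq by metis
      moreover have "s \<in> ball 0 \<rho>0" "t \<in> ball 0 \<rho>0" using st \<rho>(2) by blast+
      ultimately show "s = t" by (rule inj_onD[OF bij_betw_imp_inj_on[OF N(1)]])
    qed
    fix t :: complex assume t: "t \<in> ball 0 \<rho>"
    then have "\<gamma> t \<in> V" "\<gamma> t \<in> zero_set g"
      using S3(3) \<rho>(2) N bij_betwE[OF N(1)] by blast+
    then show "(\<xi> t, \<upsilon> t) \<in> zero_set F" unfolding pair using V(3) by blast
  qed
qed

text \<open>A polynomial in two power series is again a power series \<open>H\<close> at
  \<open>q\<close>; if the equation of \<open>g\<close> divided it, its substitution would vanish.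
  As \<open>b\<close> is a polynomial, \<open>A\<close> and \<open>B\<close> may have constant
  terms, which in the application are the coordinates of the new base point.\<close>

lemma subdegree_fps_pfun_in_semigroup:
  assumes par: "parametrization g q X Y"
    and nz: "fps_pfun E b (fps2_compose A X Y) (fps2_compose B X Y) \<noteq> 0"
  shows "subdegree (fps_pfun E b (fps2_compose A X Y) (fps2_compose B X Y)) \<in>
    {subdegree (fps2_compose G X Y) | G. \<not> fps2_at g q dvd G}"
proof -
  have X0: "fps_nth X 0 = 0" and Y0: "fps_nth Y 0 = 0" and F0: "fps2_compose (fps2_at g q) X Y = 0"
    using par by (auto simp: parametrization_def)
  define H where "H = (\<Sum>i\<le>E. \<Sum>j\<le>E. fps_const (fps_const (b i j)) * A ^ i * B ^ j)"
  have H: "fps_pfun E b (fps2_compose A X Y) (fps2_compose B X Y) = fps2_compose H X Y"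
    unfolding H_def by (rule fps2_compose_pfun[OF X0 Y0, symmetric])
  have "\<not> fps2_at g q dvd H"
    using nz F0 unfolding H by (auto simp: fps2_compose_mult[OF X0 Y0] elim!: dvdE)
  then show ?thesis unfolding H by blast
qed

text \<open>Cutting \<open>G\<close> off at exponent \<open>n\<close> in each variable leaves the
  coefficients up to \<open>n\<close> on the branch unchanged, hence also the order.\<close>

lemma ex_pfun_of_order:
  assumes "fps_nth X 0 = 0" "fps_nth Y 0 = 0" "subdegree (fps2_compose G X Y) \<le> n"
  defines "e \<equiv> subdegree (fps2_compose G X Y)"
  shows "\<exists>b. (\<forall>m<e. fps_nth (fps_pfun n b X Y) m = 0) \<and> fps_nth (fps_pfun n b X Y) e \<noteq> 0"
proof -
  have *: "\<exists>b. (\<forall>m<e. fps_nth (fps_pfun n b X Y) m = 0) \<and> fps_nth (fps_pfun n b X Y) e \<noteq> 0"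
    if H: "fps2_compose H X Y \<noteq> 0" "subdegree (fps2_compose H X Y) = e" for H
    using nth_subdegree_nonzero[OF H(1)] nth_less_subdegree_zero[of _ "fps2_compose H X Y"] assms(3)
    by (intro exI[of _ "\<lambda>i j. fps_nth (fps_nth H j) i"])
       (auto simp: fps_nth_fps_pfun_truncate[OF assms(1,2)] H(2) e_def)
  show ?thesis
  proof (cases "fps2_compose G X Y = 0")
    case True
    \<comment> \<open>Since \<^term>\<open>subdegree 0 = 0\<close>, a series vanishing on the branch contributes the order 0 of 1.\<close>
    then have "e = 0" by (simp add: e_def)
    moreover have "fps2_compose (fps_const (fps_const 1)) X Y = fps_const 1"
      by (rule fps2_compose_const[OF assms(1,2)])
    ultimately show ?thesis using *[of "fps_const (fps_const 1)"] by simp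
  qed (use * in \<open>auto simp: e_def\<close>)
qed

lemma fps_nth_fps_pfun_sum:
  fixes c :: "'a \<Rightarrow> complex"
  shows "fps_nth (fps_pfun E (\<lambda>i j. \<Sum>e\<in>T. c e * b e i j) X Y) m =
     (\<Sum>e\<in>T. c e * fps_nth (fps_pfun E (b e) X Y) m)"
proof -
  have const: "fps_const (\<Sum>e\<in>T. f e) = (\<Sum>e\<in>T. fps_const (f e))" for f :: "'a \<Rightarrow> complex"
    by (rule fps_ext) (auto simp: fps_sum_nth)
  have "fps_pfun E (\<lambda>i j. \<Sum>e\<in>T. c e * b e i j) X Y =
      (\<Sum>i\<le>E. \<Sum>j\<le>E. \<Sum>e\<in>T. fps_const (c e) * (fps_const (b e i j) * X ^ i * Y ^ j))"
    unfolding fps_pfun_def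
    by (simp add: const sum_distrib_right mult.assoc flip: fps_const_mult)
  also have "\<dots> = (\<Sum>i\<le>E. \<Sum>e\<in>T. \<Sum>j\<le>E. fps_const (c e) * (fps_const (b e i j) * X ^ i * Y ^ j))"
    by (intro sum.cong refl sum.swap)
  also have "\<dots> = (\<Sum>e\<in>T. \<Sum>i\<le>E. \<Sum>j\<le>E. fps_const (c e) * (fps_const (b e i j) * X ^ i * Y ^ j))"
    by (rule sum.swap)
  also have "\<dots> = (\<Sum>e\<in>T. fps_const (c e) * fps_pfun E (b e) X Y)"
    unfolding fps_pfun_def by (simp add: sum_distrib_left)
  finally show ?thesis by (simp add: fps_sum_nth)
qed

text \<open>The singular points accumulate in the closed ball by compactness, and a limit is
  singular on the central fibre because the three equations pass to the limit. Transversality keeps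
  it off the sphere, so it is the only singular point inside, the origin.\<close>

lemma deformation_sequence:
  assumes def: "deformation F c r" and q: "q \<in> sing_points (F (1/2)) \<inter> ball c r"
    and D: "\<And>s. s \<in> ball 0 1 \<Longrightarrow> bidegree_le D (F s)"
  obtains s p where "\<And>k. s k \<in> ball 0 1" "s \<longlonglongrightarrow> 0" "p \<longlonglongrightarrow> 0"
    "\<And>k. same_analytic_type (F (1/2)) q (F (s k)) (p k)"
proof -
  \<comment> \<open>Nonzero parameters in the disc, so that these fibres share the analytic type of
    the fibre at 1/2.\<close>
  define s where "s k = complex_of_real (1 / (real k + 2))" for k
  have s: "s k \<in> ball 0 1 - {0}" for k
    by (auto simp: s_def norm_divide simp del: of_real_add)
  have s_lim: "s \<longlonglongrightarrow> 0"
  proof -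
    have "(\<lambda>k. 1 / (real k + 2)) \<longlonglongrightarrow> 0" by real_asymp
    then have "s \<longlonglongrightarrow> complex_of_real 0" unfolding s_def by (rule tendsto_of_real)
    then show ?thesis by simp
  qed
  have "\<exists>p. p \<in> sing_points (F (s k)) \<inter> ball c r \<and> same_analytic_type (F (1/2)) q (F (s k)) p" for k
  proof -
    have half: "(1/2 :: complex) \<in> ball 0 1 - {0}" by simp
    have types: "\<forall>s\<in>ball 0 1 - {0}. \<forall>s'\<in>ball 0 1 - {0}.
        \<exists>f. bij_betw f (sing_points (F s) \<inter> ball c r) (sing_points (F s') \<inter> ball c r) \<and>
            (\<forall>p \<in> sing_points (F s) \<inter> ball c r. same_analytic_type (F s) p (F s') (f p))"
      using def unfolding deformation_def by blast
    obtain f where "bij_betw f (sing_points (F (1/2)) \<inter> ball c r) (sing_points (F (s k)) \<inter> ball c r)"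
      and "\<forall>p \<in> sing_points (F (1/2)) \<inter> ball c r. same_analytic_type (F (1/2)) p (F (s k)) (f p)"
      using types half s by blast
    then show ?thesis using q bij_betwE by blast
  qed
  then obtain p where p: "\<And>k. p k \<in> sing_points (F (s k)) \<inter> ball c r"
    "\<And>k. same_analytic_type (F (1/2)) q (F (s k)) (p k)" by metis
  have "compact (cball c r)" by simp
  moreover have "\<forall>k. p k \<in> cball c r" using p(1) by (auto intro: less_imp_le)
  ultimately obtain l \<sigma> where l: "l \<in> cball c r" "strict_mono \<sigma>" "(p \<circ> \<sigma>) \<longlonglongrightarrow> l"
    unfolding compact_def by blast
  have a_lim: "(\<lambda>k. poly2_coeff (F ((s \<circ> \<sigma>) k)) i j) \<longlonglongrightarrow> poly2_coeff (F 0) i j" for i j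
  proof -
    have "(\<lambda>s. poly2_coeff (F s) i j) holomorphic_on ball 0 1"
      using def by (simp add: deformation_def analytic_family_def poly2_coeff_def)
    then have "isCont (\<lambda>s. poly2_coeff (F s) i j) 0"
      by (metis centre_in_ball continuous_on_eq_continuous_at holomorphic_on_imp_continuous_on
          open_ball zero_less_one)
    moreover have "(s \<circ> \<sigma>) \<longlonglongrightarrow> 0" by (rule LIMSEQ_subseq_LIMSEQ[OF s_lim l(2)])
    ultimately show ?thesis by (rule isCont_tendsto_compose)
  qed
  have l_sing: "l \<in> sing_points (F 0)"
  proof -
    let ?a = "\<lambda>k. poly2_coeff (F ((s \<circ> \<sigma>) k))" and ?p = "p \<circ> \<sigma>"
    have sing: "pfun D (?a k) (fst (?p k)) (snd (?p k)) = 0"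
      "pfun D (coeff_dx D (?a k)) (fst (?p k)) (snd (?p k)) = 0"
      "pfun D (coeff_dy D (?a k)) (fst (?p k)) (snd (?p k)) = 0" for k
      using p(1)[of "\<sigma> k"] mem_sing_points_iff[OF D, of "s (\<sigma> k)"] s[of "\<sigma> k"] by auto
    have "(\<lambda>k. pfun D (?a k) (fst (?p k)) (snd (?p k))) \<longlonglongrightarrow> pfun D (poly2_coeff (F 0)) (fst l) (snd l)"
      "(\<lambda>k. pfun D (coeff_dx D (?a k)) (fst (?p k)) (snd (?p k))) \<longlonglongrightarrow>
        pfun D (coeff_dx D (poly2_coeff (F 0))) (fst l) (snd l)"
      "(\<lambda>k. pfun D (coeff_dy D (?a k)) (fst (?p k)) (snd (?p k))) \<longlonglongrightarrow>
        pfun D (coeff_dy D (poly2_coeff (F 0))) (fst l) (snd l)"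
      by (intro tendsto_pfun tendsto_coeff_dx tendsto_coeff_dy a_lim tendsto_fst tendsto_snd l(3))+
    then have "pfun D (poly2_coeff (F 0)) (fst l) (snd l) = 0"
      "pfun D (coeff_dx D (poly2_coeff (F 0))) (fst l) (snd l) = 0"
      "pfun D (coeff_dy D (poly2_coeff (F 0))) (fst l) (snd l) = 0"
      unfolding sing by (auto dest: LIMSEQ_unique[OF tendsto_const])
    then show ?thesis using mem_sing_points_iff[OF D, of 0] by simp
  qed
  have trans: "transverse_to_sphere (F 0) c r"
  proof -
    have "\<forall>s\<in>ball 0 1. transverse_to_sphere (F s) c r"
      using def unfolding deformation_def by blast
    then show ?thesis by simp
  qed
  have "l \<notin> sphere c r"
    using trans l_sing unfolding transverse_to_sphere_def by (auto simp: sing_points_def)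
  then have "l \<in> sing_points (F 0) \<inter> ball c r" using l(1) l_sing by (auto simp: less_le)
  then have "l = 0" using def unfolding deformation_def by blast
  show thesis
  proof (rule that[of "s \<circ> \<sigma>" "p \<circ> \<sigma>"])
    show "(p \<circ> \<sigma>) \<longlonglongrightarrow> 0" using l(3) \<open>l = 0\<close> by simp
    show "(s \<circ> \<sigma>) \<longlonglongrightarrow> 0" by (rule LIMSEQ_subseq_LIMSEQ[OF s_lim l(2)])
  qed (use s p in auto)
qed

text \<open>One linear condition for each element of the semigroup below \<open>n\<close>, and none
  at the gaps, makes fewer conditions than unknowns. The normalization prevents the coefficients
  from tending to 0 along a sequence of fibres.\<close>

lemma ex_combination_vanishing_on_arc:
  assumes par: "parametrization g q X Y" and type: "same_analytic_type g q F p"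
    and D: "bidegree_le D F" and T: "finite T"
    and card: "card ({subdegree (fps2_compose G X Y) | G. \<not> fps2_at g q dvd G} \<inter> {0..<n}) < card T"
  shows "\<exists>c. (\<Sum>e\<in>T. norm (c e)) = 1 \<and> (\<exists>\<rho> \<xi> \<upsilon> C. \<rho> > 0 \<and> \<xi> holomorphic_on ball 0 \<rho> \<and>
      \<upsilon> holomorphic_on ball 0 \<rho> \<and> \<xi> 0 = fst p \<and> \<upsilon> 0 = snd p \<and> inj_on (\<lambda>t. (\<xi> t, \<upsilon> t)) (ball 0 \<rho>) \<and>
      (\<forall>t\<in>ball 0 \<rho>. pfun D (poly2_coeff F) (\<xi> t) (\<upsilon> t) = 0 \<and>
         norm (pfun E (\<lambda>i j. \<Sum>e\<in>T. c e * b e i j) (\<xi> t) (\<upsilon> t)) \<le> C * norm t ^ n))"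
proof -
  define \<Gamma> where "\<Gamma> = {subdegree (fps2_compose G X Y) | G. \<not> fps2_at g q dvd G}"
  obtain A B \<xi> \<upsilon> \<rho> where \<xi>: "\<xi> has_fps_expansion fps2_compose A X Y"
    and \<upsilon>: "\<upsilon> has_fps_expansion fps2_compose B X Y"
    and 0: "\<xi> 0 = fst p" "\<upsilon> 0 = snd p" and \<rho>: "\<rho> > 0"
    and hol: "\<xi> holomorphic_on ball 0 \<rho>" "\<upsilon> holomorphic_on ball 0 \<rho>"
    and inj: "inj_on (\<lambda>t. (\<xi> t, \<upsilon> t)) (ball 0 \<rho>)"
    and zero: "\<And>t. t \<in> ball 0 \<rho> \<Longrightarrow> (\<xi> t, \<upsilon> t) \<in> zero_set F"
    by (rule transported_arc[OF par type]) blast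
  let ?A = "fps2_compose A X Y" and ?B = "fps2_compose B X Y"
  obtain c0 where c0: "\<exists>e\<in>T. c0 e \<noteq> 0"
    "\<And>m. m \<in> \<Gamma> \<inter> {0..<n} \<Longrightarrow> (\<Sum>e\<in>T. c0 e * fps_nth (fps_pfun E (b e) ?A ?B) m) = 0"
    using underdetermined_system[of "\<Gamma> \<inter> {0..<n}" T "\<lambda>e. fps_nth (fps_pfun E (b e) ?A ?B)"] T
      card[folded \<Gamma>_def] by blast
  define N where "N = (\<Sum>e\<in>T. norm (c0 e))"
  have N: "N > 0" unfolding N_def using c0(1) T by (auto simp: sum_nonneg_eq_0_iff less_le sum_nonneg)
  define c where "c e = c0 e / of_real N" for e
  have "(\<Sum>e\<in>T. norm (c e)) = N / N"
    using N by (simp add: c_def norm_divide sum_divide_distrib[symmetric] flip: N_def)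
  then have c1: "(\<Sum>e\<in>T. norm (c e)) = 1" using N by simp
  define S where "S = fps_pfun E (\<lambda>i j. \<Sum>e\<in>T. c e * b e i j) ?A ?B"
  have S\<Gamma>: "fps_nth S m = 0" if "m \<in> \<Gamma> \<inter> {0..<n}" for m
  proof -
    have "fps_nth S m = (\<Sum>e\<in>T. c0 e * fps_nth (fps_pfun E (b e) ?A ?B) m) / of_real N"
      unfolding S_def fps_nth_fps_pfun_sum by (simp add: c_def sum_divide_distrib)
    then show ?thesis using c0(2)[OF that] by simp
  qed
  \<comment> \<open>The order of a nonzero \<open>S\<close> lies in \<open>\<Gamma>\<close>, but the coefficients at all such exponents below \<open>n\<close> vanish.\<close>
  have S0: "fps_nth S m = 0" if m: "m < n" for m
  proof (cases "S = 0")
    case False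
    then have "subdegree S \<in> \<Gamma>"
      unfolding S_def \<Gamma>_def by (rule subdegree_fps_pfun_in_semigroup[OF par])
    then have "n \<le> subdegree S"
      using S\<Gamma>[of "subdegree S"] nth_subdegree_nonzero[OF False] by force
    then show ?thesis using m by (intro nth_less_subdegree_zero) auto
  qed simp
  have "(\<lambda>t. pfun E (\<lambda>i j. \<Sum>e\<in>T. c e * b e i j) (\<xi> t) (\<upsilon> t)) has_fps_expansion S"
    unfolding S_def by (rule fps_pfun_has_fps_expansion[OF \<xi> \<upsilon>])
  then obtain \<rho>' C where \<rho>': "\<rho>' > 0" "\<And>t. t \<in> ball 0 \<rho>' \<Longrightarrow>
      norm (pfun E (\<lambda>i j. \<Sum>e\<in>T. c e * b e i j) (\<xi> t) (\<upsilon> t)) \<le> C * norm t ^ n"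
    using has_fps_expansion_upper_bound[OF _ S0] by blast
  have sub: "ball (0::complex) (min \<rho> \<rho>') \<subseteq> ball 0 \<rho>" by auto
  show ?thesis
  proof (rule exI[of _ c], rule conjI[OF c1], rule exI[of _ "min \<rho> \<rho>'"], rule exI[of _ \<xi>],
      rule exI[of _ \<upsilon>], rule exI[of _ C], intro conjI 0 ballI holomorphic_on_subset[OF hol(1) sub] holomorphic_on_subset[OF hol(2) sub] inj_on_subset[OF inj sub])
    fix t :: complex assume t: "t \<in> ball 0 (min \<rho> \<rho>')"
    show "pfun D (poly2_coeff F) (\<xi> t) (\<upsilon> t) = 0"
      using zero[of t] t by (simp add: zero_set_def eval2_eq_pfun[OF D])
    show "norm (pfun E (\<lambda>i j. \<Sum>e\<in>T. c e * b e i j) (\<xi> t) (\<upsilon> t)) \<le> C * norm t ^ n"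
      using \<rho>'(2)[of t] t by simp
  qed (use \<rho> \<rho>' in auto)
qed

section \<open>Limit of the vanishing combinations\<close>

theorem theorem1p2:
  fixes f g :: "complex poly poly" and q :: "complex \<times> complex"
    and \<Gamma>\<^sub>K \<Gamma>\<^sub>L :: "nat set" and n :: nat
  assumes "deforms_to f g q"
    and "has_semigroup f 0 \<Gamma>\<^sub>K"
    and "has_semigroup g q \<Gamma>\<^sub>L"
  shows "card (\<Gamma>\<^sub>K \<inter> {0..<n}) \<le> card (\<Gamma>\<^sub>L \<inter> {0..<n})"
proof (rule ccontr)
  assume less: "\<not> ?thesis"
  obtain F c0 r0 where def: "deformation F c0 r0" and F: "F 0 = f" "F (1/2) = g"
    and q: "q \<in> sing_points (F (1/2)) \<inter> ball c0 r0"
    using assms(1) unfolding deforms_to_def by blast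
  have cusp: "cusp f 0" and family: "analytic_family F"
    using def F(1) unfolding deformation_def by auto
  obtain D where D: "\<And>s. s \<in> ball 0 1 \<Longrightarrow> bidegree_le D (F s)"
    by (rule analytic_family_bidegree_bounded[OF family]) blast
  then have Df: "bidegree_le D f" using F(1) by force
  obtain s p where s: "\<And>k. s k \<in> ball 0 1" "s \<longlonglongrightarrow> 0" and p: "p \<longlonglongrightarrow> 0"
    and type: "\<And>k. same_analytic_type g q (F (s k)) (p k)"
    using deformation_sequence[OF def q D] unfolding F(2) by blast
  obtain X Y where parK: "parametrization f 0 X Y"
    and \<Gamma>K: "\<Gamma>\<^sub>K = {subdegree (fps2_compose G X Y) | G. \<not> fps2_at f 0 dvd G}"
    using assms(2) unfolding has_semigroup_def by blast
  obtain X' Y' where parL: "parametrization g q X' Y'"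
    and \<Gamma>L: "\<Gamma>\<^sub>L = {subdegree (fps2_compose G X' Y') | G. \<not> fps2_at g q dvd G}"
    using assms(3) unfolding has_semigroup_def by blast
  have X0: "fps_nth X 0 = 0" and Y0: "fps_nth Y 0 = 0" using parK by (auto simp: parametrization_def)
  define T where "T = \<Gamma>\<^sub>K \<inter> {0..<n}"
  have T: "finite T" by (simp add: T_def)
  \<comment> \<open>Exponents up to \<open>n\<close> suffice, because every order in
    \<open>T\<close> is below \<open>n\<close>.\<close>
  have "\<forall>e\<in>T. \<exists>b. (\<forall>m<e. fps_nth (fps_pfun n b X Y) m = 0) \<and> fps_nth (fps_pfun n b X Y) e \<noteq> 0"
  proof
    fix e assume e: "e \<in> T"
    then obtain G where "e = subdegree (fps2_compose G X Y)" by (auto simp: T_def \<Gamma>K)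
    then show "\<exists>b. (\<forall>m<e. fps_nth (fps_pfun n b X Y) m = 0) \<and> fps_nth (fps_pfun n b X Y) e \<noteq> 0"
      using ex_pfun_of_order[OF X0 Y0, of G n] e by (auto simp: T_def)
  qed
  then obtain b where b: "\<And>e m. e \<in> T \<Longrightarrow> m < e \<Longrightarrow> fps_nth (fps_pfun n (b e) X Y) m = 0"
    "\<And>e. e \<in> T \<Longrightarrow> fps_nth (fps_pfun n (b e) X Y) e \<noteq> 0"
    by metis
  define comb where "comb c i j = (\<Sum>e\<in>T. c e * b e i j)" for c i j
  define vanishing where "vanishing k c \<longleftrightarrow> (\<exists>\<rho> \<xi> \<upsilon> C. \<rho> > 0 \<and> \<xi> holomorphic_on ball 0 \<rho> \<and>
      \<upsilon> holomorphic_on ball 0 \<rho> \<and> \<xi> 0 = fst (p k) \<and> \<upsilon> 0 = snd (p k) \<and>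
      inj_on (\<lambda>t. (\<xi> t, \<upsilon> t)) (ball 0 \<rho>) \<and>
      (\<forall>t\<in>ball 0 \<rho>. pfun D (poly2_coeff (F (s k))) (\<xi> t) (\<upsilon> t) = 0 \<and>
         norm (pfun n (comb c) (\<xi> t) (\<upsilon> t)) \<le> C * norm t ^ n))" for k c
  have "\<exists>c. (\<Sum>e\<in>T. norm (c e)) = 1 \<and> vanishing k c" for k
    unfolding vanishing_def comb_def
    by (rule ex_combination_vanishing_on_arc[OF parL type D[OF s(1)] T])
       (use less in \<open>simp add: T_def \<Gamma>L\<close>)
  then obtain c where c1: "\<And>k. (\<Sum>e\<in>T. norm (c k e)) = 1" and arcs: "\<And>k. vanishing k (c k)"
    by metis
  have "norm (c k e) \<le> 1" if "e \<in> T" for k e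
    using member_le_sum[OF that, of "\<lambda>e. norm (c k e)"] c1[of k] T by simp
  then obtain \<sigma> l where \<sigma>: "strict_mono \<sigma>" and l: "\<And>e. e \<in> T \<Longrightarrow> (\<lambda>k. c (\<sigma> k) e) \<longlonglongrightarrow> l e"
    using bounded_convergent_subsequence_finite[OF T, of c] by blast
  have "(\<lambda>k. \<Sum>e\<in>T. norm (c (\<sigma> k) e)) \<longlonglongrightarrow> (\<Sum>e\<in>T. norm (l e))"
    by (intro tendsto_sum tendsto_norm l)
  \<comment> \<open>The normalization survives the limit, so some limit coefficient is
    nonzero.\<close>
  then have "(\<Sum>e\<in>T. norm (l e)) = 1" unfolding c1 using LIMSEQ_unique tendsto_const by blast
  then have "\<exists>e. e \<in> T \<and> l e \<noteq> 0" by (metis norm_zero sum.neutral zero_neq_one)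
  \<comment> \<open>The polynomials given by \<open>b e\<close> have pairwise distinct orders
    \<open>e\<close> on the central branch, so the limit combination has exactly the order
    \<open>m\<close>, the least one with a nonzero coefficient.\<close>
  define m where "m = (LEAST e. e \<in> T \<and> l e \<noteq> 0)"
  have m: "m \<in> T" "l m \<noteq> 0" using LeastI_ex[OF \<open>\<exists>e. e \<in> T \<and> l e \<noteq> 0\<close>] unfolding m_def by auto
  have m_min: "l e = 0" if "e \<in> T" "e < m" for e
    using not_less_Least[of e "\<lambda>e. e \<in> T \<and> l e \<noteq> 0"] that by (auto simp: m_def)
  define S where "S = fps_pfun n (comb l) X Y"
  have S: "fps_nth S i = (\<Sum>e\<in>T. l e * fps_nth (fps_pfun n (b e) X Y) i)" for i
    unfolding S_def comb_def by (rule fps_nth_fps_pfun_sum)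
  have S_low: "fps_nth S i = 0" if "i < m" for i
    unfolding S using that m_min b(1) by (intro sum.neutral) (metis less_trans mult_eq_0_iff not_less_iff_gr_or_eq)
  have "fps_nth S m = (\<Sum>e\<in>{m}. l e * fps_nth (fps_pfun n (b e) X Y) m)"
    unfolding S using T m b(1) m_min
    by (intro sum.mono_neutral_right) (auto simp: neq_iff)
  then have S_m: "fps_nth S m \<noteq> 0" using m b(2) by simp

  obtain \<rho>0 where \<rho>0: "\<rho>0 > 0"
    "\<And>\<eta>. 0 < \<eta> \<Longrightarrow> \<eta> \<le> \<rho>0 \<Longrightarrow> ereal \<eta> \<le> fps_conv_radius X \<and> ereal \<eta> \<le> fps_conv_radius Y \<and>
        (\<exists>N U. bij_betw (\<lambda>t. 0 + (eval_fps X t, eval_fps Y t)) (ball 0 \<eta>) N \<and>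
               N \<subseteq> zero_set f \<and> open U \<and> 0 \<in> U \<and> U \<inter> zero_set f \<subseteq> N)"
    by (rule parametrization_small_balls[OF parK]) blast
  have rad: "ereal \<rho>0 \<le> fps_conv_radius X" "ereal \<rho>0 \<le> fps_conv_radius Y"
    using \<rho>0(2)[OF \<rho>0(1) order.refl] by auto
  have "0 < ereal \<rho>0" using \<rho>0(1) by simp
  then have "eval_fps X has_fps_expansion X" "eval_fps Y has_fps_expansion Y"
    using less_le_trans[OF _ rad(1)] less_le_trans[OF _ rad(2)]
    by (intro eval_fps_has_fps_expansion; blast)+
  then have "(\<lambda>t. pfun n (comb l) (eval_fps X t) (eval_fps Y t)) has_fps_expansion S"
    unfolding S_def by (rule fps_pfun_has_fps_expansion)
  then obtain \<rho>1 \<kappa> where \<rho>1: "\<rho>1 > 0" "\<kappa> > 0"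
    "\<And>t. t \<in> ball 0 \<rho>1 \<Longrightarrow> \<kappa> * norm t ^ m \<le> norm (pfun n (comb l) (eval_fps X t) (eval_fps Y t))"
    using has_fps_expansion_lower_bound[OF _ S_low S_m] by blast
  define \<rho> where "\<rho> = min \<rho>0 \<rho>1"
  have \<rho>: "\<rho> > 0" "\<rho> \<le> \<rho>0" "\<rho> \<le> \<rho>1" using \<rho>0(1) \<rho>1(1) by (auto simp: \<rho>_def)
  have f_zero: "z \<in> zero_set f \<longleftrightarrow> pfun D (poly2_coeff f) (fst z) (snd z) = 0" for z
    by (simp add: zero_set_def eval2_eq_pfun[OF Df])
  have sing0: "0 \<in> sing_points f"
    using cusp unfolding cusp_def isolated_in_def by blast
  obtain W where W: "open W" "W \<inter> sing_points f = {0}"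
    using cusp unfolding cusp_def isolated_in_def by blast
  obtain y0 where y0: "pfun D (poly2_coeff f) 0 y0 \<noteq> 0"
    using cusp_not_divisible_by_x[OF _ sing0 Df] cusp unfolding cusp_def by blast
  obtain N where N: "bij_betw (\<lambda>t. 0 + (eval_fps X t, eval_fps Y t)) (ball 0 \<rho>) N" "N \<subseteq> zero_set f"
    using \<rho>0(2)[OF \<rho>(1,2)] by blast
  have "n \<le> m"
  proof (rule intersection_order_semicontinuous[where X = "eval_fps X" and Y = "eval_fps Y"
        and a = "poly2_coeff f" and b = "comb l" and ak = "\<lambda>k. poly2_coeff (F (s (\<sigma> k)))"
        and bk = "\<lambda>k. comb (c (\<sigma> k))" and pk = "\<lambda>k. fst (p (\<sigma> k))" and qk = "\<lambda>k. snd (p (\<sigma> k))"])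
    have sub: "ball (0::complex) \<rho> \<subseteq> eball 0 (fps_conv_radius X)" "ball (0::complex) \<rho> \<subseteq> eball 0 (fps_conv_radius Y)"
      using \<rho>0(2)[OF \<rho>(1,2)] by (auto intro!: ball_eball_mono)
    show "eval_fps X holomorphic_on ball 0 \<rho>" "eval_fps Y holomorphic_on ball 0 \<rho>"
      using sub by (auto intro: holomorphic_on_eval_fps)
    show "eval_fps X 0 = 0" "eval_fps Y 0 = 0" using X0 Y0 by (simp_all add: eval_fps_at_0)
    show "inj_on (\<lambda>t. (eval_fps X t, eval_fps Y t)) (ball 0 \<rho>)"
      using bij_betw_imp_inj_on[OF N(1)] by simp
    show "pfun D (poly2_coeff f) (eval_fps X t) (eval_fps Y t) = 0" if "t \<in> ball 0 \<rho>" for t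
      using bij_betwE[OF N(1)] N(2) that f_zero[of "(eval_fps X t, eval_fps Y t)"] by auto
    show "\<exists>U. open U \<and> (0, 0) \<in> U \<and> (\<forall>x y. (x, y) \<in> U \<longrightarrow> pfun D (poly2_coeff f) x y = 0 \<longrightarrow>
        (x, y) \<in> (\<lambda>t. (eval_fps X t, eval_fps Y t)) ` ball 0 \<eta>)" if \<eta>: "0 < \<eta>" "\<eta> \<le> \<rho>" for \<eta>
    proof -
      obtain N U where NU: "bij_betw (\<lambda>t. 0 + (eval_fps X t, eval_fps Y t)) (ball 0 \<eta>) N"
        "open U" "0 \<in> U" "U \<inter> zero_set f \<subseteq> N"
        using \<rho>0(2)[of \<eta>] \<eta> \<rho>(2) by auto
      have "N = (\<lambda>t. (eval_fps X t, eval_fps Y t)) ` ball 0 \<eta>"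
        using bij_betw_imp_surj_on[OF NU(1)] by simp
      then show ?thesis
        using NU f_zero by (intro exI[of _ U]) (auto simp: zero_prod_def)
    qed
    show "(0, 0) \<in> W" using W by (auto simp: zero_prod_def)
    show "(x, y) = (0, 0)" if "(x, y) \<in> W" "pfun D (poly2_coeff f) x y = 0"
      "pfun D (coeff_dx D (poly2_coeff f)) x y = 0" "pfun D (coeff_dy D (poly2_coeff f)) x y = 0" for x y
    proof -
      have "(x, y) \<in> W \<inter> sing_points f" using that mem_sing_points_iff[OF Df, of "(x, y)"] by simp
      then show ?thesis using W(2) by (auto simp: zero_prod_def)
    qed
    show "\<kappa> * norm t ^ m \<le> norm (pfun n (comb l) (eval_fps X t) (eval_fps Y t))" if "t \<in> ball 0 \<rho>" for t
      using \<rho>1(3)[of t] that \<rho>(3) by simp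
    show "(\<lambda>k. poly2_coeff (F (s (\<sigma> k))) i j) \<longlonglongrightarrow> poly2_coeff f i j" for i j
    proof -
      have "(\<lambda>s. poly2_coeff (F s) i j) holomorphic_on ball 0 1"
        using family by (simp add: analytic_family_def poly2_coeff_def)
      then have "isCont (\<lambda>s. poly2_coeff (F s) i j) 0"
        by (metis centre_in_ball continuous_on_eq_continuous_at holomorphic_on_imp_continuous_on
            open_ball zero_less_one)
      moreover have "(\<lambda>k. s (\<sigma> k)) \<longlonglongrightarrow> 0" using LIMSEQ_subseq_LIMSEQ[OF s(2) \<sigma>] by (simp add: o_def)
      ultimately show ?thesis unfolding F(1)[symmetric] by (rule isCont_tendsto_compose)
    qed
    show "(\<lambda>k. comb (c (\<sigma> k)) i j) \<longlonglongrightarrow> comb l i j" for i j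
      unfolding comb_def by (intro tendsto_intros l)
    have "(\<lambda>k. p (\<sigma> k)) \<longlonglongrightarrow> 0" using LIMSEQ_subseq_LIMSEQ[OF p \<sigma>] by (simp add: o_def)
    from tendsto_fst[OF this] tendsto_snd[OF this]
    show "(\<lambda>k. fst (p (\<sigma> k))) \<longlonglongrightarrow> 0" "(\<lambda>k. snd (p (\<sigma> k))) \<longlonglongrightarrow> 0" by simp_all
  qed (fact \<rho>(1) W(1) y0 \<rho>1(2) arcs[unfolded vanishing_def])+
  then show False using m(1) by (simp add: T_def)
qed

end
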